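(* For each $n\ge1$ let $\mathcal T^{(n)}$ be a (deterministic or random) tree with $n$ vertices and let $r_n>0$. Conditioned on $\mathcal T^{(n)}$, let each edge $e$ be deleted at a random time $T_e$, where the $T_e$ are i.i.d. with the exponential distribution $\mathrm{Exp}(r_n)$ of rate $r_n$. Let $X^{(n)}(\cdot)=(X^{(n)}_i(\cdot))_{i=1}^\infty$ be the fragmentation process of normalized component sizes (see context). Suppose that $X^{(n)}(\cdot)$ converges in the sense of finite-dimensional distributions to some stochastic process $X(\cdot)$ in $D(\mathbb R_+,\mathbb S^{\downarrow})$. Then $X^{(n)}(\cdot)\to X(\cdot)$ in distribution in $D(\mathbb R_+,\mathbb S^{\downarrow}_{\le1})$.
   Context: $\mathbb R_+:=[0,\infty)$. $\mathbb S^{\downarrow}:=\{(x_i)_{i=1}^\infty: x_1\ge x_2\ge\dots\ge0\}$ with the product topology (as a subspace of $\mathbb R^\infty$), and $\mathbb S^{\downarrow}_{\le1}:=\{(x_i)\in\mathbb S^{\downarrow}:\sum_i x_i\le1\}$ with the subspace topology. For $\mathbb S$ one of these spaces, $D(\mathbb R_+,\mathbb S)$ is the space of càdlàg functions $\mathbb R_+\to\mathbb S$ with the Skorohod $J_1$ topology. Finite-dimensional convergence of $X^{(n)}(\cdot)$ to $X(\cdot)$ means that $(X^{(n)}(t_i))_{i=1}^m\to(X(t_i))_{i=1}^m$ in distribution for every fixed finite sequence $t_1,\dots,t_m\in\mathbb R_+$. Let $\mathcal T^{(n)}(t)$ be the forest obtained from $\mathcal T^{(n)}$ by removing all edges deleted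 up to time $t$ (i.e. with $T_e\le t$; $\mathcal T^{(n)}(0)=\mathcal T^{(n)}$), with components $\mathcal T^{(n)}_i(t)$, $i=1,\dots,\nu^{(n)}(t)$, arranged in order of decreasing size (number of vertices). Set $X^{(n)}_i(t):=|\mathcal T^{(n)}_i(t)|/n$ for $i\le\nu^{(n)}(t)$ and $X^{(n)}_i(t):=0$ for $i>\nu^{(n)}(t)$. In particular $X^{(n)}(0)=(1,0,0,\dots)$. *)

theory Defs
  imports "HOL-Probability.Probability"
begin

section \<open>Convergence in distribution in a topological space\<close>

definition borel_of :: "'a topology \<Rightarrow> 'a measure" where
  "borel_of T = sigma (topspace T) {U. openin T U}"

text \<open>Sequences are indexed by \<open>n \<ge> 1\<close>; what happens at \<open>n = 0\<close> is irrelevant. Each \<open>X n\<close> lives on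
  its own probability space \<open>M n\<close>, and the limit \<open>Y\<close> lives on \<open>N\<close>.\<close>

definition converges_in_distribution ::
    "'s topology \<Rightarrow> (nat \<Rightarrow> 'a measure) \<Rightarrow> (nat \<Rightarrow> 'a \<Rightarrow> 's) \<Rightarrow> 'b measure \<Rightarrow> ('b \<Rightarrow> 's) \<Rightarrow> bool" where
  "converges_in_distribution T M X N Y \<longleftrightarrow>
     (\<forall>n\<ge>1. X n \<in> measurable (M n) (borel_of T)) \<and>
     Y \<in> measurable N (borel_of T) \<and>
     (\<forall>f. continuous_map T euclideanreal f \<and> bounded (f ` topspace T) \<longrightarrow>
        (\<lambda>n. \<integral>\<omega>. f (X n \<omega>) \<partial>M n) \<longlonglongrightarrow> (\<integral>\<omega>. f (Y \<omega>) \<partial>N))"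

definition fdd_converges ::
    "'s topology \<Rightarrow> (nat \<Rightarrow> 'a measure) \<Rightarrow> (nat \<Rightarrow> 'a \<Rightarrow> real \<Rightarrow> 's) \<Rightarrow> 'b measure \<Rightarrow> ('b \<Rightarrow> real \<Rightarrow> 's) \<Rightarrow> bool"
  where
  "fdd_converges S M X N Y \<longleftrightarrow>
     (\<forall>(m::nat) t. (\<forall>i<m. 0 \<le> t i) \<longrightarrow>
        converges_in_distribution (product_topology (\<lambda>_. S) {..<m})
          M (\<lambda>n \<omega>. \<lambda>i\<in>{..<m}. X n \<omega> (t i)) N (\<lambda>\<omega>. \<lambda>i\<in>{..<m}. Y \<omega> (t i)))"


section \<open>The Skorohod space of cadlag functions\<close>

text \<open>Paths are functions on \<open>[0, \<infinity>)\<close>, represented extensionally (\<open>undefined\<close> at negative times).\<close>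

definition cadlag_space :: "'s::metric_space set \<Rightarrow> (real \<Rightarrow> 's) set" where
  "cadlag_space S = {x \<in> {0..} \<rightarrow>\<^sub>E S.
     (\<forall>t\<ge>0. (x \<longlongrightarrow> x t) (at_right t)) \<and>
     (\<forall>t>0. \<exists>l\<in>S. (x \<longlongrightarrow> l) (at_left t))}"

text \<open>An increasing bijection of \<open>[0, \<infinity>)\<close> is automatically continuous and fixes 0.\<close>

definition time_change :: "(real \<Rightarrow> real) \<Rightarrow> bool" where
  "time_change l \<longleftrightarrow> strict_mono_on {0..} l \<and> l ` {0..} = {0..}"

definition skorohod_nhd :: "'s::metric_space set \<Rightarrow> (real \<Rightarrow> 's) \<Rightarrow> real \<Rightarrow> real \<Rightarrow> (real \<Rightarrow> 's) set" where
  "skorohod_nhd S x e K = {y \<in> cadlag_space S. \<exists>l. time_change l \<and>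
     (\<forall>s\<ge>0. \<bar>l s - s\<bar> < e) \<and> (\<forall>s\<in>{0..K}. dist (y (l s)) (x s) < e)}"

text \<open>The \<open>J\<^sub>1\<close> topology is metrizable, and \<open>x\<^sub>n \<rightarrow> x\<close> holds in it iff there are time changes \<open>l\<^sub>n\<close> with
  \<open>sup\<^sub>s \<bar>l\<^sub>n s - s\<bar> \<rightarrow> 0\<close> and \<open>sup\<^sub>s\<^sub>\<le>\<^sub>K dist (x\<^sub>n (l\<^sub>n s)) (x s) \<rightarrow> 0\<close> for every \<open>K\<close> (Jacod and Shiryaev,
  Theorem VI.1.14; Ethier and Kurtz, Proposition 3.5.3), that is, iff \<open>x\<^sub>n\<close> is eventually in
  \<open>skorohod_nhd S x e K\<close> for all \<open>e > 0\<close> and \<open>K\<close>. As this family is countably generated, the sets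
  declared open below are exactly the sequentially open ones, which are the \<open>J\<^sub>1\<close>-open ones.\<close>

definition skorohod_J1 :: "'s::metric_space set \<Rightarrow> (real \<Rightarrow> 's) topology" where
  "skorohod_J1 S = topology (\<lambda>U. U \<subseteq> cadlag_space S \<and>
     (\<forall>x\<in>U. \<exists>e>0. \<exists>K\<ge>0. skorohod_nhd S x e K \<subseteq> U))"

lemma skorohod_nhd_mono:
  "e \<le> e' \<Longrightarrow> K' \<le> K \<Longrightarrow> skorohod_nhd S x e K \<subseteq> skorohod_nhd S x e' K'"
  unfolding skorohod_nhd_def by force

lemma openin_skorohod_J1:
  "openin (skorohod_J1 S) U \<longleftrightarrow> U \<subseteq> cadlag_space S \<and>
     (\<forall>x\<in>U. \<exists>e>0. \<exists>K\<ge>0. skorohod_nhd S x e K \<subseteq> U)"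
proof -
  let ?P = "\<lambda>U. U \<subseteq> cadlag_space S \<and> (\<forall>x\<in>U. \<exists>e>0. \<exists>K\<ge>0. skorohod_nhd S x e K \<subseteq> U)"
  have "istopology ?P"
    unfolding istopology_def
  proof (intro conjI allI impI)
    fix U V assume U: "?P U" and V: "?P V"
    show "U \<inter> V \<subseteq> cadlag_space S" using U by blast
    show "\<forall>x\<in>U \<inter> V. \<exists>e>0. \<exists>K\<ge>0. skorohod_nhd S x e K \<subseteq> U \<inter> V"
    proof
      fix x assume "x \<in> U \<inter> V"
      with U V obtain e K e' K'
        where *: "e > 0" "K \<ge> 0" "skorohod_nhd S x e K \<subseteq> U" "e' > 0" "K' \<ge> 0" "skorohod_nhd S x e' K' \<subseteq> V"
        by (metis IntD1 IntD2)
      have "skorohod_nhd S x (min e e') (max K K') \<subseteq> U \<inter> V"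
        using *(3,6) skorohod_nhd_mono[of "min e e'" e K "max K K'" S x]
          skorohod_nhd_mono[of "min e e'" e' K' "max K K'" S x] by auto
      then show "\<exists>e>0. \<exists>K\<ge>0. skorohod_nhd S x e K \<subseteq> U \<inter> V"
        using * by (intro exI[of _ "min e e'"] exI[of _ "max K K'"] conjI) auto
    qed
  next
    fix \<U> assume "\<forall>U\<in>\<U>. ?P U"
    then show "\<Union>\<U> \<subseteq> cadlag_space S"
      and "\<forall>x\<in>\<Union>\<U>. \<exists>e>0. \<exists>K\<ge>0. skorohod_nhd S x e K \<subseteq> \<Union>\<U>"
      by (blast, meson Union_iff Union_upper subset_trans)
  qed
  then show ?thesis
    unfolding skorohod_J1_def by (simp add: topology_inverse')
qed

lemma topspace_skorohod_J1: "topspace (skorohod_J1 S) = cadlag_space S"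
proof -
  have "openin (skorohod_J1 S) (cadlag_space S)"
    unfolding openin_skorohod_J1 skorohod_nhd_def by (auto intro!: exI[of _ 1])
  then show ?thesis
    using openin_subset openin_topspace openin_skorohod_J1 by (metis subset_antisym)
qed


section \<open>The state spaces\<close>

text \<open>The type \<^typ>\<open>nat \<Rightarrow> real\<close> carries the product topology, and \<^const>\<open>dist\<close> on it induces that
  topology. Sequences are indexed from 0.\<close>

definition S_dec :: "(nat \<Rightarrow> real) set" where
  "S_dec = {x. decseq x \<and> (\<forall>i. 0 \<le> x i)}"

definition S_dec_le1 :: "(nat \<Rightarrow> real) set" where
  "S_dec_le1 = {x \<in> S_dec. summable x \<and> (\<Sum>i. x i) \<le> 1}"


section \<open>Trees and their fragmentation\<close>

text \<open>A graph is a pair of a vertex set and a set of undirected edges \<open>{u, v}\<close>.\<close>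

type_synonym 'v ugraph = "'v set \<times> 'v set set"

definition finite_simple_graph :: "'v ugraph \<Rightarrow> bool" where
  "finite_simple_graph G \<longleftrightarrow> finite (fst G) \<and>
     (\<forall>e\<in>snd G. \<exists>u\<in>fst G. \<exists>v\<in>fst G. u \<noteq> v \<and> e = {u, v})"

definition adjacent :: "'v ugraph \<Rightarrow> 'v \<Rightarrow> 'v \<Rightarrow> bool" where
  "adjacent G u v \<longleftrightarrow> {u, v} \<in> snd G"

definition is_cycle :: "'v ugraph \<Rightarrow> 'v list \<Rightarrow> bool" where
  "is_cycle G p \<longleftrightarrow> 3 \<le> length p \<and> distinct p \<and> successively (adjacent G) p \<and> adjacent G (last p) (hd p)"

definition connection :: "'v ugraph \<Rightarrow> 'v rel" where
  "connection G = {(u, v) \<in> fst G \<times> fst G. (adjacent G)\<^sup>*\<^sup>* u v}"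

definition components_of :: "'v ugraph \<Rightarrow> 'v set set" where
  "components_of G = fst G // connection G"

definition is_tree :: "'v ugraph \<Rightarrow> bool" where
  "is_tree G \<longleftrightarrow> finite_simple_graph G \<and> fst G \<noteq> {} \<and>
     (\<forall>u\<in>fst G. \<forall>v\<in>fst G. (u, v) \<in> connection G) \<and> (\<nexists>p. is_cycle G p)"

definition component_sizes :: "'v ugraph \<Rightarrow> nat list" where
  "component_sizes G = rev (sorted_list_of_multiset (image_mset card (mset_set (components_of G))))"

definition delete_up_to :: "'v ugraph \<Rightarrow> ('v set \<Rightarrow> real) \<Rightarrow> real \<Rightarrow> 'v ugraph" where
  "delete_up_to G \<tau> t = (fst G, {e \<in> snd G. \<not> \<tau> e \<le> t})"

definition fragmentation :: "nat \<Rightarrow> 'v ugraph \<Rightarrow> ('v set \<Rightarrow> real) \<Rightarrow> real \<Rightarrow> nat \<Rightarrow> real" where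
  "fragmentation n G \<tau> = (\<lambda>t\<in>{0..}. \<lambda>i.
     let L = component_sizes (delete_up_to G \<tau> t)
     in if i < length L then real (L ! i) / real n else 0)"

text \<open>The random graph \<open>T\<close> takes countably many values in the intended use, so conditioning on \<open>T\<close>
  is conditioning on each event \<open>T = G\<close> of positive probability. The clock \<open>\<tau> e\<close> is relevant only
  where \<open>e\<close> is an edge of \<open>T\<close>.\<close>

definition iid_exponential_clocks ::
    "'a measure \<Rightarrow> ('a \<Rightarrow> 'v ugraph) \<Rightarrow> real \<Rightarrow> ('v set \<Rightarrow> 'a \<Rightarrow> real) \<Rightarrow> bool" where
  "iid_exponential_clocks M T r \<tau> \<longleftrightarrow>
     (\<forall>e. \<tau> e \<in> borel_measurable M) \<and>
     (\<forall>G. measure M {\<omega> \<in> space M. T \<omega> = G} > 0 \<longrightarrow>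
        (let C = uniform_measure M {\<omega> \<in> space M. T \<omega> = G} in
           prob_space.indep_vars C (\<lambda>_. borel) \<tau> (snd G) \<and>
           (\<forall>e\<in>snd G. distributed C lborel (\<tau> e) (exponential_density r))))"

end

theory Submission
  imports Defs
begin


section \<open>Time changes\<close>

text \<open>Let q(t) be the proportion of ordered vertex pairs still connected at time t
  (\<open>connected_fraction\<close>). It decreases within [0, 1] and controls the process: when q
  loses d, no normalized ranked component size moves by more than sqrt d
  (\<open>component_profile_diff_le\<close>). It therefore suffices that large drops of q do not
  cluster.

  In a tree a pair is connected exactly as long as all edges of its path survive
  (\<open>tree_path_edges_ex\<close>). By memorylessness, an intact path is cut within the next
  \<delta> with the same probability as in a fresh tree. Summed over pairs, the mean loss of q in a
  window of length \<delta> after a stopping time is at most E(1 - q(\<delta>))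
  (\<open>expectation_drop_after_drop_time\<close>). Greedily record the grid times at which q has
  fallen by \<eta> since the last record. There are at most 1 + 1/\<eta> of them, and by Markov's
  inequality some record is followed by another drop of \<eta> within 1/m with probability at most
  (1 + 1/\<eta>)/\<eta> * E(1 - q(1/m)), however fine the grid
  (\<open>prob_clustered_drops_le\<close>). Since 1 - q is at most twice the mass missing from the
  largest component, finite-dimensional convergence makes this small for large m and n: the limit
  starts from one full component and is right-continuous (\<open>limit_initial_mass\<close>).

  Off that event the path sampled at mesh 1/(mL) is Skorohod-close to the path sampled at mesh 1/m
  (\<open>sk_close_discretize_fragmentation\<close>), and L \<rightarrow> \<infinity> compares the
  path itself with its sample (\<open>discretization_error\<close>). The sample is a continuous
  function of finitely many values, so the hypothesis applies to it. This yields convergence of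
  means for bounded functionals that are Lipschitz for the gauge \<open>sk_close\<close>
  (\<open>lipschitz_tendsto\<close>). Every bounded continuous functional is a pointwise limit from
  below of Lipschitz envelopes (\<open>lip_env_tendsto\<close>); lower bounds for it and for its
  negative give \<open>skorohod_convergence\<close>.

  The limit is given in \<open>S_dec\<close> only. Bounds on partial sums pass to it almost surely
  at rational times (\<open>AE_partial_mass_le\<close>) and by right-continuity to all times, so it
  has a version with paths of mass at most 1.\<close>

lemma time_change_id: "time_change (\<lambda>s. s)"
  by (auto simp: time_change_def strict_mono_on_def)

lemma time_change_nonneg: "time_change l \<Longrightarrow> 0 \<le> s \<Longrightarrow> 0 \<le> l s"
  unfolding time_change_def by (metis atLeast_iff imageI)

lemma time_change_surj:
  assumes "time_change l" "0 \<le> y" obtains s where "0 \<le> s" "l s = y"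
proof -
  have "y \<in> l ` {0..}" using assms by (simp add: time_change_def)
  then show ?thesis using that by auto
qed

lemma time_change_le_iff:
  assumes "time_change l" "0 \<le> s" "0 \<le> t"
  shows "l s \<le> l t \<longleftrightarrow> s \<le> t"
  using assms unfolding time_change_def strict_mono_on_def
  by (metis atLeast_iff leD le_less_linear less_le)

lemma time_change_comp:
  assumes "time_change l" "time_change m"
  shows "time_change (\<lambda>s. m (l s))"
proof -
  have "(\<lambda>s. m (l s)) ` {0..} = m ` (l ` {0..})" by (simp add: image_image)
  then show ?thesis
    using assms time_change_nonneg[OF assms(1)] unfolding time_change_def strict_mono_on_def by auto
qed

lemma time_change_inverse:
  assumes l: "time_change l"
  obtains m where "time_change m" "\<And>s. 0 \<le> s \<Longrightarrow> l (m s) = s"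
proof -
  define m where "m = the_inv_into {0..} l"
  have inj: "inj_on l {0..}" and im: "l ` {0..} = {0..}"
    using l unfolding time_change_def by (auto intro: strict_mono_on_imp_inj_on)
  have m: "l (m s) = s" "0 \<le> m s" if "0 \<le> s" for s
    using f_the_inv_into_f[OF inj, of s] the_inv_into_into[OF inj, of s "{0..}"] that im
    by (auto simp: m_def)
  have "strict_mono_on {0..} m"
    unfolding strict_mono_on_def using m time_change_le_iff[OF l] by (metis atLeast_iff not_le)
  moreover have "m ` {0..} = {0..}"
    using the_inv_into_onto[OF inj] im by (simp add: m_def)
  ultimately show ?thesis
    using m that by (auto simp: time_change_def)
qed

text \<open>Continuing a time change beyond \<open>a\<close> with constant slope keeps it an
  increasing bijection; in the interpolation below one such gluing adds a node and another the
  unbounded last piece.\<close>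

lemma time_change_affine_from:
  assumes l: "time_change l" and c: "0 < c" and a: "0 \<le> a"
  shows "time_change (\<lambda>s. if s \<le> a then l s else l a + c * (s - a))" (is "time_change ?m")
proof -
  have sm: "?m s < ?m t" if "0 \<le> s" "s < t" for s t
  proof (cases "t \<le> a")
    case True
    then show ?thesis using that l unfolding time_change_def strict_mono_on_def by auto
  next
    case False
    show ?thesis
    proof (cases "s \<le> a")
      case True
      have "l s \<le> l a" using time_change_le_iff[OF l that(1) a] True by simp
      moreover have "0 < c * (t - a)" using c False by simp
      ultimately show ?thesis using False True by simp
    next
      case F: False
      then show ?thesis using False that c by simp
    qed
  qed
  have "y \<in> ?m ` {0..}" if "0 \<le> y" for y
  proof (cases "y \<le> l a")
    case True
    obtain s where "0 \<le> s" "l s = y" using time_change_surj[OF l \<open>0 \<le> y\<close>] .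
    moreover have "s \<le> a" using True calculation time_change_le_iff[OF l _ a, of s] by simp
    ultimately show ?thesis by (intro image_eqI[of _ _ s]) auto
  next
    case False
    define s where "s = a + (y - l a) / c"
    have "s > a" using False c by (simp add: s_def)
    moreover have "l a + c * (s - a) = y" using c by (simp add: s_def)
    ultimately show ?thesis using a by (intro image_eqI[of _ _ s]) auto
  qed
  moreover have "?m s \<in> {0..}" if "0 \<le> s" for s
    using time_change_nonneg[OF l that] time_change_nonneg[OF l a] c by auto
  ultimately have "?m ` {0..} = {0..}" by fast
  then show ?thesis
    unfolding time_change_def using sm by (simp add: strict_mono_on_def)
qed

text \<open>Linear interpolation through the points (p, q p), adding the largest node last. The
  displacement \<open>l s - s\<close> is affine between nodes, so its bound at the nodes extends to
  everything between them.\<close>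

lemma time_change_extending_ex:
  fixes q :: "real \<Rightarrow> real"
  assumes "finite F" "\<And>p. p \<in> F \<Longrightarrow> 0 < p \<and> 0 < q p \<and> \<bar>q p - p\<bar> \<le> e"
    "strict_mono_on F q" "0 \<le> e"
  shows "\<exists>l. time_change l \<and> (\<forall>p\<in>F. l p = q p) \<and> (\<forall>s\<ge>0. \<bar>l s - s\<bar> \<le> e)"
  using assms
proof (induction F rule: finite_linorder_max_induct)
  case empty
  then show ?case using time_change_id by (intro exI[of _ "\<lambda>s. s"]) auto
next
  case (insert b F)
  have "strict_mono_on F q" using insert.prems(2) by (auto simp: strict_mono_on_def)
  then obtain l where l: "time_change l" "\<forall>p\<in>F. l p = q p" "\<forall>s\<ge>0. \<bar>l s - s\<bar> \<le> e"
    using insert by auto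
  \<comment> \<open>The largest earlier node, or 0 if there is none; \<open>l\<close> is overwritten
    beyond it.\<close>
  define a where "a = Max (insert 0 F)"
  have fin: "finite (insert 0 F)" using insert by simp
  have a0: "0 \<le> a" unfolding a_def using fin by simp
  have aF: "p \<le> a" if "p \<in> F" for p unfolding a_def using fin that by simp
  have a_in: "a \<in> insert 0 F" unfolding a_def using fin Max_in by blast
  have l0: "l 0 = 0"
  proof -
    obtain s where "0 \<le> s" "l s = 0" using time_change_surj[OF l(1), of 0] by auto
    moreover from this have "l 0 \<le> l s" using time_change_le_iff[OF l(1), of 0 s] by simp
    ultimately show ?thesis using time_change_nonneg[OF l(1), of 0] by simp
  qed
  have ab: "a < b" using a_in insert by auto
  have lab: "l a < q b"
    using a_in l0 l(2) insert.prems(1)[of b] insert.prems(2) insert.hyps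
    by (auto simp: strict_mono_on_def)
  define c where "c = (q b - l a) / (b - a)"
  have c: "c > 0" using ab lab by (simp add: c_def)
  define m where "m = (\<lambda>s. if s \<le> a then l s else l a + c * (s - a))"
  \<comment> \<open>Slope 1 past the last node keeps the displacement equal to
    \<open>q b - b\<close>.\<close>
  define k where "k = (\<lambda>s. if s \<le> b then m s else m b + 1 * (s - b))"
  have m: "time_change m" unfolding m_def by (rule time_change_affine_from[OF l(1) c a0])
  have k: "time_change k" unfolding k_def using ab a0 by (intro time_change_affine_from[OF m]) auto
  have mb: "m b = q b" using ab by (simp add: m_def c_def)
  have "\<bar>k s - s\<bar> \<le> e" if s: "0 \<le> s" for s
  proof -
    consider "s \<le> a" | "a < s" "s \<le> b" | "b < s" by linarith
    then show ?thesis
    proof cases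
      case 1
      then show ?thesis using l(3) s ab by (simp add: k_def m_def)
    next
      case 2
      \<comment> \<open>Relative position of \<open>s\<close> between the nodes, which makes the
        displacement at \<open>s\<close> a convex combination of those at \<open>a\<close> and
        \<open>b\<close>.\<close>
      define \<theta> where "\<theta> = (s - a) / (b - a)"
      have th: "0 \<le> \<theta>" "\<theta> \<le> 1" using 2 ab by (auto simp: \<theta>_def)
      have "\<theta> * (b - a) = s - a" using ab by (simp add: \<theta>_def)
      moreover have "c * (s - a) = \<theta> * (q b - l a)" by (simp add: c_def \<theta>_def)
      ultimately have "k s - s = (1 - \<theta>) * (l a - a) + \<theta> * (q b - b)"
        using 2 by (simp add: k_def m_def algebra_simps)
      also have "\<bar>\<dots>\<bar> \<le> (1 - \<theta>) * e + \<theta> * e"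
      proof -
        have "\<bar>(1 - \<theta>) * (l a - a)\<bar> \<le> (1 - \<theta>) * e"
          using th l(3) a0 by (simp add: abs_mult mult_left_mono)
        moreover have "\<bar>\<theta> * (q b - b)\<bar> \<le> \<theta> * e"
          using th insert.prems(1)[of b] by (simp add: abs_mult mult_left_mono)
        ultimately show ?thesis by linarith
      qed
      finally show ?thesis by (simp add: algebra_simps)
    next
      case 3
      then show ?thesis using mb insert.prems(1)[of b] by (simp add: k_def)
    qed
  qed
  moreover have "k p = q p" if "p \<in> insert b F" for p
  proof (cases "p = b")
    case True
    then show ?thesis using mb by (simp add: k_def)
  next
    case False
    then show ?thesis using that l(2) aF[of p] ab by (auto simp: k_def m_def)
  qed
  ultimately show ?case using k by blast
qed


section \<open>A gauge for the Skorohod topology\<close>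

lemma tendsto_fun_component:
  fixes x :: "'a \<Rightarrow> nat \<Rightarrow> real"
  assumes "(x \<longlongrightarrow> l) F" shows "((\<lambda>s. x s i) \<longlongrightarrow> l i) F"
proof -
  have "continuous_on UNIV (\<lambda>f::nat \<Rightarrow> real. f i)" by (rule continuous_on_product_coordinates)
  then have "isCont (\<lambda>f::nat \<Rightarrow> real. f i) l" using continuous_on_eq_continuous_at[OF open_UNIV] by blast
  then show ?thesis using assms by (rule isCont_tendsto_compose)
qed

lemma S_dec_le1_partial_sum:
  assumes "a \<in> S_dec_le1" shows "(\<Sum>j<n. a j) \<le> 1"
proof -
  have "(\<Sum>j<n. a j) \<le> suminf a"
    using assms by (intro sum_le_suminf) (auto simp: S_dec_le1_def S_dec_def)
  then show ?thesis using assms by (auto simp: S_dec_le1_def)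
qed

lemma S_dec_le1I:
  assumes "a \<in> S_dec" "\<And>n. (\<Sum>j<n. a j) \<le> 1"
  shows "a \<in> S_dec_le1"
proof -
  have "summable a"
    using assms by (intro summableI_nonneg_bounded[where x=1]) (auto simp: S_dec_def)
  then show ?thesis using assms by (auto simp: S_dec_le1_def intro!: suminf_le_const)
qed

text \<open>The first i + 1 entries are all at least \<open>a i\<close> and sum to at most 1. This
  uniform decay of tails turns coordinatewise control into control uniform in the index.\<close>

lemma S_dec_le1_bounds:
  assumes "a \<in> S_dec_le1"
  shows "0 \<le> a i" "a i \<le> inverse (1 + real i)" "a i \<le> 1"
proof -
  show 0: "0 \<le> a i" using assms by (auto simp: S_dec_le1_def S_dec_def)
  have "real (Suc i) * a i = (\<Sum>j<Suc i. a i)" by simp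
  also have "\<dots> \<le> (\<Sum>j<Suc i. a j)"
    using assms by (intro sum_mono) (auto simp: S_dec_le1_def S_dec_def decseq_def)
  also have "\<dots> \<le> 1" by (rule S_dec_le1_partial_sum[OF assms])
  finally show "a i \<le> inverse (1 + real i)" by (simp add: field_simps)
  also have "\<dots> \<le> 1" by (simp add: field_simps)
  finally show "a i \<le> 1" .
qed

text \<open>A bound on a partial sum is closed under coordinatewise limits, so left limits found in
  \<open>S_dec\<close> automatically have mass at most 1.\<close>

lemma cadlag_space_S_dec_le1_iff:
  "x \<in> cadlag_space S_dec_le1 \<longleftrightarrow> x \<in> cadlag_space S_dec \<and> (\<forall>t\<ge>0. x t \<in> S_dec_le1)"
proof (intro iffI conjI allI impI)
  have sub: "S_dec_le1 \<subseteq> S_dec" by (auto simp: S_dec_le1_def)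
  assume x: "x \<in> cadlag_space S_dec_le1"
  have "x \<in> {0..} \<rightarrow>\<^sub>E S_dec" using x sub by (auto simp: cadlag_space_def PiE_def Pi_def)
  moreover have "\<exists>l\<in>S_dec. (x \<longlongrightarrow> l) (at_left t)" if "0 < t" for t
  proof -
    obtain l where "l \<in> S_dec_le1" "(x \<longlongrightarrow> l) (at_left t)"
      using x \<open>0 < t\<close> by (auto simp: cadlag_space_def)
    then show ?thesis using sub by blast
  qed
  ultimately show "x \<in> cadlag_space S_dec" using x by (simp add: cadlag_space_def)
  fix t :: real assume "0 \<le> t"
  then show "x t \<in> S_dec_le1" using x by (auto simp: cadlag_space_def PiE_def)
next
  assume x: "x \<in> cadlag_space S_dec \<and> (\<forall>t\<ge>0. x t \<in> S_dec_le1)"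
  have "\<exists>l\<in>S_dec_le1. (x \<longlongrightarrow> l) (at_left t)" if t: "0 < t" for t
  proof -
    obtain l where l: "l \<in> S_dec" "(x \<longlongrightarrow> l) (at_left t)"
      using x t by (auto simp: cadlag_space_def)
    have "(\<Sum>j<n. l j) \<le> 1" for n
    proof (rule tendsto_upperbound)
      show "((\<lambda>s. \<Sum>j<n. x s j) \<longlongrightarrow> (\<Sum>j<n. l j)) (at_left t)"
        by (rule tendsto_sum) (rule tendsto_fun_component[OF l(2)])
      show "\<forall>\<^sub>F s in at_left t. (\<Sum>j<n. x s j) \<le> 1"
        using eventually_at_left_real[OF t] by eventually_elim (use x S_dec_le1_partial_sum in auto)
    qed (simp add: trivial_limit_at_left_real)
    then show ?thesis using l S_dec_le1I by blast
  qed
  then show "x \<in> cadlag_space S_dec_le1"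
    using x by (auto simp: cadlag_space_def PiE_def)
qed

text \<open>The product metric adds truncated coordinate differences with weights 1, 1/2, 1/4, ...,
  whose total is 2.\<close>

lemma dist_fun_le:
  fixes a b :: "nat \<Rightarrow> real"
  assumes "\<And>i. \<bar>a i - b i\<bar> \<le> e"
  shows "dist a b \<le> 2 * e"
proof -
  have s: "summable (\<lambda>n. (1/2::real)^n)" by (simp add: summable_geometric_iff)
  have "dist a b \<le> (\<Sum>n. (1/2)^n * e)"
    unfolding dist_fun_def
  proof (rule suminf_le)
    show "summable (\<lambda>n. (1/2)^n * min (dist (a (from_nat n)) (b (from_nat n))) 1)"
      by (rule summable_comparison_test'[OF s]) auto
    show "summable (\<lambda>n. (1/2)^n * e)" by (rule summable_mult2[OF s])
  qed (use assms in \<open>auto simp: dist_real_def min_le_iff_disj\<close>)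
  also have "\<dots> = 2 * e" using suminf_mult2[OF s, of e] suminf_geometric[of "1/2::real"] by simp
  finally show ?thesis .
qed

section \<open>The weighted gauge and its triangle inequality\<close>

text \<open>The weight makes the far future negligible; comparing weighted values at the changed time on
  both sides, rather than weighting the difference, yields an exact triangle inequality.\<close>

definition sk_close :: "real \<Rightarrow> (real \<Rightarrow> nat \<Rightarrow> real) \<Rightarrow> (real \<Rightarrow> nat \<Rightarrow> real) \<Rightarrow> bool" where
  "sk_close e x y \<longleftrightarrow> (\<exists>l. time_change l \<and> (\<forall>s\<ge>0. \<bar>l s - s\<bar> \<le> e \<and>
     (\<forall>i. \<bar>inverse (1 + s) * x s i - inverse (1 + l s) * y (l s) i\<bar> \<le> e)))"

lemma sk_close_refl: "sk_close 0 x x"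
  unfolding sk_close_def by (intro exI[of _ "\<lambda>s. s"]) (simp add: time_change_id)

lemma sk_close_mono: "sk_close e x y \<Longrightarrow> e \<le> e' \<Longrightarrow> sk_close e' x y"
  unfolding sk_close_def by (meson order_trans)

lemma sk_close_nonneg: "sk_close e x y \<Longrightarrow> 0 \<le> e"
  unfolding sk_close_def by (metis abs_ge_zero order_trans order_refl)

text \<open>The inverse time change works, because the two weighted values enter
  symmetrically.\<close>

lemma sk_close_sym:
  assumes "sk_close e x y" shows "sk_close e y x"
proof -
  obtain l where l: "time_change l" and
    c: "\<And>s. 0 \<le> s \<Longrightarrow> \<bar>l s - s\<bar> \<le> e \<and>
     (\<forall>i. \<bar>inverse (1 + s) * x s i - inverse (1 + l s) * y (l s) i\<bar> \<le> e)"
    using assms unfolding sk_close_def by blast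
  obtain m where m: "time_change m" "\<And>s. 0 \<le> s \<Longrightarrow> l (m s) = s"
    using time_change_inverse[OF l] by blast
  show ?thesis
    unfolding sk_close_def
  proof (intro exI[of _ m] conjI allI impI m(1))
    fix s :: real and i assume s: "0 \<le> s"
    note * = c[OF time_change_nonneg[OF m(1) s], unfolded m(2)[OF s]]
    show "\<bar>m s - s\<bar> \<le> e" using * by (simp add: abs_minus_commute)
    show "\<bar>inverse (1 + s) * y s i - inverse (1 + m s) * x (m s) i\<bar> \<le> e"
      using * by (simp add: abs_minus_commute)
  qed
qed

lemma sk_close_trans:
  assumes "sk_close e x y" "sk_close e' y z"
  shows "sk_close (e + e') x z"
proof -
  obtain l where l: "time_change l" and
    c: "\<And>s. 0 \<le> s \<Longrightarrow> \<bar>l s - s\<bar> \<le> e \<and>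
     (\<forall>i. \<bar>inverse (1 + s) * x s i - inverse (1 + l s) * y (l s) i\<bar> \<le> e)"
    using assms unfolding sk_close_def by blast
  obtain m where m: "time_change m" and
    c': "\<And>s. 0 \<le> s \<Longrightarrow> \<bar>m s - s\<bar> \<le> e' \<and>
     (\<forall>i. \<bar>inverse (1 + s) * y s i - inverse (1 + m s) * z (m s) i\<bar> \<le> e')"
    using assms unfolding sk_close_def by blast
  show ?thesis
    unfolding sk_close_def
  proof (intro exI[of _ "\<lambda>s. m (l s)"] conjI allI impI time_change_comp[OF l m])
    fix s :: real and i assume s: "0 \<le> s"
    note 1 = c[OF s] and 2 = c'[OF time_change_nonneg[OF l s]]
    show "\<bar>m (l s) - s\<bar> \<le> e + e'" using 1 2 by linarith
    show "\<bar>inverse (1 + s) * x s i - inverse (1 + m (l s)) * z (m (l s)) i\<bar> \<le> e + e'"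
      using conjunct2[OF 1, rule_format, of i] conjunct2[OF 2, rule_format, of i] by linarith
  qed
qed

lemma inverse_1_plus_diff:
  fixes s t :: real
  assumes "0 \<le> s" "0 \<le> t"
  shows "\<bar>inverse (1 + s) - inverse (1 + t)\<bar> \<le> \<bar>s - t\<bar>"
proof -
  have "inverse (1 + s) - inverse (1 + t) = (t - s) * (inverse (1 + s) * inverse (1 + t))"
    using assms by (simp add: field_simps)
  moreover have "inverse (1 + s) * inverse (1 + t) \<le> 1"
    using assms by (intro mult_le_one) (auto simp: field_simps)
  ultimately show ?thesis
    using assms by (simp add: abs_mult abs_minus_commute mult_left_le)
qed

lemma weighted_diff_le:
  fixes s t :: real
  assumes "0 \<le> s" "0 \<le> t" "\<bar>b\<bar> \<le> 1" "\<bar>s - t\<bar> \<le> e" "\<bar>a - b\<bar> \<le> e'"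
  shows "\<bar>inverse (1 + s) * a - inverse (1 + t) * b\<bar> \<le> e + e'"
proof -
  have "inverse (1 + s) * a - inverse (1 + t) * b =
      inverse (1 + s) * (a - b) + (inverse (1 + s) - inverse (1 + t)) * b"
    by (simp add: algebra_simps)
  moreover have "\<bar>inverse (1 + s) * (a - b)\<bar> \<le> 1 * e'"
    unfolding abs_mult using assms by (intro mult_mono) (auto simp: field_simps)
  moreover have "\<bar>(inverse (1 + s) - inverse (1 + t)) * b\<bar> \<le> e * 1"
    unfolding abs_mult using assms inverse_1_plus_diff[OF assms(1,2)] by (intro mult_mono) auto
  ultimately show ?thesis by linarith
qed

text \<open>Up to time \<open>K\<close> the weight is at least 1 / (1 + K), so removing it costs
  only this factor. Every basic Skorohod neighbourhood thus contains a gauge ball whose radius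
  depends on \<open>e\<close> and \<open>K\<close> alone, and J1-open sets are open for the
  gauge.\<close>

lemma sk_close_imp_nhd:
  assumes e: "0 < e" and K: "0 \<le> K"
  obtains d where "0 < d"
    "\<And>x y e'. x \<in> cadlag_space S_dec_le1 \<Longrightarrow> y \<in> cadlag_space S_dec_le1 \<Longrightarrow> e' < d \<Longrightarrow>
       sk_close e' x y \<Longrightarrow> y \<in> skorohod_nhd S_dec_le1 x e K"
proof
  \<comment> \<open>The 4 combines a factor 2 from \<open>dist_fun_le\<close> with a factor 2 for
    the error in the values plus the error in the weights.\<close>
  define d where "d = min e (e / (4 * (1 + K)))"
  show "0 < d" using e K by (simp add: d_def)
  fix x y e' assume x: "x \<in> cadlag_space S_dec_le1" and y: "y \<in> cadlag_space S_dec_le1"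
    and e': "e' < d" and c: "sk_close e' x y"
  obtain l where l: "time_change l" and
    c: "\<And>s. 0 \<le> s \<Longrightarrow> \<bar>l s - s\<bar> \<le> e' \<and>
     (\<forall>i. \<bar>inverse (1 + s) * x s i - inverse (1 + l s) * y (l s) i\<bar> \<le> e')"
    using c unfolding sk_close_def by blast
  have "dist (y (l s)) (x s) < e" if s: "s \<in> {0..K}" for s
  proof -
    have s0: "0 \<le> s" and ls: "0 \<le> l s" using s time_change_nonneg[OF l] by auto
    have ybd: "0 \<le> y (l s) i" "y (l s) i \<le> 1" for i
      using y ls cadlag_space_S_dec_le1_iff S_dec_le1_bounds by blast+
    have "\<bar>y (l s) i - x s i\<bar> \<le> 2 * (1 + K) * e'" for i
    proof -
      have "inverse (1 + s) * (x s i - y (l s) i) =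
        (inverse (1 + s) * x s i - inverse (1 + l s) * y (l s) i) + (inverse (1 + l s) - inverse (1 + s)) * y (l s) i"
        by (simp add: algebra_simps)
      moreover have "\<bar>(inverse (1 + l s) - inverse (1 + s)) * y (l s) i\<bar> \<le> e' * 1"
        unfolding abs_mult using c[OF s0] inverse_1_plus_diff[OF ls s0] ybd[of i]
        by (intro mult_mono) auto
      ultimately have "\<bar>inverse (1 + s) * (x s i - y (l s) i)\<bar> \<le> 2 * e'"
        using conjunct2[OF c[OF s0], rule_format, of i] by linarith
      then have "\<bar>x s i - y (l s) i\<bar> \<le> (1 + s) * (2 * e')"
        using s0 by (simp add: abs_mult field_simps)
      also have "\<dots> \<le> (1 + K) * (2 * e')"
        using s c[OF s0] by (intro mult_right_mono) auto
      finally show ?thesis by (simp add: abs_minus_commute algebra_simps)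
    qed
    from dist_fun_le[of "y (l s)" "x s", OF this] have "dist (y (l s)) (x s) \<le> 4 * (1 + K) * e'" by (simp add: algebra_simps)
    also have "\<dots> < 4 * (1 + K) * (e / (4 * (1 + K)))"
      using e' K by (intro mult_strict_left_mono) (auto simp: d_def)
    also have "\<dots> = e" using K by simp
    finally show ?thesis .
  qed
  moreover have "\<bar>l s - s\<bar> < e" if "0 \<le> s" for s using c[OF that] e' by (simp add: d_def)
  ultimately show "y \<in> skorohod_nhd S_dec_le1 x e K"
    unfolding skorohod_nhd_def using y l by blast
qed

section \<open>Lipschitz envelopes: infimal convolution with a multiple of the gauge\<close>

definition lip_env :: "((real \<Rightarrow> nat \<Rightarrow> real) \<Rightarrow> real) \<Rightarrow> real \<Rightarrow> (real \<Rightarrow> nat \<Rightarrow> real) \<Rightarrow> real" where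
  "lip_env f k x = Inf {f y + k * e | y e. y \<in> cadlag_space S_dec_le1 \<and> sk_close e x y}"

definition sk_lipschitz :: "((real \<Rightarrow> nat \<Rightarrow> real) \<Rightarrow> real) \<Rightarrow> real \<Rightarrow> bool" where
  "sk_lipschitz g k \<longleftrightarrow> (\<forall>x\<in>cadlag_space S_dec_le1. \<forall>y\<in>cadlag_space S_dec_le1. \<forall>e.
     sk_close e x y \<longrightarrow> \<bar>g x - g y\<bar> \<le> k * e)"

lemma sk_lipschitzD:
  "sk_lipschitz g k \<Longrightarrow> x \<in> cadlag_space S_dec_le1 \<Longrightarrow> y \<in> cadlag_space S_dec_le1 \<Longrightarrow>
     sk_close e x y \<Longrightarrow> \<bar>g x - g y\<bar> \<le> k * e"
  unfolding sk_lipschitz_def by blast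

context
  fixes f :: "(real \<Rightarrow> nat \<Rightarrow> real) \<Rightarrow> real" and B k :: real
  assumes f_ge: "\<And>y. y \<in> cadlag_space S_dec_le1 \<Longrightarrow> B \<le> f y" and k: "0 \<le> k"
begin

lemma lip_env_bdd_below: "bdd_below {f y + k * e | y e. y \<in> cadlag_space S_dec_le1 \<and> sk_close e x y}"
proof (rule bdd_belowI[of _ B])
  fix v assume "v \<in> {f y + k * e | y e. y \<in> cadlag_space S_dec_le1 \<and> sk_close e x y}"
  then obtain y e where "v = f y + k * e" "y \<in> cadlag_space S_dec_le1" "sk_close e x y" by blast
  then show "B \<le> v" using f_ge[of y] k sk_close_nonneg[of e x y] by (simp add: add_increasing2)
qed

lemma lip_env_lower:
  "y \<in> cadlag_space S_dec_le1 \<Longrightarrow> sk_close e x y \<Longrightarrow> lip_env f k x \<le> f y + k * e"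
  unfolding lip_env_def by (rule cInf_lower[OF _ lip_env_bdd_below]) blast

lemma lip_env_le: "x \<in> cadlag_space S_dec_le1 \<Longrightarrow> lip_env f k x \<le> f x"
  using lip_env_lower[of x 0 x] sk_close_refl by simp

lemma lip_env_greatest:
  assumes "x \<in> cadlag_space S_dec_le1"
    "\<And>y e. y \<in> cadlag_space S_dec_le1 \<Longrightarrow> sk_close e x y \<Longrightarrow> z \<le> f y + k * e"
  shows "z \<le> lip_env f k x"
  unfolding lip_env_def by (rule cInf_greatest) (use assms sk_close_refl in blast)+

lemma lip_env_ge: "x \<in> cadlag_space S_dec_le1 \<Longrightarrow> B \<le> lip_env f k x"
  using f_ge k sk_close_nonneg by (intro lip_env_greatest) (auto intro: add_increasing2)

text \<open>Triangle inequality: a competitor for \<open>y\<close> at gauge e' competes for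
  \<open>x\<close> at gauge e + e', so the two infima differ by at most
  \<open>k * e\<close>.\<close>

lemma sk_lipschitz_lip_env: "sk_lipschitz (lip_env f k) k"
proof -
  have *: "lip_env f k x \<le> lip_env f k y + k * e"
    if "x \<in> cadlag_space S_dec_le1" "y \<in> cadlag_space S_dec_le1" "sk_close e x y" for x y e
  proof -
    have "lip_env f k x - k * e \<le> lip_env f k y"
    proof (rule lip_env_greatest[OF that(2)])
      fix z e' assume "z \<in> cadlag_space S_dec_le1" "sk_close e' y z"
      with lip_env_lower[OF this(1) sk_close_trans[OF that(3) this(2)]]
      show "lip_env f k x - k * e \<le> f z + k * e'" by (simp add: algebra_simps)
    qed
    then show ?thesis by simp
  qed
  show ?thesis
    unfolding sk_lipschitz_def
  proof (intro ballI allI impI)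
    fix x y e assume "x \<in> cadlag_space S_dec_le1" "y \<in> cadlag_space S_dec_le1" "sk_close e x y"
    with *[of x y e] *[of y x e] sk_close_sym[of e x y]
    show "\<bar>lip_env f k x - lip_env f k y\<bar> \<le> k * e" by (simp add: abs_le_iff)
  qed
qed

end

lemma openin_sk_close:
  assumes "openin (skorohod_J1 S_dec_le1) U" "x \<in> U"
  obtains d where "0 < d"
    "\<And>y e. y \<in> cadlag_space S_dec_le1 \<Longrightarrow> sk_close e x y \<Longrightarrow> e < d \<Longrightarrow> y \<in> U"
proof -
  from assms obtain e K where "0 < e" "0 \<le> K" "skorohod_nhd S_dec_le1 x e K \<subseteq> U"
    and x: "x \<in> cadlag_space S_dec_le1"
    unfolding openin_skorohod_J1 by blast
  then show ?thesis using sk_close_imp_nhd[of e K] that by (metis subsetD)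
qed

text \<open>Competitors within gauge \<open>d\<close> of \<open>x\<close> lie in \<open>U\<close>,
  where \<open>f\<close> is at least \<open>c\<close>; all others pay a penalty of at least
  \<open>k * d\<close> above the global lower bound \<open>B\<close>.\<close>

lemma lip_env_lsc_at:
  assumes f: "\<And>y. y \<in> cadlag_space S_dec_le1 \<Longrightarrow> B \<le> f y"
    and U: "openin (skorohod_J1 S_dec_le1) U" and x: "x \<in> U"
    and fU: "\<And>y. y \<in> U \<Longrightarrow> c \<le> f y"
  obtains d where "0 < d" "\<And>k. 0 \<le> k \<Longrightarrow> min c (B + k * d) \<le> lip_env f k x"
proof -
  have xD: "x \<in> cadlag_space S_dec_le1" using U x openin_skorohod_J1 by blast
  obtain d where d: "0 < d"
    "\<And>y e. y \<in> cadlag_space S_dec_le1 \<Longrightarrow> sk_close e x y \<Longrightarrow> e < d \<Longrightarrow> y \<in> U"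
    using openin_sk_close[OF U x] by blast
  have "min c (B + k * d) \<le> lip_env f k x" if k: "0 \<le> k" for k
  proof (rule lip_env_greatest[where B=B])
    fix y e assume y: "y \<in> cadlag_space S_dec_le1" and e: "sk_close e x y"
    show "min c (B + k * d) \<le> f y + k * e"
    proof (cases "e < d")
      case True
      then have "c \<le> f y" using d y e fU by blast
      moreover have "0 \<le> k * e" using k sk_close_nonneg[OF e] by simp
      ultimately show ?thesis by linarith
    next
      case False
      then have "k * d \<le> k * e" using k by (intro mult_left_mono) auto
      then show ?thesis using f[OF y] by linarith
    qed
  qed (use f k xD in auto)
  with d(1) that show ?thesis by blast
qed

text \<open>The penalty \<open>k * d\<close> eventually exceeds the gap between \<open>f x\<close>
  and the lower bound \<open>B\<close>, so only values of \<open>f\<close> near \<open>x\<close>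
  matter, and continuity keeps these from falling far below \<open>f x\<close>.\<close>

lemma lip_env_tendsto:
  assumes f: "\<And>y. y \<in> cadlag_space S_dec_le1 \<Longrightarrow> B \<le> f y"
    and c: "continuous_map (skorohod_J1 S_dec_le1) euclideanreal f"
    and x: "x \<in> cadlag_space S_dec_le1"
  shows "(\<lambda>k. lip_env f (real k) x) \<longlonglongrightarrow> f x"
proof (rule LIMSEQ_I)
  fix r :: real assume r: "0 < r"
  define U where "U = {y \<in> cadlag_space S_dec_le1. f y \<in> {f x - r / 2<..}}"
  have U: "openin (skorohod_J1 S_dec_le1) U"
    using openin_continuous_map_preimage[OF c, of "{f x - r / 2<..}"]
    by (simp add: U_def topspace_skorohod_J1 open_openin[symmetric])
  have "x \<in> U" using x r by (simp add: U_def)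
  then obtain d where d: "0 < d" "\<And>k. 0 \<le> k \<Longrightarrow> min (f x - r / 2) (B + k * d) \<le> lip_env f k x"
    using lip_env_lsc_at[of B f U x "f x - r / 2"] f U by (auto simp: U_def)
  obtain k0 :: nat where k0: "(f x - B) / d < real k0" using reals_Archimedean2 by blast
  have "norm (lip_env f (real k) x - f x) < r" if "k0 \<le> k" for k
  proof -
    have "(f x - B) / d < real k" using k0 that by linarith
    then have "f x < B + k * d" using d by (simp add: field_simps)
    then have "f x - r / 2 \<le> lip_env f (real k) x" using d(2)[of k] r by simp
    moreover have "lip_env f (real k) x \<le> f x" using lip_env_le[where B=B] f x by simp
    ultimately show ?thesis using r by simp
  qed
  then show "\<exists>no. \<forall>n\<ge>no. norm (lip_env f (real n) x - f x) < r" by blast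
qed

text \<open>The indicator equals 1 on a whole gauge ball around each point of \<open>U\<close>, so
  its envelope stays positive there, while off \<open>U\<close> it is at most 0. Skorohod open sets
  become positivity sets of Lipschitz functionals.\<close>

lemma lip_env_indicator_pos_iff:
  assumes U: "openin (skorohod_J1 S_dec_le1) U" and x: "x \<in> cadlag_space S_dec_le1"
  shows "0 < lip_env (indicator U) 1 x \<longleftrightarrow> x \<in> U"
proof
  assume "x \<in> U"
  then obtain d :: real where "0 < d" "\<And>k. 0 \<le> k \<Longrightarrow> min 1 (0 + k * d) \<le> lip_env (indicator U) k x"
    using lip_env_lsc_at[of 0 "indicator U" U x 1] U by (metis indicator_pos_le indicator_simps(1) order_refl)
  from this(1) this(2)[of 1] show "0 < lip_env (indicator U) 1 x" by simp
next
  assume "0 < lip_env (indicator U) 1 x"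
  moreover have "lip_env (indicator U) 1 x \<le> indicator U x"
    by (rule lip_env_le[where B=0]) (use x in auto)
  ultimately show "x \<in> U" by (cases "x \<in> U") auto
qed


section \<open>Discretization\<close>

text \<open>Index of the last multiple of 1/m up to \<open>t\<close>, capped at
  \<open>m * m\<close>: a discretized path is frozen from time m on and uses only m^2 + 1 sampled
  values.\<close>

definition grid :: "nat \<Rightarrow> real \<Rightarrow> nat" where
  "grid m t = min (nat \<lfloor>t * real m\<rfloor>) (m * m)"

definition step_path :: "nat \<Rightarrow> (nat \<Rightarrow> nat \<Rightarrow> real) \<Rightarrow> real \<Rightarrow> nat \<Rightarrow> real" where
  "step_path m a = (\<lambda>t\<in>{0..}. a (grid m t))"

definition discretize :: "nat \<Rightarrow> (real \<Rightarrow> nat \<Rightarrow> real) \<Rightarrow> real \<Rightarrow> nat \<Rightarrow> real" where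
  "discretize m x = step_path m (\<lambda>k. x (real k / real m))"

lemma grid_le: "grid m t \<le> m * m"
  by (simp add: grid_def)

lemma step_path_cadlag:
  assumes m: "0 < m" and a: "\<And>k. k \<le> m * m \<Longrightarrow> a k \<in> S_dec_le1"
  shows "step_path m a \<in> cadlag_space S_dec_le1"
proof -
  have val: "step_path m a t = a (grid m t)" if "0 \<le> t" for t using that by (simp add: step_path_def)
  have right: "(step_path m a \<longlongrightarrow> step_path m a t) (at_right t)" if t: "0 \<le> t" for t
  proof -
    define b where "b = (of_int \<lfloor>t * real m\<rfloor> + 1) / real m"
    have "t < b" using m by (simp add: b_def pos_less_divide_eq)
    have "step_path m a s = step_path m a t" if s: "s \<in> {t<..<b}" for s
    proof -
      have "t * real m \<le> s * real m" using s m by simp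
      moreover have "s * real m < of_int \<lfloor>t * real m\<rfloor> + 1"
        using s m by (simp add: b_def pos_less_divide_eq)
      ultimately have "\<lfloor>s * real m\<rfloor> = \<lfloor>t * real m\<rfloor>" by linarith
      then show ?thesis using s t by (simp add: val grid_def)
    qed
    then have "\<forall>\<^sub>F s in at_right t. step_path m a s = step_path m a t"
      using eventually_at_right_real[OF \<open>t < b\<close>] by (rule eventually_mono[rotated]) auto
    then show ?thesis by (rule tendsto_eventually)
  qed
  have left: "\<exists>l\<in>S_dec_le1. (step_path m a \<longlongrightarrow> l) (at_left t)" if t: "0 < t" for t
  proof -
    \<comment> \<open>The last grid point strictly before \<open>t\<close>, so that at a grid time
      the left limit is the previous sample.\<close>
    define b where "b = (of_int \<lceil>t * real m\<rceil> - 1) / real m"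
    have "b < t" using m by (simp add: b_def pos_divide_less_eq) linarith
    have "0 < t * real m" using t m by simp
    then have "b \<ge> 0" using m by (simp add: b_def)
    define u where "u = (b + t) / 2"
    have "step_path m a s = a (grid m u)" if s: "s \<in> {b<..<t}" for s
    proof -
      have fl: "\<lfloor>s * real m\<rfloor> = \<lceil>t * real m\<rceil> - 1" if "b < s" "s < t" for s
      proof -
        have "s * real m < t * real m" using that m by simp
        moreover have "of_int \<lceil>t * real m\<rceil> - 1 < s * real m"
          using that m by (simp add: b_def pos_divide_less_eq)
        ultimately show ?thesis by linarith
      qed
      have "b < u" "u < t" using \<open>b < t\<close> by (auto simp: u_def)
      then show ?thesis using s \<open>0 \<le> b\<close> fl by (simp add: val grid_def)
    qed
    then have "\<forall>\<^sub>F s in at_left t. step_path m a s = a (grid m u)"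
      using eventually_at_left_real[OF \<open>b < t\<close>] by (rule eventually_mono[rotated]) auto
    then show ?thesis using tendsto_eventually a grid_le by blast
  qed
  have "step_path m a \<in> {0..} \<rightarrow>\<^sub>E S_dec_le1"
    using a grid_le by (auto simp: step_path_def)
  then show ?thesis using left right by (auto simp: cadlag_space_def)
qed

lemma discretize_cadlag:
  assumes "0 < m" "\<And>t. 0 \<le> t \<Longrightarrow> x t \<in> S_dec_le1"
  shows "discretize m x \<in> cadlag_space S_dec_le1"
  unfolding discretize_def using assms by (intro step_path_cadlag) auto

text \<open>The coarse grid is contained in the fine one, k / m = k L / (m L), and the coarse
  indices stay below the fine cap.\<close>

lemma discretize_discretize:
  assumes "0 < m" "0 < L"
  shows "discretize m (discretize (m * L) x) = discretize m x"
proof -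
  have "grid (m * L) (real k / real m) = k * L" if "k \<le> m * m" for k
  proof -
    have "real k / real m * real (m * L) = real (k * L)" using assms by simp
    then have "nat \<lfloor>real k / real m * real (m * L)\<rfloor> = k * L" by (metis floor_of_nat nat_int)
    moreover have "k * L \<le> m * L * (m * L)"
    proof -
      have "k * L \<le> m * m * L" using that by simp
      also have "\<dots> \<le> m * m * L * L" using assms by simp
      finally show ?thesis by (simp add: mult_ac)
    qed
    ultimately show ?thesis by (simp add: grid_def)
  qed
  moreover have "real (k * L) / real (m * L) = real k / real m" for k using assms by simp
  ultimately show ?thesis
    unfolding discretize_def step_path_def by (intro restrict_ext) (simp add: grid_le)
qed

lemma sk_close_step_path:
  assumes "0 \<le> e" "\<And>k i. k \<le> m * m \<Longrightarrow> \<bar>a k i - b k i\<bar> \<le> e"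
  shows "sk_close e (step_path m a) (step_path m b)"
  unfolding sk_close_def
proof (intro exI[of _ "\<lambda>s. s"] conjI allI impI time_change_id)
  fix s :: real and i assume s: "0 \<le> s"
  show "\<bar>s - s\<bar> \<le> e" using assms by simp
  have "\<bar>inverse (1 + s) * step_path m a s i - inverse (1 + s) * step_path m b s i\<bar>
      = inverse (1 + s) * \<bar>a (grid m s) i - b (grid m s) i\<bar>"
    using s by (simp add: step_path_def right_diff_distrib[symmetric] abs_mult)
  also have "\<dots> \<le> 1 * e"
    using s assms grid_le by (intro mult_mono) (auto simp: field_simps)
  finally show "\<bar>inverse (1 + s) * step_path m a s i - inverse (1 + s) * step_path m b s i\<bar> \<le> e"
    by simp
qed

section \<open>Oscillation between exceptional times and the distance to the discretized
  path\<close>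

definition osc_le :: "real \<Rightarrow> real set \<Rightarrow> real \<Rightarrow> real \<Rightarrow> (real \<Rightarrow> nat \<Rightarrow> real) \<Rightarrow> bool" where
  "osc_le \<epsilon> F a b x \<longleftrightarrow>
     (\<forall>s t i. a \<le> s \<and> s \<le> t \<and> t < b \<and> F \<inter> {s<..t} = {} \<longrightarrow> \<bar>x s i - x t i\<bar> \<le> \<epsilon>)"

text \<open>Each exceptional time is moved to the next grid point, and \<open>gap\<close> keeps
  these images in order. After the time change, \<open>s\<close> and the sampling time below
  \<open>l s\<close> lie in the same piece between exceptional times, so the values differ by at
  most \<epsilon>. The term 1 / m bounds the time shift and 1 / K the weighted values beyond the
  horizon.\<close>

lemma sk_close_discretize:
  assumes x: "\<And>t. 0 \<le> t \<Longrightarrow> x t \<in> S_dec_le1" and m: "0 < m" and K: "0 < K" "K \<le> real m"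
    and F: "finite F" "F \<subseteq> {0<..}" and gap: "\<And>p p'. p \<in> F \<Longrightarrow> p' \<in> F \<Longrightarrow> p < p' \<Longrightarrow> 1 / real m < p' - p"
    and osc: "osc_le \<epsilon> F 0 K x" and \<epsilon>: "0 \<le> \<epsilon>"
  shows "sk_close (\<epsilon> + 1 / real m + 1 / K) x (discretize m x)"
proof -
  \<comment> \<open>The first grid point at or after \<open>p\<close>, less than 1 / m
    later.\<close>
  define q where "q = (\<lambda>p. of_int \<lceil>p * real m\<rceil> / real m)"
  have q_ge: "p \<le> q p" for p
    using m by (simp add: q_def pos_le_divide_eq)
  have q_lt: "q p < p + 1 / real m" for p
  proof -
    have "of_int \<lceil>p * real m\<rceil> < p * real m + 1" by linarith
    then show ?thesis using m by (simp add: q_def field_simps)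
  qed
  have "strict_mono_on F q"
  proof (rule strict_mono_onI)
    fix p p' assume "p \<in> F" "p' \<in> F" "p < p'"
    then have "1 / real m < p' - p" using gap by blast
    then have "q p < p'" using q_lt[of p] by linarith
    also have "p' \<le> q p'" by (rule q_ge)
    finally show "q p < q p'" .
  qed
  moreover have "0 < p \<and> 0 < q p \<and> \<bar>q p - p\<bar> \<le> 1 / real m" if "p \<in> F" for p
    using that F(2) q_ge[of p] q_lt[of p] by force
  ultimately obtain l where l: "time_change l" "\<And>p. p \<in> F \<Longrightarrow> l p = q p"
    and ls: "\<And>s. 0 \<le> s \<Longrightarrow> \<bar>l s - s\<bar> \<le> 1 / real m"
    using time_change_extending_ex[OF F(1), of q "1 / real m"] m by auto
  have D: "discretize m x t \<in> S_dec_le1" if "0 \<le> t" for t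
    using that x by (auto simp: discretize_def step_path_def)
  show ?thesis
    unfolding sk_close_def
  proof (intro exI[of _ l] conjI allI impI l(1))
    fix s :: real and i assume s: "0 \<le> s"
    have l0: "0 \<le> l s" using time_change_nonneg[OF l(1) s] .
    note xb = S_dec_le1_bounds[OF x[OF s], of i] and Db = S_dec_le1_bounds[OF D[OF l0], of i]
    have "\<bar>l s - s\<bar> \<le> 1 / real m" by (rule ls[OF s])
    also have "\<dots> \<le> \<epsilon> + 1 / real m + 1 / K" using K \<epsilon> by simp
    finally show "\<bar>l s - s\<bar> \<le> \<epsilon> + 1 / real m + 1 / K" .
    show "\<bar>inverse (1 + s) * x s i - inverse (1 + l s) * discretize m x (l s) i\<bar> \<le> \<epsilon> + 1 / real m + 1 / K"
    proof (cases "s < K \<and> l s < K")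
      case True
      define j where "j = nat \<lfloor>l s * real m\<rfloor>"
      define t where "t = real j / real m"
      have j: "real j = of_int \<lfloor>l s * real m\<rfloor>" using l0 by (simp add: j_def)
      have jle: "real j \<le> l s * real m" unfolding j by linarith
      have tl: "t \<le> l s" using jle m by (simp add: t_def pos_divide_le_eq)
      \<comment> \<open>Below the horizon \<open>K\<close>, which is at most m, the cap in
        \<open>grid\<close> is inactive.\<close>
      have "l s * real m < real m * real m" using True K m by simp
      then have "real j < real (m * m)" using jle by simp
      then have "j < m * m" by (simp only: of_nat_less_iff)
      then have "discretize m x (l s) = x t"
        using l0 by (simp add: discretize_def step_path_def grid_def t_def j_def[symmetric])
      moreover have "\<bar>x s i - x t i\<bar> \<le> \<epsilon>"
      proof -
        \<comment> \<open>The image \<open>q p\<close> is itself a grid point, so it is at most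
          \<open>l s\<close> exactly when it is at most the sampling time \<open>t\<close>.\<close>
        have iff: "p \<le> s \<longleftrightarrow> p \<le> t" if p: "p \<in> F" for p
        proof
          have p0: "0 \<le> p" using p F by auto
          assume "p \<le> s"
          then have "q p \<le> l s" using time_change_le_iff[OF l(1) p0 s] l(2)[OF p] by simp
          then have "\<lceil>p * real m\<rceil> \<le> \<lfloor>l s * real m\<rfloor>"
            using m by (simp add: q_def pos_divide_le_eq le_floor_iff)
          then have "q p \<le> t" using m unfolding q_def t_def j by (simp add: divide_right_mono)
          then show "p \<le> t" using q_ge[of p] by simp
        next
          have p0: "0 \<le> p" using p F by auto
          assume "p \<le> t"
          then have "p * real m \<le> real j" using m by (simp add: t_def pos_le_divide_eq)
          then have "\<lceil>p * real m\<rceil> \<le> int j" by (simp add: ceiling_le_iff)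
          then have "real_of_int \<lceil>p * real m\<rceil> \<le> real j" by linarith
          then have "q p \<le> t" unfolding q_def t_def by (intro divide_right_mono) auto
          then have "l p \<le> l s" using l(2)[OF p] tl by simp
          then show "p \<le> s" using time_change_le_iff[OF l(1) p0 s] by simp
        qed
        have t: "0 \<le> t" "t < K" using tl True by (auto simp: t_def)
        show ?thesis
        proof (cases "s \<le> t")
          case T: True
          have "F \<inter> {s<..t} = {}" using iff by force
          then show ?thesis using osc T t s unfolding osc_le_def by blast
        next
          case T: False
          have "F \<inter> {t<..s} = {}" using iff by force
          then have "\<bar>x t i - x s i\<bar> \<le> \<epsilon>" using osc T t s True unfolding osc_le_def by auto
          then show ?thesis by (simp add: abs_minus_commute)
        qed
      qed
      ultimately have "\<bar>inverse (1 + s) * x s i - inverse (1 + l s) * discretize m x (l s) i\<bar> \<le> 1 / real m + \<epsilon>"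
        using s l0 Db ls[OF s] by (intro weighted_diff_le) (auto simp: abs_minus_commute)
      moreover have "0 \<le> 1 / K" using K by simp
      ultimately show ?thesis by linarith
    next
      case False
      \<comment> \<open>The shift is at most 1, so past the horizon both weights are at most 1 / K,
        and both paths have coordinates in [0, 1].\<close>
      have m1: "1 / real m \<le> 1" using m by simp
      have "K \<le> 1 + s" "K \<le> 1 + l s" using False ls[OF s] m1 by linarith+
      then have "inverse (1 + s) \<le> 1 / K" "inverse (1 + l s) \<le> 1 / K"
        using K by (auto simp: inverse_eq_divide intro!: divide_left_mono mult_pos_pos)
      then have "inverse (1 + s) * x s i \<le> 1 / K" "inverse (1 + l s) * discretize m x (l s) i \<le> 1 / K"
        using mult_mono[of "inverse (1 + s)" "1 / K" "x s i" 1]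
          mult_mono[of "inverse (1 + l s)" "1 / K" "discretize m x (l s) i" 1] xb Db K by auto
      moreover have "0 \<le> inverse (1 + s) * x s i" "0 \<le> inverse (1 + l s) * discretize m x (l s) i"
        using xb Db s l0 by auto
      moreover have "0 \<le> \<epsilon> + 1 / real m" using \<epsilon> by simp
      ultimately show ?thesis by linarith
    qed
  qed
qed

text \<open>Coordinates from \<open>I\<close> on are below \<epsilon> for every sequence of mass at
  most 1, so only finitely many coordinates have to converge.\<close>

lemma tendsto_S_dec_le1_uniform:
  fixes x :: "real \<Rightarrow> nat \<Rightarrow> real"
  assumes "(x \<longlongrightarrow> l) \<F>" "l \<in> S_dec_le1" "\<forall>\<^sub>F s in \<F>. x s \<in> S_dec_le1" "0 < \<epsilon>"
  shows "\<forall>\<^sub>F s in \<F>. \<forall>i. \<bar>x s i - l i\<bar> \<le> \<epsilon>"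
proof -
  obtain I where I: "inverse (real (Suc I)) < \<epsilon>" using assms(4) reals_Archimedean by blast
  have "\<forall>\<^sub>F s in \<F>. \<forall>i\<in>{..<I}. \<bar>x s i - l i\<bar> < \<epsilon>"
  proof (intro eventually_ball_finite ballI)
    fix i
    have "((\<lambda>s. x s i) \<longlongrightarrow> l i) \<F>" by (rule tendsto_fun_component[OF assms(1)])
    then show "\<forall>\<^sub>F s in \<F>. \<bar>x s i - l i\<bar> < \<epsilon>" using assms(4) tendstoD by (fastforce simp: dist_real_def)
  qed simp
  then show ?thesis
    using assms(3)
  proof eventually_elim
    case (elim s)
    have "\<bar>x s i - l i\<bar> \<le> \<epsilon>" if "I \<le> i" for i
    proof -
      have "inverse (1 + real i) \<le> inverse (real (Suc I))" using that by (intro le_imp_inverse_le) auto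
      then show ?thesis
        using S_dec_le1_bounds(1,2)[OF elim(2), of i] S_dec_le1_bounds(1,2)[OF assms(2), of i] I by linarith
    qed
    then show ?case using elim(1) by (meson lessThan_iff less_imp_le not_le)
  qed
qed

text \<open>Near each time the path is close to its left limit before and to its value after, so one
  exceptional point suffices locally; bisection assembles finitely many. The lower end
  \<open>max 0 u\<close> copes with intervals around 0 that reach below it.\<close>

lemma cadlag_osc_le_ex:
  assumes x: "x \<in> cadlag_space S_dec_le1" and K: "0 \<le> K" and \<epsilon>: "0 < \<epsilon>"
  obtains F where "finite F" "F \<subseteq> {0<..}" "osc_le \<epsilon> F 0 K x"
proof -
  have xS: "x t \<in> S_dec_le1" if "0 \<le> t" for t using x that by (auto simp: cadlag_space_def PiE_def)
  have "\<exists>F. finite F \<and> osc_le \<epsilon> F (max 0 0) K x"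
  proof (rule Bolzano[where P="\<lambda>u v. \<exists>F. finite F \<and> osc_le \<epsilon> F (max 0 u) v x", OF K])
    fix a b c assume "\<exists>F. finite F \<and> osc_le \<epsilon> F (max 0 a) b x"
      "\<exists>F. finite F \<and> osc_le \<epsilon> F (max 0 b) c x" "a \<le> b" "b \<le> c"
    then obtain F F' where *: "finite F" "osc_le \<epsilon> F (max 0 a) b x" "finite F'" "osc_le \<epsilon> F' (max 0 b) c x"
      by blast
    \<comment> \<open>The common endpoint \<open>b\<close> becomes exceptional, so that no piece
      straddles it.\<close>
    have "osc_le \<epsilon> (F \<union> F' \<union> {b}) (max 0 a) c x"
      unfolding osc_le_def
    proof (intro allI impI)
      fix s t i assume st: "max 0 a \<le> s \<and> s \<le> t \<and> t < c \<and> (F \<union> F' \<union> {b}) \<inter> {s<..t} = {}"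
      then have "b \<notin> {s<..t}" by blast
      then consider "t < b" | "b \<le> s" by fastforce
      then show "\<bar>x s i - x t i\<bar> \<le> \<epsilon>"
        by cases (use st * in \<open>auto simp: osc_le_def Int_Un_distrib2\<close>)
    qed
    then show "\<exists>F. finite F \<and> osc_le \<epsilon> F (max 0 a) c x" using * by (intro exI[of _ "F \<union> F' \<union> {b}"]) auto
  next
    fix t assume t: "0 \<le> t" "t \<le> K"
    have e2: "0 < \<epsilon> / 2" using \<epsilon> by simp
    have "(x \<longlongrightarrow> x t) (at_right t)" using x t by (auto simp: cadlag_space_def)
    then have "\<forall>\<^sub>F s in at_right t. \<forall>i. \<bar>x s i - x t i\<bar> \<le> \<epsilon> / 2"
    proof (rule tendsto_S_dec_le1_uniform[OF _ _ _ e2])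
      show "\<forall>\<^sub>F s in at_right t. x s \<in> S_dec_le1"
        using eventually_at_right_less[of t] by eventually_elim (use t xS in auto)
    qed (use t xS in auto)
    then obtain b where b: "t < b" "\<And>s i. t < s \<Longrightarrow> s < b \<Longrightarrow> \<bar>x s i - x t i\<bar> \<le> \<epsilon> / 2"
      unfolding eventually_at_right_field by blast
    \<comment> \<open>At time 0 there is no left limit, and the condition on earlier nonnegative
      times is void.\<close>
    have "\<exists>a l. a < t \<and> (\<forall>s i. 0 \<le> s \<and> a < s \<and> s < t \<longrightarrow> \<bar>x s i - l i\<bar> \<le> \<epsilon> / 2)"
    proof (cases "t = 0")
      case True
      then show ?thesis by (intro exI[of _ "-1"]) auto
    next
      case False
      then have t0: "0 < t" using t by simp
      then obtain l where l: "l \<in> S_dec_le1" "(x \<longlongrightarrow> l) (at_left t)"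
        using x by (auto simp: cadlag_space_def)
      have "\<forall>\<^sub>F s in at_left t. \<forall>i. \<bar>x s i - l i\<bar> \<le> \<epsilon> / 2"
      proof (rule tendsto_S_dec_le1_uniform[OF l(2,1) _ e2])
        show "\<forall>\<^sub>F s in at_left t. x s \<in> S_dec_le1"
          using eventually_at_left_real[OF t0] by eventually_elim (use t xS in auto)
      qed
      then show ?thesis unfolding eventually_at_left_field by blast
    qed
    then obtain a l where a: "a < t" "\<And>s i. 0 \<le> s \<Longrightarrow> a < s \<Longrightarrow> s < t \<Longrightarrow> \<bar>x s i - l i\<bar> \<le> \<epsilon> / 2" by blast
    define d where "d = min (t - a) (b - t)"
    have "\<exists>F. finite F \<and> osc_le \<epsilon> F (max 0 u) v x" if uv: "u \<le> t" "t \<le> v" "v - u < d" for u v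
    proof (intro exI[of _ "{t}"] conjI)
      show "osc_le \<epsilon> {t} (max 0 u) v x"
        unfolding osc_le_def
      proof (intro allI impI)
        fix s s' i assume s: "max 0 u \<le> s \<and> s \<le> s' \<and> s' < v \<and> {t} \<inter> {s<..s'} = {}"
        have ab: "a < u" "v < b" using uv by (auto simp: d_def)
        consider "s' < t" | "t \<le> s" using s by fastforce
        then show "\<bar>x s i - x s' i\<bar> \<le> \<epsilon>"
        proof cases
          case 1
          then have "\<bar>x s i - l i\<bar> \<le> \<epsilon> / 2" "\<bar>x s' i - l i\<bar> \<le> \<epsilon> / 2" using s uv ab a(2) by auto
          then show ?thesis by linarith
        next
          case 2
          have "\<bar>x r i - x t i\<bar> \<le> \<epsilon> / 2" if "t \<le> r" "r < b" for r
            using b(2)[of r i] that \<epsilon> by (cases "r = t") auto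
          then have "\<bar>x s i - x t i\<bar> \<le> \<epsilon> / 2" "\<bar>x s' i - x t i\<bar> \<le> \<epsilon> / 2" using 2 s ab by auto
          then show ?thesis by linarith
        qed
      qed
    qed simp
    moreover have "0 < d" using a b by (simp add: d_def)
    ultimately show "\<exists>d>0. \<forall>u v. u \<le> t \<and> t \<le> v \<and> v - u < d \<longrightarrow>
        (\<exists>F. finite F \<and> osc_le \<epsilon> F (max 0 u) v x)" by blast
  qed
  then obtain F where "finite F" "osc_le \<epsilon> F 0 K x" by auto
  \<comment> \<open>Points outside \<open>{0<..}\<close> never separate two nonnegative
    times.\<close>
  moreover have "F \<inter> {0<..} \<inter> {s<..t} = F \<inter> {s<..t}" if "0 \<le> s" for s t using that by auto
  ultimately have "finite (F \<inter> {0<..})" "F \<inter> {0<..} \<subseteq> {0<..}" "osc_le \<epsilon> (F \<inter> {0<..}) 0 K x"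
    by (auto simp: osc_le_def)
  then show ?thesis using that by blast
qed

text \<open>The error splits into three thirds: oscillation, mesh and far future. For large m the
  mesh also falls below all gaps between the finitely many exceptional times.\<close>

lemma sk_close_discretize_eventually:
  assumes x: "x \<in> cadlag_space S_dec_le1" and e: "0 < e"
  shows "\<forall>\<^sub>F m in sequentially. sk_close e x (discretize m x)"
proof -
  have xS: "x t \<in> S_dec_le1" if "0 \<le> t" for t using x that by (auto simp: cadlag_space_def PiE_def)
  define K where "K = 3 / e"
  have K: "0 < K" using e by (simp add: K_def)
  obtain F where F: "finite F" "F \<subseteq> {0<..}" "osc_le (e / 3) F 0 K x"
    using cadlag_osc_le_ex[OF x, of K "e / 3"] K e by auto
  have "\<forall>\<^sub>F m in sequentially. \<forall>pp\<in>F \<times> F. fst pp < snd pp \<longrightarrow> 1 / real m < snd pp - fst pp"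
  proof (intro eventually_ball_finite ballI)
    fix pp :: "real \<times> real"
    have "(\<lambda>m. 1 / real m) \<longlonglongrightarrow> 0" by (rule lim_1_over_n)
    then have "\<forall>\<^sub>F m in sequentially. 1 / real m < snd pp - fst pp" if "fst pp < snd pp"
      using that order_tendstoD(2) by fastforce
    then show "\<forall>\<^sub>F m in sequentially. fst pp < snd pp \<longrightarrow> 1 / real m < snd pp - fst pp"
      by (cases "fst pp < snd pp") auto
  qed (use F in auto)
  moreover have "\<forall>\<^sub>F m in sequentially. K \<le> real m"
    using filterlim_real_sequentially unfolding filterlim_at_top by blast
  moreover have "\<forall>\<^sub>F m in sequentially. 0 < m" by (rule eventually_gt_at_top)
  ultimately show ?thesis
  proof eventually_elim
    case (elim m)
    have "1 / real m \<le> 1 / K" using elim K by (intro divide_left_mono) auto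
    moreover have "1 / K = e / 3" by (simp add: K_def)
    moreover have "sk_close (e / 3 + 1 / real m + 1 / K) x (discretize m x)"
      using elim K F e xS by (intro sk_close_discretize[where F=F]) auto
    ultimately show ?case by (auto intro: sk_close_mono)
  qed
qed

lemma sk_lipschitz_discretize_tendsto:
  assumes g: "sk_lipschitz g k" and x: "x \<in> cadlag_space S_dec_le1"
  shows "(\<lambda>m. g (discretize m x)) \<longlonglongrightarrow> g x"
proof (rule LIMSEQ_I)
  fix r :: real assume r: "0 < r"
  define e where "e = r / (\<bar>k\<bar> + 1)"
  have e: "0 < e" using r by (simp add: e_def)
  have "\<forall>\<^sub>F m in sequentially. norm (g (discretize m x) - g x) < r"
    using sk_close_discretize_eventually[OF x e] eventually_gt_at_top[of 0]
  proof eventually_elim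
    case (elim m)
    have "discretize m x \<in> cadlag_space S_dec_le1"
      using elim x by (intro discretize_cadlag) (auto simp: cadlag_space_def PiE_def)
    then have "\<bar>g x - g (discretize m x)\<bar> \<le> k * e" using sk_lipschitzD[OF g x _ elim(1)] by blast
    also have "\<dots> < (\<bar>k\<bar> + 1) * e" using e by (intro mult_strict_right_mono) auto
    also have "\<dots> = r" by (simp add: e_def)
    finally show ?case by (simp add: abs_minus_commute)
  qed
  then show "\<exists>no. \<forall>n\<ge>no. norm (g (discretize n x) - g x) < r" by (simp add: eventually_sequentially)
qed


section \<open>Components of a graph and paths in a tree\<close>

lemma adjacent_commute: "adjacent G u v \<longleftrightarrow> adjacent G v u"
  by (simp add: adjacent_def insert_commute)

lemma adjacent_rtranclp_sym: "(adjacent G)\<^sup>*\<^sup>* u v \<Longrightarrow> (adjacent G)\<^sup>*\<^sup>* v u"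
  by (metis adjacent_commute sympD sympI symp_rtranclp)

lemma equiv_connection: "equiv (fst G) (connection G)"
  by (auto simp: equiv_def connection_def refl_on_def sym_def trans_def adjacent_rtranclp_sym)

lemma adjacent_rtranclp_mono:
  assumes "(adjacent (V, A))\<^sup>*\<^sup>* u v" "A \<subseteq> B" shows "(adjacent (V, B))\<^sup>*\<^sup>* u v"
  using assms(1) by (rule rtranclp_mono[THEN predicate2D, rotated]) (use assms(2) in \<open>auto simp: adjacent_def\<close>)

lemma connection_mono: "A \<subseteq> B \<Longrightarrow> connection (V, A) \<subseteq> connection (V, B)"
  by (auto simp: connection_def intro: adjacent_rtranclp_mono)

section \<open>Simple paths, bridges and the path edges of a pair\<close>

lemma rtranclp_distinct_path:
  assumes "R\<^sup>*\<^sup>* u v"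
  shows "\<exists>p. p \<noteq> [] \<and> hd p = u \<and> last p = v \<and> distinct p \<and> successively R p"
  using assms
proof (induction rule: rtranclp_induct)
  case base
  show ?case by (intro exI[of _ "[u]"]) simp
next
  case (step y z)
  then obtain p where p: "p \<noteq> []" "hd p = u" "last p = y" "distinct p" "successively R p" by blast
  show ?case
  proof (cases "z \<in> set p")
    case True
    \<comment> \<open>The walk returns to \<open>z\<close>: only the part up to the earlier visit is
      kept.\<close>
    then obtain q r where "p = q @ z # r" by (meson split_list)
    with p show ?thesis
      by (intro exI[of _ "q @ [z]"]) (auto simp: hd_append successively_append_iff split: if_splits)
  next
    case False
    then show ?thesis using p step.hyps(2)
      by (intro exI[of _ "p @ [z]"]) (auto simp: successively_append_iff)
  qed
qed

text \<open>A simple path from \<open>a\<close> to \<open>b\<close> avoiding the edge would close up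
  with it to a cycle; it has at least three vertices, since a path with two vertices would use the
  deleted edge.\<close>

lemma acyclic_bridge:
  assumes acyc: "\<nexists>p. is_cycle (V, E) p" and e: "{a, b} \<in> E" and ab: "a \<noteq> b"
  shows "\<not> (adjacent (V, E - {{a, b}}))\<^sup>*\<^sup>* a b"
proof
  assume "(adjacent (V, E - {{a, b}}))\<^sup>*\<^sup>* a b"
  then obtain p where p: "p \<noteq> []" "hd p = a" "last p = b" "distinct p"
    "successively (adjacent (V, E - {{a, b}})) p"
    using rtranclp_distinct_path by metis
  obtain q where q: "p = a # q" "q \<noteq> []" using p ab by (cases p) (auto split: if_splits)
  obtain c r where r: "q = c # r" using q(2) by (cases q) auto
  have "r \<noteq> []" using p q r by (auto simp: adjacent_def)
  then have "3 \<le> length p" using q r by (cases r) auto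
  moreover have "successively (adjacent (V, E)) p"
    using p(5) by (rule successively_mono) (auto simp: adjacent_def)
  moreover have "adjacent (V, E) (last p) (hd p)"
    using p e by (auto simp: adjacent_def insert_commute)
  ultimately show False using acyc p(4) unfolding is_cycle_def by blast
qed

text \<open>Crossing the edge back again cancels an earlier crossing, so along a walk it is enough
  to record at most one crossing, in one of two directions.\<close>

lemma rtranclp_adjacent_delete_edge:
  assumes "(adjacent (V, A))\<^sup>*\<^sup>* u v"
  shows "(adjacent (V, A - {{a, b}}))\<^sup>*\<^sup>* u v \<or>
    ((adjacent (V, A - {{a, b}}))\<^sup>*\<^sup>* u a \<and> (adjacent (V, A - {{a, b}}))\<^sup>*\<^sup>* b v) \<or>
    ((adjacent (V, A - {{a, b}}))\<^sup>*\<^sup>* u b \<and> (adjacent (V, A - {{a, b}}))\<^sup>*\<^sup>* a v)"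
    (is "?R u v \<or> (?R u a \<and> ?R b v) \<or> (?R u b \<and> ?R a v)")
  using assms
proof (induction rule: rtranclp_induct)
  case base
  then show ?case by simp
next
  case (step y z)
  show ?case
  proof (cases "{y, z} = {a, b}")
    case True
    then consider "y = a" "z = b" | "y = b" "z = a" by (auto simp: doubleton_eq_iff)
    then show ?thesis using step.IH by cases auto
  next
    case False
    then have "adjacent (V, A - {{a, b}}) y z" using step.hyps by (simp add: adjacent_def)
    then have "?R x z" if "?R x y" for x using that by (rule rtranclp.rtrancl_into_rtrancl[rotated])
    then show ?thesis using step.IH by blast
  qed
qed

text \<open>\<open>P\<close> is the edge set of the unique path: the edges whose removal alone
  separates \<open>u\<close> from \<open>v\<close>. Removing another edge cannot disconnect the
  pair, even after earlier such removals, since its ends would then be joined around it, although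
  every edge of a tree is a bridge. Connectedness thus becomes survival of a fixed set of
  edges.\<close>

lemma tree_path_edges_ex:
  assumes tree: "is_tree (V, E)" and u: "u \<in> V" and v: "v \<in> V"
  shows "\<exists>P\<subseteq>E. \<forall>A\<subseteq>E. (u, v) \<in> connection (V, A) \<longleftrightarrow> P \<subseteq> A"
proof -
  let ?c = "\<lambda>A. (adjacent (V, A))\<^sup>*\<^sup>*"
  define P where "P = {e \<in> E. \<not> ?c (E - {e}) u v}"
  have fin: "finite E" and edge: "\<And>e. e \<in> E \<Longrightarrow> \<exists>a b. a \<noteq> b \<and> e = {a, b}"
    and acyc: "\<nexists>p. is_cycle (V, E) p" and uv: "?c E u v"
  proof -
    have "finite V" "E \<subseteq> Pow V" using tree by (auto simp: is_tree_def finite_simple_graph_def)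
    then show "finite E" using finite_subset by blast
    fix e assume "e \<in> E"
    then show "\<exists>a b. a \<noteq> b \<and> e = {a, b}"
      using tree unfolding is_tree_def finite_simple_graph_def by (metis snd_conv)
  qed (use tree u v in \<open>auto simp: is_tree_def connection_def\<close>)
  have "P \<subseteq> A" if "A \<subseteq> E" "?c A u v" for A
  proof
    fix e assume e: "e \<in> P"
    show "e \<in> A"
    proof (rule ccontr)
      assume "e \<notin> A"
      then have "?c (E - {e}) u v" using that by (intro adjacent_rtranclp_mono[OF that(2)]) auto
      then show False using e by (simp add: P_def)
    qed
  qed
  moreover have "?c A u v" if A: "A \<subseteq> E" "P \<subseteq> A" for A
  proof -
    have "?c (E - D) u v" if "finite D" "D \<subseteq> E - P" for D
      using that
    proof (induction D rule: finite_induct)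
      case empty
      then show ?case using uv by simp
    next
      case (insert e D)
      obtain a b where ab: "a \<noteq> b" "e = {a, b}" using edge insert.prems by blast
      have eE: "{a, b} \<in> E" using insert.prems ab by blast
      have eq: "E - insert e D = E - D - {{a, b}}" using ab by auto
      have sub: "E - D - {{a, b}} \<subseteq> E - {{a, b}}" by auto
      have br: "\<not> ?c (E - {{a, b}}) a b" using acyclic_bridge[OF acyc eE ab(1)] .
      \<comment> \<open>The edge lies outside \<open>P\<close>, so its removal alone leaves the pair
        connected; with the two half-connections below this joins \<open>a\<close> to
        \<open>b\<close> around the edge.\<close>
      have uv': "?c (E - {{a, b}}) u v" using insert.prems ab by (auto simp: P_def)
      show ?case
      proof (rule ccontr)
        assume "\<not> ?thesis"
        then have "(?c (E - D - {{a, b}}) u a \<and> ?c (E - D - {{a, b}}) b v) \<or>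
            (?c (E - D - {{a, b}}) u b \<and> ?c (E - D - {{a, b}}) a v)"
          using rtranclp_adjacent_delete_edge[of V "E - D" u v a b] insert.IH insert.prems eq by auto
        then have "(?c (E - {{a, b}}) u a \<and> ?c (E - {{a, b}}) b v) \<or>
            (?c (E - {{a, b}}) u b \<and> ?c (E - {{a, b}}) a v)"
          using adjacent_rtranclp_mono[OF _ sub] by blast
        then have "?c (E - {{a, b}}) a b"
          using uv' adjacent_rtranclp_sym rtranclp_trans by metis
        then show False using br by simp
      qed
    qed
    from this[of "E - A"] show ?thesis using A fin by (simp add: double_diff Diff_mono)
  qed
  ultimately have "\<forall>A\<subseteq>E. (u, v) \<in> connection (V, A) \<longleftrightarrow> P \<subseteq> A"
    using u v by (simp add: connection_def) blast
  moreover have "P \<subseteq> E" by (auto simp: P_def)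
  ultimately show ?thesis by blast
qed


section \<open>Ranked component sizes\<close>

definition ranked_size :: "'v ugraph \<Rightarrow> nat \<Rightarrow> nat" where
  "ranked_size G i = (if i < length (component_sizes G) then component_sizes G ! i else 0)"

text \<open>In a nonincreasing list the entries that are at least \<open>a\<close> form an initial
  segment.\<close>

lemma nth_ge_iff_filter:
  fixes L :: "nat list"
  assumes "sorted_wrt (\<ge>) L"
  shows "i < length L \<and> a \<le> L ! i \<longleftrightarrow> i < length (filter (\<lambda>x. a \<le> x) L)"
  using assms
proof (induction L arbitrary: i)
  case Nil
  then show ?case by simp
next
  case (Cons x L)
  show ?case
  proof (cases "a \<le> x")
    case True
    then show ?thesis using Cons by (cases i) auto
  next
    case False
    then have "filter (\<lambda>x. a \<le> x) L = []" using Cons.prems by (auto simp: filter_empty_conv)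
    moreover have "\<not> (i < length (x # L) \<and> a \<le> (x # L) ! i)"
      using False Cons.prems by (cases i) (auto dest!: nth_mem)
    ultimately show ?thesis using False by simp
  qed
qed

lemma sorted_component_sizes: "sorted_wrt (\<ge>) (component_sizes G)"
  by (simp add: component_sizes_def sorted_wrt_rev)

lemma mset_component_sizes: "mset (component_sizes G) = image_mset card (mset_set (components_of G))"
  by (simp add: component_sizes_def)

context
  fixes G :: "'v ugraph"
  assumes fin: "finite (fst G)"
begin

lemma finite_components: "finite (components_of G)"
  unfolding components_of_def using finite_quotient[OF fin] equiv_connection[of G]
  by (simp add: equiv_type)

lemma component_subset: "C \<in> components_of G \<Longrightarrow> C \<subseteq> fst G"
  unfolding components_of_def using equiv_connection in_quotient_imp_subset by blast

lemma finite_component: "C \<in> components_of G \<Longrightarrow> finite C"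
  using component_subset fin finite_subset by blast

lemma finite_connection: "finite (connection G)"
  by (rule finite_subset[of _ "fst G \<times> fst G"]) (auto simp: connection_def fin)

lemma component_Times_subset: "C \<in> components_of G \<Longrightarrow> C \<times> C \<subseteq> connection G"
  unfolding components_of_def using in_quotient_imp_in_rel[OF equiv_connection[of G]] by auto

text \<open>Counting large components replaces the sorted list, so ranked sizes of two graphs can be
  compared by injections between their large components. A positive threshold ignores the padding
  zeros.\<close>

lemma ranked_size_ge_iff:
  assumes "0 < a"
  shows "a \<le> ranked_size G i \<longleftrightarrow> i < card {C \<in> components_of G. a \<le> card C}"
proof -
  have "length (filter (\<lambda>x. a \<le> x) (component_sizes G)) = size (filter_mset (\<lambda>x. a \<le> x) (mset (component_sizes G)))"
    by (metis mset_filter size_mset)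
  also have "\<dots> = card {C \<in> components_of G. a \<le> card C}"
    unfolding mset_component_sizes using finite_components by (simp add: filter_mset_image_mset)
  finally show ?thesis
    using nth_ge_iff_filter[OF sorted_component_sizes, of i G a] assms
    by (auto simp: ranked_size_def)
qed

lemma decseq_ranked_size: "decseq (ranked_size G)"
  unfolding decseq_def
proof (intro allI impI)
  fix i j :: nat assume "i \<le> j"
  then show "ranked_size G j \<le> ranked_size G i"
    using sorted_wrt_nth_less[OF sorted_component_sizes, of i j G]
    by (cases "i = j") (auto simp: ranked_size_def)
qed

text \<open>The components partition the vertices.\<close>

lemma sum_ranked_size_le: "(\<Sum>i<k. ranked_size G i) \<le> card (fst G)"
proof -
  let ?L = "component_sizes G"
  have "(\<Sum>i<k. ranked_size G i) = (\<Sum>i\<in>{..<k} \<inter> {..<length ?L}. ?L ! i)"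
    by (intro sum.mono_neutral_cong_right) (auto simp: ranked_size_def)
  also have "\<dots> \<le> (\<Sum>i<length ?L. ?L ! i)" by (intro sum_mono2) auto
  also have "\<dots> = sum_list ?L" by (simp add: sum_list_sum_nth atLeast0LessThan)
  also have "\<dots> = sum_mset (mset ?L)" by (simp add: sum_mset_sum_list)
  also have "\<dots> = (\<Sum>C\<in>components_of G. card C)" by (simp add: mset_component_sizes sum_unfold_sum_mset)
  also have "\<dots> = card (\<Union>(components_of G))"
    using equiv_connection[of G] finite_component unfolding components_of_def
    by (intro card_Union_disjoint[symmetric]) (auto simp: pairwise_def disjnt_def dest: quotient_disj)
  also have "\<Union>(components_of G) = fst G"
    unfolding components_of_def by (rule Union_quotient[OF equiv_connection])
  finally show ?thesis .
qed

text \<open>All ordered pairs within a largest component are connected.\<close>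

lemma ranked_size_0_sq_le: "(ranked_size G 0)\<^sup>2 \<le> card (connection G)"
proof (cases "ranked_size G 0 = 0")
  case False
  then have "0 < card {C \<in> components_of G. ranked_size G 0 \<le> card C}"
    using ranked_size_ge_iff[of "ranked_size G 0" 0] by simp
  then obtain C where C: "C \<in> components_of G" "ranked_size G 0 \<le> card C"
    by (metis (mono_tags, lifting) card_gt_0_iff ex_in_conv mem_Collect_eq)
  then have "(ranked_size G 0)\<^sup>2 \<le> card (C \<times> C)" by (simp add: card_cartesian_product power2_eq_square mult_le_mono)
  also have "\<dots> \<le> card (connection G)"
    using C by (intro card_mono finite_connection component_Times_subset)
  finally show ?thesis .
qed simp

end

section \<open>Ranked sizes when the removed edges disconnect few pairs\<close>

context
  fixes V :: "'v set" and A B :: "'v set set" and \<delta> :: real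
  assumes fin: "finite V" and sub: "B \<subseteq> A" and \<delta>: "0 \<le> \<delta>"
    and gap: "real (card (connection (V, A))) - real (card (connection (V, B))) \<le> \<delta>\<^sup>2"
begin

lemma card_connection_diff: "real (card (connection (V, A) - connection (V, B))) \<le> \<delta>\<^sup>2"
  using gap connection_mono[OF sub, of V] finite_connection[of "(V, B)"] fin finite_connection[of "(V, A)"]
  by (simp add: card_Diff_subset card_mono of_nat_diff)

text \<open>Let D be a largest piece of \<open>C\<close>. Each vertex of \<open>C\<close> is
  connected in \<open>B\<close> to at most |D| vertices, so at least |C| (|C| - |D|) pairs of
  \<open>C\<close> were disconnected. This number is at most \<delta>^2 and at least (|C| -
  |D|)^2.\<close>

lemma large_subcomponent_ex:
  assumes C: "C \<in> components_of (V, A)"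
  shows "\<exists>D\<in>components_of (V, B). D \<subseteq> C \<and> real (card C) - \<delta> \<le> real (card D)"
proof -
  let ?R = "connection (V, A)" and ?S = "connection (V, B)"
  have eqR: "equiv V ?R"
    using equiv_connection[of "(V, A)"] by simp
  have CV: "C \<subseteq> V" and finC: "finite C" and C0: "C \<noteq> {}"
    using C component_subset[of "(V, A)" C] finite_component[of "(V, A)" C] fin
      in_quotient_imp_non_empty[OF eqR] by (auto simp: components_of_def)
  obtain w where w: "w \<in> C" "\<And>u. u \<in> C \<Longrightarrow> card (?S `` {u}) \<le> card (?S `` {w})"
  proof -
    have "Max ((\<lambda>u. card (?S `` {u})) ` C) \<in> (\<lambda>u. card (?S `` {u})) ` C"
      using finC C0 by (intro Max_in) auto
    then obtain w where "w \<in> C" "card (?S `` {w}) = Max ((\<lambda>u. card (?S `` {u})) ` C)" by auto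
    then show ?thesis using finC that by simp
  qed
  let ?D = "?S `` {w}"
  have D: "?D \<in> components_of (V, B)" using w CV by (auto simp: components_of_def intro: quotientI)
  have DC: "?D \<subseteq> C"
  proof
    fix z assume "z \<in> ?D"
    then have "(w, z) \<in> ?R" using connection_mono[OF sub] by blast
    then show "z \<in> C" using C w(1) in_quotient_imp_closed[OF eqR] by (auto simp: components_of_def)
  qed
  have fS: "finite (?S `` {u})" for u
    using finite_connection[of "(V, B)"] fin by (simp add: finite_Image)
  have "C \<times> C \<subseteq> (?R - ?S) \<union> Sigma C (\<lambda>u. ?S `` {u})"
    using component_Times_subset[of "(V, A)" C] fin C by auto
  then have "card (C \<times> C) \<le> card ((?R - ?S) \<union> Sigma C (\<lambda>u. ?S `` {u}))"
    using finC fS finite_connection[of "(V, A)"] fin by (intro card_mono) auto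
  also have "\<dots> \<le> card (?R - ?S) + card (Sigma C (\<lambda>u. ?S `` {u}))" by (rule card_Un_le)
  also have "card (Sigma C (\<lambda>u. ?S `` {u})) \<le> (\<Sum>u\<in>C. card ?D)"
    unfolding card_SigmaI[OF finC ballI[OF fS]] by (rule sum_mono) (rule w(2))
  finally have "card C * card C \<le> card (?R - ?S) + card C * card ?D"
    by (simp add: card_cartesian_product)
  then have "real (card C) * real (card C) \<le> real (card (?R - ?S)) + real (card C) * real (card ?D)"
    by (metis of_nat_add of_nat_le_iff of_nat_mult)
  then have "real (card C) * (real (card C) - real (card ?D)) \<le> \<delta>\<^sup>2"
    using card_connection_diff by (simp add: algebra_simps)
  moreover have le: "real (card ?D) \<le> real (card C)" using DC finC by (simp add: card_mono)
  ultimately have "(real (card C) - real (card ?D))\<^sup>2 \<le> \<delta>\<^sup>2"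
    using mult_right_mono[of "real (card C) - real (card ?D)" "real (card C)" "real (card C) - real (card ?D)"]
    by (simp add: power2_eq_square)
  then have "real (card C) - real (card ?D) \<le> \<delta>" using \<delta> by (rule power2_le_imp_le)
  then show ?thesis using D DC by (intro bexI[of _ ?D]) auto
qed

text \<open>Distinct components contain distinct large pieces, so a loss of at most \<delta> in each
  of them costs at most \<delta> in every rank.\<close>

lemma ranked_size_refine_ge: "real (ranked_size (V, A) i) - \<delta> \<le> real (ranked_size (V, B) i)"
proof (cases "real (ranked_size (V, A) i) \<le> \<delta>")
  case False
  define s where "s = ranked_size (V, A) i"
  \<comment> \<open>Sizes being integers, a piece of size at least s - \<delta> has at least this
    size.\<close>
  define a where "a = nat \<lceil>real s - \<delta>\<rceil>"
  have a: "0 < a" "real s - \<delta> \<le> real a" using False by (auto simp: a_def s_def)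
  have s0: "0 < s" using False \<delta> by (simp add: s_def)
  have f: "finite (fst (V, A))" "finite (fst (V, B))" using fin by auto
  obtain D where D: "\<And>C. C \<in> components_of (V, A) \<Longrightarrow>
      D C \<in> components_of (V, B) \<and> D C \<subseteq> C \<and> real (card C) - \<delta> \<le> real (card (D C))"
    using large_subcomponent_ex by metis
  have ne: "D C \<noteq> {}" if "C \<in> components_of (V, A)" for C
    using D[OF that] in_quotient_imp_non_empty[OF equiv_connection[of "(V, B)"], of "D C"]
    by (auto simp: components_of_def)
  have "i < card {C \<in> components_of (V, A). s \<le> card C}"
    using ranked_size_ge_iff[OF f(1) s0, of i] by (simp add: s_def)
  also have "\<dots> \<le> card {C \<in> components_of (V, B). a \<le> card C}"
  proof (rule card_inj_on_le[of D])
    show "inj_on D {C \<in> components_of (V, A). s \<le> card C}"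
    proof (rule inj_onI)
      fix C C' assume "C \<in> {C \<in> components_of (V, A). s \<le> card C}"
        "C' \<in> {C \<in> components_of (V, A). s \<le> card C}" "D C = D C'"
      then have "C \<inter> C' \<noteq> {}" and "C \<in> components_of (V, A)" "C' \<in> components_of (V, A)"
        using D ne by blast+
      then show "C = C'" using quotient_disj[OF equiv_connection[of "(V, A)"]] unfolding components_of_def by metis
    qed
    show "D ` {C \<in> components_of (V, A). s \<le> card C} \<subseteq> {C \<in> components_of (V, B). a \<le> card C}"
    proof clarify
      fix C assume C: "C \<in> components_of (V, A)" "s \<le> card C"
      then have "real s - \<delta> \<le> real (card (D C))" using D[OF C(1)] by linarith
      then have "a \<le> card (D C)" unfolding a_def by (simp add: ceiling_le_iff nat_le_iff)
      then show "D C \<in> components_of (V, B) \<and> a \<le> card (D C)" using D[OF C(1)] by simp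
    qed
  qed (use finite_components[OF f(2)] in auto)
  finally have "a \<le> ranked_size (V, B) i" using ranked_size_ge_iff[OF f(2) a(1)] by simp
  then show ?thesis using a(2) by (simp add: s_def)
qed simp

text \<open>Two pieces of one component of \<open>A\<close> that both have size above \<open>\<delta>\<close> would account for more than
  \<open>\<delta>\<^sup>2\<close> disconnected pairs.\<close>

lemma ranked_size_refine_le: "real (ranked_size (V, B) i) \<le> max (real (ranked_size (V, A) i)) \<delta>"
proof (cases "real (ranked_size (V, B) i) \<le> \<delta>")
  case False
  define s where "s = ranked_size (V, B) i"
  have s: "0 < s" "\<delta> < real s" using False \<delta> by (auto simp: s_def)
  have f: "finite (fst (V, A))" "finite (fst (V, B))" using fin by auto
  let ?R = "connection (V, A)" and ?S = "connection (V, B)"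
  have eqS: "equiv V ?S"
    using equiv_connection[of "(V, B)"] by simp
  have "\<exists>C\<in>components_of (V, A). D \<subseteq> C" if D: "D \<in> components_of (V, B)" for D
  proof -
    obtain u where "u \<in> V" "D = ?S `` {u}" using D by (auto simp: components_of_def elim: quotientE)
    then show ?thesis using connection_mono[OF sub, of V]
      by (intro bexI[of _ "?R `` {u}"]) (auto simp: components_of_def intro: quotientI)
  qed
  then obtain C where C: "\<And>D. D \<in> components_of (V, B) \<Longrightarrow> C D \<in> components_of (V, A) \<and> D \<subseteq> C D"
    by metis
  have "i < card {D \<in> components_of (V, B). s \<le> card D}"
    using ranked_size_ge_iff[OF f(2) s(1), of i] by (simp add: s_def)
  also have "\<dots> \<le> card {D \<in> components_of (V, A). s \<le> card D}"
  proof (rule card_inj_on_le[of C])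
    show "inj_on C {D \<in> components_of (V, B). s \<le> card D}"
    proof (rule inj_onI, rule ccontr)
      fix D D' assume D: "D \<in> {D \<in> components_of (V, B). s \<le> card D}"
        and D': "D' \<in> {D \<in> components_of (V, B). s \<le> card D}" and eq: "C D = C D'" and neq: "D \<noteq> D'"
      have disj: "D \<inter> D' = {}"
        using D D' neq quotient_disj[OF eqS] unfolding components_of_def by auto
      have "D \<times> D' \<subseteq> ?R - ?S"
      proof
        fix p assume p: "p \<in> D \<times> D'"
        then have "p \<in> C D \<times> C D" using C D D' eq by fastforce
        then have "p \<in> ?R" using component_Times_subset[of "(V, A)" "C D"] C D fin by auto
        moreover have "p \<notin> ?S"
        proof
          assume "p \<in> ?S"
          then have "snd p \<in> D" using p D in_quotient_imp_closed[OF eqS, of D "fst p" "snd p"]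
            by (auto simp: components_of_def)
          then show False using p disj by auto
        qed
        ultimately show "p \<in> ?R - ?S" by simp
      qed
      then have "card (D \<times> D') \<le> card (?R - ?S)"
        using finite_connection[OF f(1)] by (intro card_mono) auto
      then have "real (card D) * real (card D') \<le> \<delta>\<^sup>2"
        using card_connection_diff by (simp add: card_cartesian_product) (metis of_nat_le_iff of_nat_mult order_trans)
      moreover have "\<delta> * \<delta> < real (card D) * real (card D')"
        using D D' s \<delta> by (intro mult_strict_mono') auto
      ultimately show False by (simp add: power2_eq_square)
    qed
    show "C ` {D \<in> components_of (V, B). s \<le> card D} \<subseteq> {C \<in> components_of (V, A). s \<le> card C}"
    proof clarify
      fix D assume D: "D \<in> components_of (V, B)" "s \<le> card D"
      then have "card D \<le> card (C D)" using C finite_component[OF f(1)] by (intro card_mono) auto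
      then show "C D \<in> components_of (V, A) \<and> s \<le> card (C D)" using C D by auto
    qed
  qed (use finite_components[OF f(1)] in auto)
  finally have "s \<le> ranked_size (V, A) i" using ranked_size_ge_iff[OF f(1) s(1)] by simp
  then show ?thesis by (simp add: s_def)
qed simp

lemma ranked_size_refine: "\<bar>real (ranked_size (V, A) i) - real (ranked_size (V, B) i)\<bar> \<le> \<delta>"
  using ranked_size_refine_ge[of i] ranked_size_refine_le[of i] \<delta> by (auto simp: max_def split: if_splits)

end


section \<open>Fragmentation paths\<close>

definition surviving :: "'v set set \<Rightarrow> ('v set \<Rightarrow> real) \<Rightarrow> real \<Rightarrow> 'v set set" where
  "surviving E \<tau> t = {e \<in> E. \<not> \<tau> e \<le> t}"

definition component_profile :: "'v ugraph \<Rightarrow> nat \<Rightarrow> real" where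
  "component_profile G i = real (ranked_size G i) / real (card (fst G))"

text \<open>The probability that two independent uniform vertices, possibly equal, lie in one
  component; equivalently the sum of the squared normalized sizes.\<close>

definition connected_fraction :: "'v ugraph \<Rightarrow> real" where
  "connected_fraction G = real (card (connection G)) / (real (card (fst G)))\<^sup>2"

lemma delete_up_to_eq: "delete_up_to G \<tau> t = (fst G, surviving (snd G) \<tau> t)"
  by (simp add: delete_up_to_def surviving_def)

lemma surviving_antimono: "s \<le> t \<Longrightarrow> surviving E \<tau> t \<subseteq> surviving E \<tau> s"
  by (auto simp: surviving_def)

lemma surviving_subset: "surviving E \<tau> t \<subseteq> E"
  by (auto simp: surviving_def)

lemma fragmentation_eq:
  "0 \<le> t \<Longrightarrow> card (fst G) = n \<Longrightarrow>
    fragmentation n G \<tau> t = component_profile (fst G, surviving (snd G) \<tau> t)"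
  by (auto simp: fragmentation_def component_profile_def ranked_size_def Let_def delete_up_to_eq)

lemma component_profile_in_S_dec_le1:
  assumes "finite (fst G)" "fst G \<noteq> {}"
  shows "component_profile G \<in> S_dec_le1"
proof (rule S_dec_le1I)
  have pos: "0 < card (fst G)" using assms by (simp add: card_gt_0_iff)
  show "component_profile G \<in> S_dec"
    using decseq_ranked_size[OF assms(1)] pos
    by (auto simp: S_dec_def component_profile_def decseq_def divide_right_mono)
  fix k
  have "(\<Sum>j<k. component_profile G j) = real (\<Sum>j<k. ranked_size G j) / real (card (fst G))"
    by (simp add: component_profile_def sum_divide_distrib)
  also have "\<dots> \<le> 1" using sum_ranked_size_le[OF assms(1), of k] pos
    by (simp only: divide_le_eq_1 of_nat_le_iff of_nat_0_less_iff) simp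
  finally show "(\<Sum>j<k. component_profile G j) \<le> 1" .
qed

text \<open>There are finitely many clocks, so the path is constant just after each
  \<open>t\<close>, and just before \<open>t\<close> it shows the graph of the edges with clock not
  below \<open>t\<close>.\<close>

lemma fragmentation_cadlag:
  assumes V: "finite (fst G)" "fst G \<noteq> {}" "card (fst G) = n" and E: "finite (snd G)"
  shows "fragmentation n G \<tau> \<in> cadlag_space S_dec_le1"
proof -
  let ?x = "fragmentation n G \<tau>" and ?p = "\<lambda>A. component_profile (fst G, A)"
  have x: "?x t = ?p (surviving (snd G) \<tau> t)" if "0 \<le> t" for t
    using fragmentation_eq[OF that V(3)] .
  have pS: "?p A \<in> S_dec_le1" for A using V by (intro component_profile_in_S_dec_le1) auto
  have "?x \<in> {0..} \<rightarrow>\<^sub>E S_dec_le1" using x pS by (auto simp: fragmentation_def)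
  moreover have "(?x \<longlongrightarrow> ?x t) (at_right t)" if t: "0 \<le> t" for t
  proof (rule tendsto_eventually)
    have "\<forall>\<^sub>F s in at_right t. \<forall>e\<in>snd G. \<tau> e \<le> s \<longleftrightarrow> \<tau> e \<le> t"
    proof (intro eventually_ball_finite ballI E)
      fix e
      have "\<forall>\<^sub>F s in at_right t. \<tau> e \<le> t \<or> s < \<tau> e"
        using eventually_at_right_real[of t "\<tau> e"] by (cases "\<tau> e \<le> t") (auto elim: eventually_mono)
      then show "\<forall>\<^sub>F s in at_right t. \<tau> e \<le> s \<longleftrightarrow> \<tau> e \<le> t"
        using eventually_at_right_less[of t] by eventually_elim auto
    qed
    then show "\<forall>\<^sub>F s in at_right t. ?x s = ?x t"
      using eventually_at_right_less[of t]
    proof eventually_elim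
      case (elim s)
      then have "surviving (snd G) \<tau> s = surviving (snd G) \<tau> t" by (auto simp: surviving_def)
      then show ?case using elim t x by simp
    qed
  qed
  moreover have "\<exists>l\<in>S_dec_le1. (?x \<longlongrightarrow> l) (at_left t)" if t: "0 < t" for t
  proof (intro bexI[OF _ pS] tendsto_eventually)
    have "\<forall>\<^sub>F s in at_left t. \<forall>e\<in>snd G. \<tau> e \<le> s \<longleftrightarrow> \<tau> e < t"
    proof (intro eventually_ball_finite ballI E)
      fix e
      have "\<forall>\<^sub>F s in at_left t. t \<le> \<tau> e \<or> \<tau> e < s"
        using eventually_at_left_real[of "\<tau> e" t] by (cases "t \<le> \<tau> e") (auto elim: eventually_mono)
      moreover have "\<forall>\<^sub>F s in at_left t. s < t" by (simp add: eventually_at_filter)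
      ultimately show "\<forall>\<^sub>F s in at_left t. \<tau> e \<le> s \<longleftrightarrow> \<tau> e < t" by eventually_elim auto
    qed
    then show "\<forall>\<^sub>F s in at_left t. ?x s = ?p {e \<in> snd G. \<not> \<tau> e < t}"
      using eventually_at_left_real[OF t]
    proof eventually_elim
      case (elim s)
      then have "surviving (snd G) \<tau> s = {e \<in> snd G. \<not> \<tau> e < t}" by (auto simp: surviving_def)
      then show ?case using elim x by simp
    qed
  qed
  ultimately show ?thesis by (simp add: cadlag_space_def)
qed

section \<open>Connected pairs control the profile\<close>

lemma connected_fraction_mono:
  assumes "finite V" "A \<subseteq> B" shows "connected_fraction (V, A) \<le> connected_fraction (V, B)"
  using assms connection_mono[OF assms(2), of V] finite_connection[of "(V, B)"]
  by (auto simp: connected_fraction_def intro!: divide_right_mono card_mono)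

lemma connected_fraction_nonneg: "0 \<le> connected_fraction G"
  by (simp add: connected_fraction_def)

lemma connected_fraction_le_1:
  assumes "finite (fst G)" shows "connected_fraction G \<le> 1"
proof -
  have "card (connection G) \<le> card (fst G \<times> fst G)"
    using assms by (intro card_mono) (auto simp: connection_def)
  then have "real (card (connection G)) \<le> (real (card (fst G)))\<^sup>2"
    by (metis card_cartesian_product of_nat_le_iff of_nat_mult power2_eq_square)
  then show ?thesis by (auto simp: connected_fraction_def divide_le_eq_1)
qed

text \<open>A loss of d in the fraction means that d n^2 pairs were disconnected, so the refinement
  bound applies with \<delta> equal to n times sqrt d.\<close>

lemma component_profile_diff_le:
  assumes V: "finite V" "V \<noteq> {}" and sub: "B \<subseteq> A"
  shows "\<bar>component_profile (V, A) i - component_profile (V, B) i\<bar>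
    \<le> sqrt (connected_fraction (V, A) - connected_fraction (V, B))"
proof -
  let ?d = "connected_fraction (V, A) - connected_fraction (V, B)"
  let ?n = "real (card V)"
  have n: "0 < ?n" using V by (simp add: card_gt_0_iff)
  have d: "0 \<le> ?d" using connected_fraction_mono[OF V(1) sub] by simp
  have "real (card (connection (V, A))) - real (card (connection (V, B))) = (?n * sqrt ?d)\<^sup>2"
    using d n by (simp add: power_mult_distrib connected_fraction_def field_simps)
  then have "\<bar>real (ranked_size (V, A) i) - real (ranked_size (V, B) i)\<bar> \<le> ?n * sqrt ?d"
    using n d by (intro ranked_size_refine V(1) sub) auto
  then show ?thesis
    using n by (simp add: component_profile_def diff_divide_distrib[symmetric] field_simps)
qed

text \<open>A largest component of normalized size x contributes x^2 to the fraction, and 1 - x^2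
  \<le> 2 (1 - x).\<close>

lemma connected_fraction_ge:
  assumes V: "finite (fst G)" "fst G \<noteq> {}"
  shows "1 - connected_fraction G \<le> 2 * (1 - component_profile G 0)"
proof -
  let ?n = "real (card (fst G))"
  have n: "0 < ?n" using V by (simp add: card_gt_0_iff)
  have "(component_profile G 0)\<^sup>2 = real ((ranked_size G 0)\<^sup>2) / ?n\<^sup>2"
    by (simp add: component_profile_def power_divide)
  also have "\<dots> \<le> connected_fraction G"
    unfolding connected_fraction_def using ranked_size_0_sq_le[OF V(1)]
    by (intro divide_right_mono of_nat_mono) auto
  finally have "(component_profile G 0)\<^sup>2 \<le> connected_fraction G" .
  moreover have "0 \<le> (1 - component_profile G 0)\<^sup>2" by simp
  ultimately show ?thesis by (simp add: power2_eq_square algebra_simps)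
qed


section \<open>Greedy times of macroscopic decrease\<close>

text \<open>\<open>drop_ref \<eta> q k\<close> is the value of \<open>q\<close> at the last greedy time up to \<open>k\<close>.\<close>

fun drop_ref :: "real \<Rightarrow> (nat \<Rightarrow> real) \<Rightarrow> nat \<Rightarrow> real" where
  "drop_ref \<eta> q 0 = q 0"
| "drop_ref \<eta> q (Suc k) = (if \<eta> \<le> drop_ref \<eta> q k - q (Suc k) then q (Suc k) else drop_ref \<eta> q k)"

text \<open>Index 0 counts as a greedy time, which is the extra 1 in the count 1 + 1 /
  \<eta>.\<close>

definition drop_time :: "real \<Rightarrow> (nat \<Rightarrow> real) \<Rightarrow> nat \<Rightarrow> bool" where
  "drop_time \<eta> q k \<longleftrightarrow> k = 0 \<or> \<eta> \<le> drop_ref \<eta> q (k - 1) - q k"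

lemma drop_ref_cong: "(\<And>j. j \<le> k \<Longrightarrow> q j = q' j) \<Longrightarrow> drop_ref \<eta> q k = drop_ref \<eta> q' k"
  by (induction k) auto

text \<open>The stopping-time property, on which the separation of past and future clocks
  rests.\<close>

lemma drop_time_cong:
  assumes "\<And>j. j \<le> k \<Longrightarrow> q j = q' j" shows "drop_time \<eta> q k \<longleftrightarrow> drop_time \<eta> q' k"
  using drop_ref_cong[of "k - 1" q q' \<eta>] assms by (simp add: drop_time_def)

lemma drop_ref_at_drop_time: "drop_time \<eta> q k \<Longrightarrow> drop_ref \<eta> q k = q k"
  by (cases k) (auto simp: drop_time_def)

context
  fixes q :: "nat \<Rightarrow> real" and \<eta> :: real
  assumes q: "decseq q" and \<eta>: "0 < \<eta>"
begin

lemma drop_ref_ge: "q k \<le> drop_ref \<eta> q k"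
proof (induction k)
  case (Suc k)
  then show ?case using decseqD[OF q, of k "Suc k"] by auto
qed simp

lemma drop_ref_less: "drop_ref \<eta> q k < q k + \<eta>"
  using \<eta> by (induction k) auto

lemma decseq_drop_ref: "decseq (drop_ref \<eta> q)"
  using \<eta> by (intro decseq_SucI) auto

text \<open>The reference value is reset to \<open>q k\<close> at \<open>k\<close> and can only fall
  afterwards.\<close>

lemma drop_time_gap:
  assumes "drop_time \<eta> q k" "drop_time \<eta> q k'" "k < k'"
  shows "\<eta> \<le> q k - q k'"
proof -
  have "\<eta> \<le> drop_ref \<eta> q (k' - 1) - q k'" using assms(2,3) by (simp add: drop_time_def)
  moreover have "drop_ref \<eta> q (k' - 1) \<le> drop_ref \<eta> q k"
    using assms(3) by (intro decseqD[OF decseq_drop_ref]) auto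
  ultimately show ?thesis using drop_ref_at_drop_time[OF assms(1)] by simp
qed

text \<open>The reference value is constant on the stretch, and \<open>q\<close> stays within \<eta>
  below it.\<close>

lemma between_drop_times:
  assumes "j \<le> j'" "\<And>k. j < k \<Longrightarrow> k \<le> j' \<Longrightarrow> \<not> drop_time \<eta> q k"
  shows "q j - q j' < \<eta>"
proof -
  have "drop_ref \<eta> q j' = drop_ref \<eta> q j"
    using assms
  proof (induction j' rule: dec_induct)
    case (step k)
    have "\<not> drop_time \<eta> q (Suc k)" using step.hyps step.prems by simp
    then show ?case using step by (simp add: drop_time_def)
  qed simp
  then show ?thesis using drop_ref_ge[of j] drop_ref_less[of j'] by simp
qed

text \<open>Telescoping: every greedy time after 0 lowers the reference value by at least
  \<eta>.\<close>

lemma card_drop_times: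
  "real (card {k \<in> {..N}. drop_time \<eta> q k}) * \<eta> \<le> \<eta> + q 0 - drop_ref \<eta> q N"
proof (induction N)
  case 0
  have "{k \<in> {..0}. drop_time \<eta> q k} = {0}" by (auto simp: drop_time_def)
  then show ?case by simp
next
  case (Suc N)
  have eq: "{k \<in> {..Suc N}. drop_time \<eta> q k} = (if drop_time \<eta> q (Suc N)
      then insert (Suc N) {k \<in> {..N}. drop_time \<eta> q k} else {k \<in> {..N}. drop_time \<eta> q k})"
    by (auto simp: le_Suc_eq)
  show ?case
  proof (cases "drop_time \<eta> q (Suc N)")
    case True
    then have "\<eta> \<le> drop_ref \<eta> q N - drop_ref \<eta> q (Suc N)" by (simp add: drop_time_def)
    then show ?thesis using Suc True unfolding eq by (simp add: algebra_simps del: drop_ref.simps)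
  next
    case False
    then have "drop_ref \<eta> q (Suc N) = drop_ref \<eta> q N" by (simp add: drop_time_def)
    then show ?thesis using Suc False unfolding eq by (simp del: drop_ref.simps)
  qed
qed

end

text \<open>The bad event. It is phrased by the drop over a fixed window after a greedy time, rather
  than by two close greedy times, so that its probability can be bounded through an expected drop.
  Indices up to \<open>m * m * L\<close> cover the times up to m.\<close>

definition clustered_drops :: "real \<Rightarrow> nat \<Rightarrow> nat \<Rightarrow> (real \<Rightarrow> real) \<Rightarrow> bool" where
  "clustered_drops \<eta> m L q \<longleftrightarrow> (\<exists>k\<le>m * m * L. drop_time \<eta> (\<lambda>j. q (real j / real (m * L))) k \<and>
     \<eta> \<le> q (real k / real (m * L)) - q (real k / real (m * L) + 1 / real m))"

text \<open>The positive greedy times serve as exceptional set: between them the fraction drops by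
  less than \<eta>, so the profile moves by at most sqrt \<eta>, and without clustered drops they
  are more than 1 / m apart. Of the two terms 1 / m, one is the time shift and one the horizon term
  with K = m.\<close>

lemma sk_close_discretize_fragmentation:
  fixes G :: "'v ugraph"
  defines "q \<equiv> \<lambda>\<tau> t. connected_fraction (fst G, surviving (snd G) \<tau> t)"
  assumes V: "finite (fst G)" "fst G \<noteq> {}" "card (fst G) = n"
    and \<eta>: "0 < \<eta>" and m: "0 < m" and L: "0 < L" and nc: "\<not> clustered_drops \<eta> m L (q \<tau>)"
  shows "sk_close (sqrt \<eta> + 2 / real m) (discretize (m * L) (fragmentation n G \<tau>))
    (discretize m (fragmentation n G \<tau>))"
proof -
  let ?M = "m * L"
  let ?x = "fragmentation n G \<tau>"
  let ?y = "discretize ?M ?x"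
  let ?t = "\<lambda>k. real k / real ?M"
  let ?q = "\<lambda>j. q \<tau> (?t j)"
  have M: "0 < real ?M" using m L by simp
  have x: "?x t = component_profile (fst G, surviving (snd G) \<tau> t)" if "0 \<le> t" for t
    using fragmentation_eq[OF that V(3)] .
  have xS: "?x t \<in> S_dec_le1" if "0 \<le> t" for t
    using that V x by (simp add: component_profile_in_S_dec_le1)
  have q_anti: "q \<tau> t \<le> q \<tau> s" if "s \<le> t" for s t
    unfolding q_def using V that by (intro connected_fraction_mono surviving_antimono)
  have dq: "decseq ?q" unfolding decseq_def using M by (auto intro!: q_anti divide_right_mono)
  define F where "F = ?t ` {k. 0 < k \<and> k \<le> m * m * L \<and> drop_time \<eta> ?q k}"
  have gap: "1 / real m < p' - p" if p: "p \<in> F" "p' \<in> F" "p < p'" for p p'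
  proof (rule ccontr)
    assume close: "\<not> 1 / real m < p' - p"
    obtain k k' where k: "p = ?t k" "p' = ?t k'" "drop_time \<eta> ?q k" "drop_time \<eta> ?q k'" "k \<le> m * m * L"
      using p unfolding F_def by blast
    have "k < k'" using p(3) M unfolding k by (simp add: divide_less_cancel)
    then have "\<eta> \<le> q \<tau> p - q \<tau> p'" using drop_time_gap[OF dq \<eta> k(3,4)] k by simp
    also have "\<dots> \<le> q \<tau> p - q \<tau> (p + 1 / real m)" using close by (intro diff_left_mono q_anti) auto
    finally show False using nc k unfolding clustered_drops_def by blast
  qed
  have osc: "osc_le (sqrt \<eta>) F 0 (real m) ?y"
    unfolding osc_le_def
  proof (intro allI impI)
    fix s t i assume st: "0 \<le> s \<and> s \<le> t \<and> t < real m \<and> F \<inter> {s<..t} = {}"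
    define j where "j = nat \<lfloor>s * real ?M\<rfloor>"
    define j' where "j' = nat \<lfloor>t * real ?M\<rfloor>"
    have "s * real ?M \<le> t * real ?M" using st M by (intro mult_right_mono) auto
    then have jj: "j \<le> j'" unfolding j_def j'_def by (intro nat_mono floor_mono)
    have j'le: "real j' \<le> t * real ?M" unfolding j'_def using st M by simp
    also have "\<dots> < real m * real ?M" using st M by (intro mult_strict_right_mono) auto
    finally have "real j' < real (m * m * L)" by simp
    then have j'lt: "j' < m * m * L" by (simp only: of_nat_less_iff)
    also have "\<dots> \<le> ?M * ?M" using L by (simp add: mult_ac)
    finally have grid: "grid ?M t = j'" "grid ?M s = j" using jj by (auto simp: grid_def j_def j'_def)
    have y: "?y s = ?x (?t j)" "?y t = ?x (?t j')"
      using st grid by (auto simp: discretize_def step_path_def)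
    have "\<not> drop_time \<eta> ?q k" if k: "j < k" "k \<le> j'" for k
    proof
      assume "drop_time \<eta> ?q k"
      then have "?t k \<in> F" using k j'lt by (auto simp: F_def)
      moreover have "s < ?t k"
      proof -
        have "s * real ?M < real j + 1" unfolding j_def using st M by simp
        then have "s * real ?M < real k" using k by linarith
        then show ?thesis using M by (simp add: pos_less_divide_eq)
      qed
      moreover have "?t k \<le> t"
      proof -
        have "real k \<le> t * real ?M" using j'le k by linarith
        then show ?thesis using M by (simp add: pos_divide_le_eq)
      qed
      ultimately show False using st by auto
    qed
    then have "?q j - ?q j' < \<eta>" using between_drop_times[OF dq \<eta> jj] by blast
    then have "sqrt (?q j - ?q j') \<le> sqrt \<eta>" by simp
    moreover have "?t j \<le> ?t j'" using jj M by (intro divide_right_mono) auto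
    then have "\<bar>?x (?t j) i - ?x (?t j') i\<bar> \<le> sqrt (?q j - ?q j')"
      unfolding q_def using V M by (simp add: x component_profile_diff_le surviving_antimono)
    ultimately show "\<bar>?y s i - ?y t i\<bar> \<le> sqrt \<eta>" unfolding y by linarith
  qed
  have "sk_close (sqrt \<eta> + 1 / real m + 1 / real m) ?y (discretize m ?y)"
  proof (rule sk_close_discretize[where F=F])
    show "finite F" unfolding F_def by (rule finite_imageI, rule finite_subset[of _ "{..m * m * L}"]) auto
    show "F \<subseteq> {0<..}" unfolding F_def using M by auto
    show "?y t \<in> S_dec_le1" if "0 \<le> t" for t
      using that xS by (auto simp: discretize_def step_path_def)
  qed (use m \<eta> gap osc in auto)
  then show ?thesis unfolding discretize_discretize[OF m L] by (simp add: algebra_simps)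
qed


section \<open>Exponential clocks on a fixed tree\<close>

lemma tree_finite:
  assumes "is_tree G" shows "finite (fst G)" "fst G \<noteq> {}" "finite (snd G)"
proof -
  show "finite (fst G)" "fst G \<noteq> {}" using assms by (auto simp: is_tree_def finite_simple_graph_def)
  moreover have "snd G \<subseteq> Pow (fst G)" using assms by (auto simp: is_tree_def finite_simple_graph_def)
  ultimately show "finite (snd G)" using finite_subset by blast
qed

text \<open>The random subset has finitely many possible values; induction splits on whether one
  element is selected.\<close>

lemma measurable_Collect_finite_set:
  fixes f :: "'e set \<Rightarrow> real"
  assumes "finite E" "\<And>e. e \<in> E \<Longrightarrow> {\<omega> \<in> space M. P e \<omega>} \<in> sets M"
  shows "(\<lambda>\<omega>. f {e \<in> E. P e \<omega>}) \<in> borel_measurable M"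
  using assms
proof (induction E arbitrary: f rule: finite_induct)
  case (insert x E)
  have eq: "{e \<in> insert x E. P e \<omega>} =
      (if P x \<omega> then insert x {e \<in> E. P e \<omega>} else {e \<in> E. P e \<omega>})" for \<omega>
    by auto
  have "(\<lambda>\<omega>. if P x \<omega> then f (insert x {e \<in> E. P e \<omega>}) else f {e \<in> E. P e \<omega>}) \<in> borel_measurable M"
    using insert.prems insert.IH[of f] insert.IH[of "\<lambda>A. f (insert x A)"] by (intro measurable_If) auto
  then show ?case unfolding eq by (simp add: if_distrib cong: if_cong)
qed simp

lemma drop_ref_measurable:
  assumes "\<And>j. (\<lambda>\<omega>. q \<omega> j) \<in> borel_measurable M"
  shows "(\<lambda>\<omega>. drop_ref \<eta> (q \<omega>) k) \<in> borel_measurable M"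
proof (induction k)
  case (Suc k)
  note [measurable] = Suc assms
  show ?case by simp
qed (simp add: assms)

lemma drop_time_measurable:
  assumes "\<And>j. (\<lambda>\<omega>. q \<omega> j) \<in> borel_measurable M"
  shows "{\<omega> \<in> space M. drop_time \<eta> (q \<omega>) k} \<in> sets M"
proof -
  note [measurable] = assms drop_ref_measurable[OF assms]
  show ?thesis unfolding drop_time_def by measurable
qed

lemma surviving_function_measurable:
  fixes f :: "'v set set \<Rightarrow> real"
  assumes "finite E" "\<And>e. e \<in> E \<Longrightarrow> \<tau> e \<in> borel_measurable M"
  shows "(\<lambda>\<omega>. f (surviving E (\<lambda>e. \<tau> e \<omega>) t)) \<in> borel_measurable M"
  unfolding surviving_def
proof (rule measurable_Collect_finite_set[OF assms(1)])
  fix e assume "e \<in> E"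
  note [measurable] = assms(2)[OF this]
  show "{\<omega> \<in> space M. \<not> \<tau> e \<omega> \<le> t} \<in> sets M" by measurable
qed

lemma clustered_drops_measurable:
  assumes "\<And>t. (\<lambda>\<omega>. q \<omega> t) \<in> borel_measurable M"
  shows "{\<omega> \<in> space M. clustered_drops \<eta> m L (q \<omega>)} \<in> sets M"
proof -
  note [measurable] = assms
  have [measurable]: "Measurable.pred M (\<lambda>\<omega>. drop_time \<eta> (\<lambda>j. q \<omega> (real j / real (m * L))) k)" for k
    using drop_time_measurable[of "\<lambda>\<omega> j. q \<omega> (real j / real (m * L))" M \<eta> k] assms by (simp add: pred_def)
  show ?thesis unfolding clustered_drops_def by measurable
qed

lemma of_bool_measurable:
  "{\<omega> \<in> space M. R \<omega>} \<in> sets M \<Longrightarrow> (\<lambda>\<omega>. of_bool (R \<omega>) :: real) \<in> borel_measurable M"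
  unfolding of_bool_def by (intro measurable_If) auto

section \<open>Memorylessness and the expected drop for a fixed tree\<close>

context prob_space
begin

lemma expectation_of_bool:
  assumes "{\<omega> \<in> space M. R \<omega>} \<in> sets M"
  shows "expectation (\<lambda>\<omega>. of_bool (R \<omega>) :: real) = prob {\<omega> \<in> space M. R \<omega>}"
proof -
  have "expectation (\<lambda>\<omega>. of_bool (R \<omega>) :: real) = expectation (indicator {\<omega> \<in> space M. R \<omega>})"
    by (intro Bochner_Integration.integral_cong) (auto simp: indicator_def)
  then show ?thesis using assms by simp
qed

lemma integrable_of_bool:
  "{\<omega> \<in> space M. R \<omega>} \<in> sets M \<Longrightarrow> integrable M (\<lambda>\<omega>. of_bool (R \<omega>) :: real)"
  by (intro integrable_const_bound[where B=1] of_bool_measurable) auto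

context
  fixes V :: "'v set" and E :: "'v set set" and \<tau> :: "'v set \<Rightarrow> 'a \<Rightarrow> real" and r :: real
  assumes tree: "is_tree (V, E)" and r: "0 < r"
    and ind: "indep_vars (\<lambda>_. borel) \<tau> E"
    and distr: "\<And>e. e \<in> E \<Longrightarrow> distributed M lborel (\<tau> e) (exponential_density r)"
begin

abbreviation (input) "surv t \<omega> \<equiv> surviving E (\<lambda>e. \<tau> e \<omega>) t"
abbreviation (input) "cfrac t \<omega> \<equiv> connected_fraction (V, surv t \<omega>)"

lemma vertices_edges_finite: "finite V" "V \<noteq> {}" "finite E"
  using tree_finite[OF tree] by auto

lemma clock_measurable: "e \<in> E \<Longrightarrow> \<tau> e \<in> borel_measurable M"
  using distr[of e] by (simp add: distributed_def)

lemma surv_measurable: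
  fixes f :: "'v set set \<Rightarrow> real"
  shows "(\<lambda>\<omega>. f (surv t \<omega>)) \<in> borel_measurable M"
  by (rule surviving_function_measurable[OF vertices_edges_finite(3) clock_measurable])

lemma prob_all_survive:
  assumes P: "P \<subseteq> E" and t: "0 \<le> t"
  shows "prob {\<omega> \<in> space M. P \<subseteq> surv t \<omega>} = exp (- r * t * card P)"
proof (cases "P = {}")
  case True
  then show ?thesis by (simp add: prob_space)
next
  case False
  have fin: "finite P" using P vertices_edges_finite finite_subset by blast
  have "{\<omega> \<in> space M. P \<subseteq> surv t \<omega>} = (\<Inter>e\<in>P. \<tau> e -` {t<..} \<inter> space M)"
    using P False by (auto simp: surviving_def not_le)
  then have "prob {\<omega> \<in> space M. P \<subseteq> surv t \<omega>} = (\<Prod>e\<in>P. prob (\<tau> e -` {t<..} \<inter> space M))"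
    using indep_varsD[OF ind False fin P, of "\<lambda>_. {t<..}"] by simp
  also have "\<dots> = (\<Prod>e\<in>P. exp (- t * r))"
  proof (rule prod.cong)
    fix e assume "e \<in> P"
    then show "prob (\<tau> e -` {t<..} \<inter> space M) = exp (- t * r)"
      using exponential_distributedD_gt[OF distr t r, of e] P
      by (auto simp: vimage_def Int_def conj_commute)
  qed simp
  also have "\<dots> = exp (- r * t * card P)" by (simp add: exp_of_nat_mult[symmetric] mult_ac)
  finally show ?thesis .
qed

text \<open>While no edge of \<open>P\<close> has been deleted, the past up to the \<open>k\<close>th grid time is a function of
  the clocks outside \<open>P\<close>.\<close>

lemma prob_drop_time_and_survive:
  assumes P: "P \<subseteq> E" and h: "0 \<le> h"
  obtains c where "0 \<le> c" "\<And>s. real k * h \<le> s \<Longrightarrow>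
    prob {\<omega> \<in> space M. drop_time \<eta> (\<lambda>j. cfrac (real j * h) \<omega>) k \<and> P \<subseteq> surv s \<omega>} =
      c * exp (- r * s * card P)"
proof -
  \<comment> \<open>The past recomputed from the clocks outside \<open>P\<close> alone, with all of
    \<open>P\<close> declared alive.\<close>
  define H where "H = {\<rho> \<in> space (PiM (E - P) (\<lambda>_. borel :: real measure)).
    drop_time \<eta> (\<lambda>j. connected_fraction (V, {e \<in> E - P. \<not> \<rho> e \<le> real j * h} \<union> P)) k}"
  have H: "H \<in> sets (PiM (E - P) (\<lambda>_. borel))"
    unfolding H_def
  proof (rule drop_time_measurable)
    fix j
    show "(\<lambda>\<rho>. connected_fraction (V, {e \<in> E - P. \<not> \<rho> e \<le> real j * h} \<union> P))
        \<in> borel_measurable (PiM (E - P) (\<lambda>_. borel))"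
      by (rule measurable_Collect_finite_set[of _ _ _ "\<lambda>A. connected_fraction (V, A \<union> P)"])
        (use vertices_edges_finite in auto)
  qed
  define X where "X = (\<lambda>\<omega>. restrict (\<lambda>e. \<tau> e \<omega>) (E - P))"
  define Y where "Y = (\<lambda>\<omega>. restrict (\<lambda>e. \<tau> e \<omega>) P)"
  have iv: "indep_var (PiM (E - P) (\<lambda>_. borel)) X (PiM P (\<lambda>_. borel)) Y"
    unfolding X_def Y_def using P by (intro indep_var_restrict[OF ind]) auto
  have fP: "finite P" using P vertices_edges_finite finite_subset by blast
  show ?thesis
  proof (rule that[of "prob (X -` H \<inter> space M)"])
    fix s assume s: "real k * h \<le> s"
    define S where "S = {\<rho> \<in> space (PiM P (\<lambda>_. borel :: real measure)). \<forall>e\<in>P. s < \<rho> e}"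
    have S: "S \<in> sets (PiM P (\<lambda>_. borel))" unfolding S_def using fP by measurable
    have YS: "Y -` S \<inter> space M = {\<omega> \<in> space M. P \<subseteq> surv s \<omega>}"
      using P by (auto simp: Y_def S_def surviving_def not_le space_PiM)
    have "{\<omega> \<in> space M. drop_time \<eta> (\<lambda>j. cfrac (real j * h) \<omega>) k \<and> P \<subseteq> surv s \<omega>}
        = (\<lambda>\<omega>. (X \<omega>, Y \<omega>)) -` (H \<times> S) \<inter> space M"
    proof -
      \<comment> \<open>If \<open>P\<close> survives up to \<open>s\<close>, it is alive at all grid
        times up to \<open>k\<close>, where the recomputed past is then the true one.\<close>
      have "drop_time \<eta> (\<lambda>j. cfrac (real j * h) \<omega>) k \<longleftrightarrow> X \<omega> \<in> H" if "P \<subseteq> surv s \<omega>" for \<omega>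
      proof -
        have "surv (real j * h) \<omega> = {e \<in> E - P. \<not> X \<omega> e \<le> real j * h} \<union> P" if j: "j \<le> k" for j
        proof -
          have "real j * h \<le> real k * h" using j h by (intro mult_right_mono) auto
          then have "P \<subseteq> surv (real j * h) \<omega>"
            using \<open>P \<subseteq> surv s \<omega>\<close> surviving_antimono[of "real j * h" s E "\<lambda>e. \<tau> e \<omega>"] s by force
          then show ?thesis by (auto simp: X_def surviving_def)
        qed
        then have "drop_time \<eta> (\<lambda>j. cfrac (real j * h) \<omega>) k \<longleftrightarrow>
          drop_time \<eta> (\<lambda>j. connected_fraction (V, {e \<in> E - P. \<not> X \<omega> e \<le> real j * h} \<union> P)) k"
          by (intro drop_time_cong) simp
        then show ?thesis by (simp add: H_def X_def space_PiM)
      qed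
      then show ?thesis using YS by auto
    qed
    then have "prob {\<omega> \<in> space M. drop_time \<eta> (\<lambda>j. cfrac (real j * h) \<omega>) k \<and> P \<subseteq> surv s \<omega>}
        = prob (X -` H \<inter> space M) * prob (Y -` S \<inter> space M)"
      using indep_varD[OF iv H S] by simp
    moreover have "0 \<le> s" using s h mult_nonneg_nonneg[of "real k" h] by linarith
    ultimately show "prob {\<omega> \<in> space M. drop_time \<eta> (\<lambda>j. cfrac (real j * h) \<omega>) k \<and> P \<subseteq> surv s \<omega>}
        = prob (X -` H \<inter> space M) * exp (- r * s * card P)"
      unfolding YS using prob_all_survive[OF P] by simp
  qed simp
qed

text \<open>On the greedy event, the probability that \<open>P\<close> is still intact decays in
  time like exp (- r s |P|). Losing \<open>P\<close> during the next \<delta> therefore has the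
  fresh probability 1 - exp (- r \<delta> |P|) times the probability of being intact at the k-th
  grid time.\<close>

lemma prob_drop_time_then_cut:
  fixes k :: nat and \<eta> :: real
  assumes P: "P \<subseteq> E" and h: "0 \<le> h" and \<delta>: "0 \<le> \<delta>"
  defines "D \<equiv> \<lambda>\<omega>. drop_time \<eta> (\<lambda>j. cfrac (real j * h) \<omega>) k"
  shows "prob {\<omega> \<in> space M. D \<omega> \<and> P \<subseteq> surv (real k * h) \<omega>} -
      prob {\<omega> \<in> space M. D \<omega> \<and> P \<subseteq> surv (real k * h + \<delta>) \<omega>}
    \<le> prob {\<omega> \<in> space M. D \<omega>} * (1 - prob {\<omega> \<in> space M. P \<subseteq> surv \<delta> \<omega>})"
proof -
  obtain c where c: "\<And>s. real k * h \<le> s \<Longrightarrow>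
      prob {\<omega> \<in> space M. D \<omega> \<and> P \<subseteq> surv s \<omega>} = c * exp (- r * s * card P)"
    using prob_drop_time_and_survive[OF P h, of k \<eta>] unfolding D_def by blast
  have D: "{\<omega> \<in> space M. D \<omega>} \<in> sets M"
    unfolding D_def by (rule drop_time_measurable) (rule surv_measurable)
  let ?a = "exp (- r * \<delta> * card P)"
  have "c * exp (- r * (real k * h) * card P) - c * exp (- r * (real k * h + \<delta>) * card P) =
      c * exp (- r * (real k * h) * card P) * (1 - ?a)"
    by (simp add: algebra_simps exp_add[symmetric])
  also have "\<dots> \<le> prob {\<omega> \<in> space M. D \<omega>} * (1 - ?a)"
  proof (rule mult_right_mono)
    show "c * exp (- r * (real k * h) * card P) \<le> prob {\<omega> \<in> space M. D \<omega>}"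
      unfolding c[OF order_refl, symmetric] by (rule finite_measure_mono[OF _ D]) auto
    show "0 \<le> 1 - ?a" using r \<delta> by simp
  qed
  finally show ?thesis using c[of "real k * h"] c[of "real k * h + \<delta>"] prob_all_survive[OF P \<delta>] \<delta> by simp
qed

text \<open>The fraction is an average, over vertex pairs, of the indicators that their paths are
  intact, and the bound for a single path is summed over all pairs. After a greedy time a window
  loses in mean no more than a window starting at time 0.\<close>

lemma expectation_drop_after_drop_time:
  fixes k :: nat and \<eta> :: real
  assumes h: "0 \<le> h" and \<delta>: "0 \<le> \<delta>"
  defines "D \<equiv> \<lambda>\<omega>. drop_time \<eta> (\<lambda>j. cfrac (real j * h) \<omega>) k"
  shows "expectation (\<lambda>\<omega>. of_bool (D \<omega>) * (cfrac (real k * h) \<omega> - cfrac (real k * h + \<delta>) \<omega>))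
    \<le> prob {\<omega> \<in> space M. D \<omega>} * expectation (\<lambda>\<omega>. 1 - cfrac \<delta> \<omega>)"
proof -
  let ?n = "real (card V)"
  have n: "0 < ?n" using vertices_edges_finite by (simp add: card_gt_0_iff)
  obtain P where P: "\<And>p. p \<in> V \<times> V \<Longrightarrow> P p \<subseteq> E \<and> (\<forall>A\<subseteq>E. p \<in> connection (V, A) \<longleftrightarrow> P p \<subseteq> A)"
  proof -
    have "\<forall>p\<in>V \<times> V. \<exists>P\<subseteq>E. \<forall>A\<subseteq>E. p \<in> connection (V, A) \<longleftrightarrow> P \<subseteq> A"
      using tree_path_edges_ex[OF tree] by auto
    then show ?thesis using that by metis
  qed
  have cfrac: "cfrac t \<omega> = (\<Sum>p\<in>V \<times> V. of_bool (P p \<subseteq> surv t \<omega>)) / ?n\<^sup>2" for t \<omega>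
  proof -
    have "connection (V, surv t \<omega>) = {p \<in> V \<times> V. P p \<subseteq> surv t \<omega>}"
      using P surviving_subset[of E "\<lambda>e. \<tau> e \<omega>" t] by (auto simp: connection_def)
    then show ?thesis using vertices_edges_finite
      by (simp add: connected_fraction_def of_bool_def sum.If_cases Int_def)
  qed
  have D: "{\<omega> \<in> space M. D \<omega>} \<in> sets M"
    unfolding D_def by (rule drop_time_measurable) (rule surv_measurable)
  have A: "{\<omega> \<in> space M. Q \<subseteq> surv t \<omega>} \<in> sets M" for Q t
  proof -
    note [measurable] = surv_measurable[of "\<lambda>A. of_bool (Q \<subseteq> A)" t]
    have "{\<omega> \<in> space M. of_bool (Q \<subseteq> surv t \<omega>) = (1::real)} \<in> sets M" by measurable
    then show ?thesis by simp
  qed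
  have DA: "{\<omega> \<in> space M. D \<omega> \<and> Q \<subseteq> surv t \<omega>} \<in> sets M" for Q t
    using sets.Int[OF D A[of Q t]] by (simp add: Int_def conj_ac cong: conj_cong)
  note ob = of_bool_measurable integrable_of_bool expectation_of_bool
  have "expectation (\<lambda>\<omega>. of_bool (D \<omega>) * (cfrac (real k * h) \<omega> - cfrac (real k * h + \<delta>) \<omega>)) =
    expectation (\<lambda>\<omega>. (\<Sum>p\<in>V \<times> V. of_bool (D \<omega> \<and> P p \<subseteq> surv (real k * h) \<omega>) -
       of_bool (D \<omega> \<and> P p \<subseteq> surv (real k * h + \<delta>) \<omega>)) / ?n\<^sup>2)"
    unfolding cfrac by (intro Bochner_Integration.integral_cong)
      (auto simp: sum_subtractf diff_divide_distrib of_bool_conj sum_distrib_left[symmetric])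
  also have "\<dots> = (\<Sum>p\<in>V \<times> V. prob {\<omega> \<in> space M. D \<omega> \<and> P p \<subseteq> surv (real k * h) \<omega>} -
       prob {\<omega> \<in> space M. D \<omega> \<and> P p \<subseteq> surv (real k * h + \<delta>) \<omega>}) / ?n\<^sup>2"
    using DA ob by simp
  also have "\<dots> \<le> (\<Sum>p\<in>V \<times> V. prob {\<omega> \<in> space M. D \<omega>} *
      (1 - prob {\<omega> \<in> space M. P p \<subseteq> surv \<delta> \<omega>})) / ?n\<^sup>2"
    unfolding D_def using P prob_drop_time_then_cut[OF _ h \<delta>]
    by (intro divide_right_mono sum_mono) auto
  also have "\<dots> = prob {\<omega> \<in> space M. D \<omega>} *
      (1 - (\<Sum>p\<in>V \<times> V. prob {\<omega> \<in> space M. P p \<subseteq> surv \<delta> \<omega>}) / ?n\<^sup>2)"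
    using n by (simp add: sum_distrib_left[symmetric] sum_subtractf
        card_cartesian_product power2_eq_square) (simp add: field_simps)
  also have "(\<Sum>p\<in>V \<times> V. prob {\<omega> \<in> space M. P p \<subseteq> surv \<delta> \<omega>}) / ?n\<^sup>2 = expectation (cfrac \<delta>)"
    unfolding cfrac using A ob by simp
  also have "1 - expectation (cfrac \<delta>) = expectation (\<lambda>\<omega>. 1 - cfrac \<delta> \<omega>)"
    unfolding cfrac using A ob by (subst Bochner_Integration.integral_diff) (auto simp: prob_space)
  finally show ?thesis .
qed

text \<open>Markov's inequality for the sum of the drops after greedy times: the term for k has mean
  at most the probability that k is greedy times the mean loss from a fresh start, and there are at
  most 1 + 1 / \<eta> greedy times. The bound is free of \<open>L\<close>, which permits refining
  the grid.\<close>

lemma prob_clustered_drops_le: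
  assumes \<eta>: "0 < \<eta>" and m: "0 < m" and L: "0 < L"
  shows "prob {\<omega> \<in> space M. clustered_drops \<eta> m L (\<lambda>t. cfrac t \<omega>)}
    \<le> (1 + 1 / \<eta>) / \<eta> * expectation (\<lambda>\<omega>. 1 - cfrac (1 / real m) \<omega>)"
proof -
  define h where "h = 1 / real (m * L)"
  define N where "N = m * m * L"
  define D where "D = (\<lambda>k \<omega>. drop_time \<eta> (\<lambda>j. cfrac (real j * h) \<omega>) k)"
  define W where "W = (\<lambda>k \<omega>. of_bool (D k \<omega>) * (cfrac (real k * h) \<omega> - cfrac (real k * h + 1 / real m) \<omega>))"
  have h: "0 \<le> h" by (simp add: h_def)
  let ?a = "expectation (\<lambda>\<omega>. 1 - cfrac (1 / real m) \<omega>)"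
  have fr: "0 \<le> cfrac t \<omega>" "cfrac t \<omega> \<le> 1" for t \<omega>
    using vertices_edges_finite by (auto simp: connected_fraction_nonneg connected_fraction_le_1)
  have fr_mono: "cfrac t \<omega> \<le> cfrac s \<omega>" if "s \<le> t" for s t \<omega>
    using vertices_edges_finite that by (intro connected_fraction_mono surviving_antimono)
  have Dm: "{\<omega> \<in> space M. D k \<omega>} \<in> sets M" for k
    unfolding D_def by (rule drop_time_measurable) (rule surv_measurable)
  note ob = of_bool_measurable integrable_of_bool expectation_of_bool
  have W0: "0 \<le> W k \<omega>" "W k \<omega> \<le> 1" for k \<omega>
    using fr_mono[of "real k * h" "real k * h + 1 / real m" \<omega>] fr[of \<omega> "real k * h"]
      fr[of \<omega> "real k * h + 1 / real m"] by (auto simp: W_def)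
  have Wm: "W k \<in> borel_measurable M" for k
    unfolding W_def using Dm[of k] surv_measurable[of "\<lambda>A. connected_fraction (V, A)"]
    by (intro borel_measurable_times borel_measurable_diff of_bool_measurable)
  have Wi: "integrable M (W k)" for k
    using Wm W0 by (intro integrable_const_bound[where B=1]) auto
  let ?C = "{\<omega> \<in> space M. clustered_drops \<eta> m L (\<lambda>t. cfrac t \<omega>)}"
  \<comment> \<open>As \<eta> is positive, \<open>\<eta> \<le> W k \<omega>\<close> already forces
    \<open>k\<close> to be a greedy time.\<close>
  have C: "?C = {\<omega> \<in> space M. \<exists>k\<in>{..N}. \<eta> \<le> W k \<omega>}"
    using \<eta> unfolding clustered_drops_def D_def W_def N_def h_def by (auto split: if_splits)
  have Cm: "?C \<in> sets M" by (rule clustered_drops_measurable) (rule surv_measurable)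
  have cnt: "real (card {k \<in> {..N}. D k \<omega>}) \<le> 1 + 1 / \<eta>" for \<omega>
  proof -
    have dq: "decseq (\<lambda>j. cfrac (real j * h) \<omega>)"
      unfolding decseq_def using h by (auto intro!: fr_mono mult_right_mono)
    have "real (card {k \<in> {..N}. D k \<omega>}) * \<eta> \<le> \<eta> + 1"
      using card_drop_times[OF dq \<eta>, of N] drop_ref_ge[OF dq \<eta>, of N] fr[of \<omega> "real N * h"]
        fr[of \<omega> "real 0 * h"] unfolding D_def by linarith
    then show ?thesis using \<eta> by (simp add: field_simps)
  qed
  have eq: "(\<lambda>\<omega>. real (card {k \<in> {..N}. D k \<omega>})) = (\<lambda>\<omega>. \<Sum>k\<le>N. of_bool (D k \<omega>))"
    by (simp add: of_bool_def sum.If_cases Int_def)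
  have "prob ?C = expectation (\<lambda>\<omega>. of_bool (clustered_drops \<eta> m L (\<lambda>t. cfrac t \<omega>)))"
    using expectation_of_bool[OF Cm] by simp
  also have "\<dots> \<le> expectation (\<lambda>\<omega>. (\<Sum>k\<le>N. W k \<omega>) / \<eta>)"
  proof (rule integral_mono)
    fix \<omega> assume "\<omega> \<in> space M"
    show "of_bool (clustered_drops \<eta> m L (\<lambda>t. cfrac t \<omega>)) \<le> (\<Sum>k\<le>N. W k \<omega>) / \<eta>"
    proof (cases "clustered_drops \<eta> m L (\<lambda>t. cfrac t \<omega>)")
      case True
      then obtain k where k: "k \<in> {..N}" "\<eta> \<le> W k \<omega>" using C \<open>\<omega> \<in> space M\<close> by blast
      have "W k \<omega> \<le> (\<Sum>k\<le>N. W k \<omega>)" by (rule member_le_sum) (use k W0 in auto)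
      then show ?thesis using k True \<eta> by simp
    next
      case False
      then show ?thesis using W0 \<eta> by (simp add: sum_nonneg)
    qed
  qed (use integrable_of_bool[OF Cm] Wi in auto)
  also have "\<dots> = (\<Sum>k\<le>N. expectation (W k)) / \<eta>" using Wi by simp
  also have "\<dots> \<le> (\<Sum>k\<le>N. prob {\<omega> \<in> space M. D k \<omega>} * ?a) / \<eta>"
    using \<eta> expectation_drop_after_drop_time[OF h, of "1 / real m"] unfolding W_def D_def
    by (intro divide_right_mono sum_mono) auto
  also have "\<dots> = expectation (\<lambda>\<omega>. real (card {k \<in> {..N}. D k \<omega>})) * ?a / \<eta>"
  proof -
    have "expectation (\<lambda>\<omega>. real (card {k \<in> {..N}. D k \<omega>})) = (\<Sum>k\<le>N. expectation (\<lambda>\<omega>. of_bool (D k \<omega>)))"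
      unfolding eq by (rule Bochner_Integration.integral_sum) (rule integrable_of_bool[OF Dm])
    then show ?thesis using expectation_of_bool[OF Dm] by (simp add: sum_distrib_right)
  qed
  also have "\<dots> \<le> (1 + 1 / \<eta>) * ?a / \<eta>"
  proof -
    have "expectation (\<lambda>\<omega>. real (card {k \<in> {..N}. D k \<omega>})) \<le> expectation (\<lambda>\<omega>. 1 + 1 / \<eta>)"
    proof (rule integral_mono)
      show "integrable M (\<lambda>\<omega>. real (card {k \<in> {..N}. D k \<omega>}))"
        unfolding eq by (rule Bochner_Integration.integrable_sum) (rule integrable_of_bool[OF Dm])
    qed (use cnt in auto)
    moreover have "0 \<le> ?a" using fr(2) by (intro Bochner_Integration.integral_nonneg) auto
    ultimately show ?thesis using \<eta> by (intro divide_right_mono mult_right_mono) (auto simp: prob_space)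
  qed
  finally show ?thesis by (simp add: field_simps)
qed

end

end


section \<open>Random trees\<close>

lemma integral_uniform_measure:
  fixes f :: "'a \<Rightarrow> real"
  assumes "prob_space M" and A: "A \<in> sets M" "0 < measure M A" and f: "f \<in> borel_measurable M"
  shows "integral\<^sup>L (uniform_measure M A) f = (LINT \<omega>:A|M. f \<omega>) / measure M A"
proof -
  interpret prob_space M by fact
  have "uniform_measure M A = density M (\<lambda>\<omega>. ennreal (indicator A \<omega> / measure M A))"
    unfolding uniform_measure_def emeasure_eq_measure using A
    by (intro density_cong) (auto simp: divide_ennreal[symmetric] ennreal_indicator)
  then have "integral\<^sup>L (uniform_measure M A) f = (\<integral>\<omega>. (indicator A \<omega> / measure M A) *\<^sub>R f \<omega> \<partial>M)"
    using f A by (simp add: integral_density)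
  also have "\<dots> = (\<integral>\<omega>. (indicator A \<omega> * f \<omega>) / measure M A \<partial>M)" by simp
  also have "\<dots> = (LINT \<omega>:A|M. f \<omega>) / measure M A"
    by (simp add: set_lebesgue_integral_def)
  finally show ?thesis .
qed

lemma (in prob_space) expectation_bounded_tendsto:
  fixes s :: "nat \<Rightarrow> 'a \<Rightarrow> real"
  assumes s: "\<And>i. s i \<in> borel_measurable M" "\<And>i \<omega>. \<omega> \<in> space M \<Longrightarrow> \<bar>s i \<omega>\<bar> \<le> B"
    and lim: "\<And>\<omega>. \<omega> \<in> space M \<Longrightarrow> (\<lambda>i. s i \<omega>) \<longlonglongrightarrow> f \<omega>"
  shows "f \<in> borel_measurable M" "(\<lambda>i. expectation (s i)) \<longlonglongrightarrow> expectation f"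
proof -
  show f: "f \<in> borel_measurable M" by (rule borel_measurable_LIMSEQ_metric[OF s(1) lim])
  show "(\<lambda>i. expectation (s i)) \<longlonglongrightarrow> expectation f"
    using s lim by (intro integral_dominated_convergence[OF f, where w="\<lambda>_. B"]) auto
qed

text \<open>Total expectation over the countably many values of \<open>T\<close>; values of
  probability zero contribute nothing. In the form of nonnegativity it averages any inequality that
  is linear in the conditional law.\<close>

lemma (in prob_space) expectation_nonneg_countable_cases:
  fixes \<phi> :: "'g \<Rightarrow> 'a \<Rightarrow> real"
  assumes S: "countable S" and T: "T \<in> measurable M (count_space UNIV)" "\<And>\<omega>. \<omega> \<in> space M \<Longrightarrow> T \<omega> \<in> S"
    and \<phi>: "\<And>G. G \<in> S \<Longrightarrow> \<phi> G \<in> borel_measurable M" "\<And>G \<omega>. G \<in> S \<Longrightarrow> \<bar>\<phi> G \<omega>\<bar> \<le> B"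
    and nonneg: "\<And>G. G \<in> S \<Longrightarrow> 0 < prob {\<omega> \<in> space M. T \<omega> = G} \<Longrightarrow>
      0 \<le> integral\<^sup>L (uniform_measure M {\<omega> \<in> space M. T \<omega> = G}) (\<phi> G)"
  shows "(\<lambda>\<omega>. \<phi> (T \<omega>) \<omega>) \<in> borel_measurable M" "0 \<le> expectation (\<lambda>\<omega>. \<phi> (T \<omega>) \<omega>)"
proof -
  have TS: "T \<in> measurable M (count_space S)"
    using T S by (intro measurable_count_space_eq_countable[THEN iffD2]) (auto intro: measurable_sets)
  show m: "(\<lambda>\<omega>. \<phi> (T \<omega>) \<omega>) \<in> borel_measurable M"
    by (rule measurable_compose_countable'[OF _ TS S]) (rule \<phi>(1))
  have int: "integrable M (\<lambda>\<omega>. \<phi> (T \<omega>) \<omega>)"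
    using m \<phi>(2) T(2) by (intro integrable_const_bound[where B=B]) auto
  \<comment> \<open>Codes of the values of \<open>T\<close> index the partition; the sums over the
    codes below k converge by domination.\<close>
  define A where "A i = {\<omega> \<in> space M. to_nat_on S (T \<omega>) = i}" for i
  have TG: "{\<omega> \<in> space M. T \<omega> = G} \<in> sets M" for G
    using measurable_sets[OF T(1), of "{G}"] by (simp add: vimage_def Int_def conj_commute)
  have A_cases: "A i = {} \<or> (\<exists>G\<in>S. A i = {\<omega> \<in> space M. T \<omega> = G})" for i
  proof (cases "A i = {}")
    case False
    then obtain \<omega> where \<omega>: "\<omega> \<in> space M" "to_nat_on S (T \<omega>) = i" by (auto simp: A_def)
    then have "A i = {\<omega>' \<in> space M. T \<omega>' = T \<omega>}"
      using T(2) to_nat_on_inj[OF S] by (auto simp: A_def)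
    then show ?thesis using T(2) \<omega> by blast
  qed simp
  have Am: "A i \<in> sets M" for i using A_cases[of i] TG by auto
  have U: "(\<Union>i. A i) = space M" by (auto simp: A_def)
  define F where "F k \<omega> = (\<Sum>i<k. indicator (A i) \<omega> * \<phi> (T \<omega>) \<omega>)" for k \<omega>
  have ind: "indicator (A i) \<omega> = (of_bool (to_nat_on S (T \<omega>) = i) :: real)" if "\<omega> \<in> space M" for i \<omega>
    using that by (simp add: A_def)
  have F: "F k \<omega> = of_bool (to_nat_on S (T \<omega>) < k) * \<phi> (T \<omega>) \<omega>" if "\<omega> \<in> space M" for k \<omega>
    using that by (auto simp: F_def ind sum_distrib_right[symmetric] of_bool_def sum.delta')
  have "(\<lambda>k. expectation (F k)) \<longlonglongrightarrow> expectation (\<lambda>\<omega>. \<phi> (T \<omega>) \<omega>)"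
  proof (rule expectation_bounded_tendsto(2)[where B=B])
    show "F k \<in> borel_measurable M" for k unfolding F_def using m Am by measurable
    fix \<omega> assume \<omega>: "\<omega> \<in> space M"
    show "\<bar>F k \<omega>\<bar> \<le> B" for k
      using \<phi>(2)[OF T(2)[OF \<omega>], of \<omega>] F[OF \<omega>] by (auto simp: of_bool_def)
    have "\<forall>\<^sub>F k in sequentially. F k \<omega> = \<phi> (T \<omega>) \<omega>"
      using eventually_gt_at_top[of "to_nat_on S (T \<omega>)"] by eventually_elim (simp add: F[OF \<omega>])
    then show "(\<lambda>k. F k \<omega>) \<longlonglongrightarrow> \<phi> (T \<omega>) \<omega>" by (rule tendsto_eventually)
  qed
  moreover have "0 \<le> expectation (F k)" for k
  proof -
    have "expectation (F k) = (\<Sum>i<k. LINT \<omega>:A i|M. \<phi> (T \<omega>) \<omega>)"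
      unfolding F_def set_lebesgue_integral_def using int Am
      by (subst Bochner_Integration.integral_sum) (auto intro!: integrable_mult_indicator[where 'b=real, simplified])
    moreover have "0 \<le> (LINT \<omega>:A i|M. \<phi> (T \<omega>) \<omega>)" for i
    proof (cases "prob (A i) = 0")
      case True
      then have "AE \<omega> in M. \<omega> \<notin> A i" using Am by (simp add: prob_eq_0)
      then have "(LINT \<omega>:A i|M. \<phi> (T \<omega>) \<omega>) = (\<integral>\<omega>. 0 \<partial>M)"
        unfolding set_lebesgue_integral_def using m Am by (intro integral_cong_AE) auto
      then show ?thesis by simp
    next
      case False
      then obtain G where G: "G \<in> S" "A i = {\<omega> \<in> space M. T \<omega> = G}" using A_cases[of i] by auto
      have pos: "0 < prob (A i)" using False by (simp add: zero_less_measure_iff)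
      have "(LINT \<omega>:A i|M. \<phi> (T \<omega>) \<omega>) = (LINT \<omega>:A i|M. \<phi> G \<omega>)"
        unfolding set_lebesgue_integral_def G(2)
        by (intro Bochner_Integration.integral_cong) (auto simp: indicator_def)
      also have "\<dots> = prob (A i) * integral\<^sup>L (uniform_measure M (A i)) (\<phi> G)"
        using integral_uniform_measure[OF prob_space_axioms Am pos \<phi>(1)[OF G(1)]] pos by simp
      also have "0 \<le> \<dots>" using nonneg[OF G(1)] pos G(2) by simp
      finally show ?thesis .
    qed
    ultimately show ?thesis by (simp add: sum_nonneg)
  qed
  ultimately show "0 \<le> expectation (\<lambda>\<omega>. \<phi> (T \<omega>) \<omega>)" by (intro LIMSEQ_le_const) auto
qed

lemma component_profile_tree:
  assumes "is_tree G" shows "component_profile G 0 = 1"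
proof -
  note f = tree_finite[OF assms]
  have "connection G = fst G \<times> fst G" using assms by (auto simp: is_tree_def connection_def)
  then have "fst G \<in> components_of G"
    using f unfolding components_of_def by (auto simp: quotient_def Image_def)
  then have "fst G \<in> {C \<in> components_of G. card (fst G) \<le> card C}" by simp
  then have "0 < card {C \<in> components_of G. card (fst G) \<le> card C}"
    using finite_components[OF f(1)] by (intro card_gt_0_iff[THEN iffD2]) auto
  moreover have pos: "0 < card (fst G)" using f by (simp add: card_gt_0_iff)
  ultimately have "card (fst G) \<le> ranked_size G 0" using ranked_size_ge_iff[OF f(1)] by simp
  moreover have "ranked_size G 0 \<le> card (fst G)" using sum_ranked_size_le[OF f(1), of 1] by simp
  ultimately show ?thesis using pos by (simp add: component_profile_def)
qed

text \<open>Finite graphs on a countable vertex type are countable in number, which reduces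
  conditioning on the tree to a countable sum.\<close>

lemma countable_trees: "countable {G :: 'v::countable ugraph. is_tree G}"
proof (rule countable_subset)
  show "{G :: 'v ugraph. is_tree G} \<subseteq> Collect finite \<times> {E. finite E \<and> E \<subseteq> Collect finite}"
  proof clarify
    fix V :: "'v set" and E assume t: "is_tree (V, E)"
    have "E \<subseteq> Collect finite" using t by (auto simp: is_tree_def finite_simple_graph_def)
    then show "V \<in> Collect finite \<and> E \<in> {E. finite E \<and> E \<subseteq> Collect finite}"
      using tree_finite[OF t, simplified] by auto
  qed
  show "countable ((Collect finite :: 'v set set) \<times> {E. finite E \<and> E \<subseteq> (Collect finite :: 'v set set)})"
    by (intro countable_SIGMA countable_Collect_finite countable_Collect_finite_subset)
qed

section \<open>The random tree: averaging the bounds for fixed trees\<close>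

locale random_tree_fragmentation = prob_space M for M :: "'a measure" +
  fixes T :: "'a \<Rightarrow> 'v::countable ugraph" and r :: real and \<tau> :: "'v set \<Rightarrow> 'a \<Rightarrow> real"
  assumes T_measurable: "T \<in> measurable M (count_space UNIV)"
    and T_tree: "\<And>\<omega>. \<omega> \<in> space M \<Longrightarrow> is_tree (T \<omega>)"
    and r_pos: "0 < r"
    and clocks: "iid_exponential_clocks M T r \<tau>"
begin

lemma clock_measurable: "\<tau> e \<in> borel_measurable M"
  using clocks by (simp add: iid_exponential_clocks_def)

lemma conditional_clocks:
  assumes "0 < prob {\<omega> \<in> space M. T \<omega> = G}"
  defines "C \<equiv> uniform_measure M {\<omega> \<in> space M. T \<omega> = G}"
  shows "prob_space C" "prob_space.indep_vars C (\<lambda>_. borel) \<tau> (snd G)"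
    "\<And>e. e \<in> snd G \<Longrightarrow> distributed C lborel (\<tau> e) (exponential_density r)"
proof -
  show "prob_space C" unfolding C_def
    using assms(1) by (intro prob_space_uniform_measure) (auto simp: emeasure_eq_measure)
  have "prob_space.indep_vars C (\<lambda>_. borel) \<tau> (snd G) \<and>
      (\<forall>e\<in>snd G. distributed C lborel (\<tau> e) (exponential_density r))"
    using clocks assms(1) unfolding iid_exponential_clocks_def Let_def C_def by blast
  then show "prob_space.indep_vars C (\<lambda>_. borel) \<tau> (snd G)"
    "\<And>e. e \<in> snd G \<Longrightarrow> distributed C lborel (\<tau> e) (exponential_density r)" by auto
qed

abbreviation "frac_at t \<omega> \<equiv> connected_fraction (fst (T \<omega>), surviving (snd (T \<omega>)) (\<lambda>e. \<tau> e \<omega>) t)"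
abbreviation "profile_at t \<omega> \<equiv> component_profile (fst (T \<omega>), surviving (snd (T \<omega>)) (\<lambda>e. \<tau> e \<omega>) t)"

lemma surviving_measurable:
  fixes f :: "'v ugraph \<Rightarrow> 'v set set \<Rightarrow> real"
  shows "(\<lambda>\<omega>. f (T \<omega>) (surviving (snd (T \<omega>)) (\<lambda>e. \<tau> e \<omega>) t)) \<in> borel_measurable M"
proof (rule measurable_compose_countable'[OF _ _ countable_trees])
  show "(\<lambda>\<omega>. f G (surviving (snd G) (\<lambda>e. \<tau> e \<omega>) t)) \<in> borel_measurable M" if "G \<in> {G. is_tree G}" for G
    using that tree_finite(3)[of G] clock_measurable by (intro surviving_function_measurable) auto
  show "T \<in> measurable M (count_space {G. is_tree G})"
    using T_measurable T_tree countable_trees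
    by (intro measurable_count_space_eq_countable[THEN iffD2]) (auto intro: measurable_sets)
qed

text \<open>Both sides of the bound for a fixed tree are conditional expectations, so averaging over
  the tree amounts to nonnegativity of the mean of their difference \<open>\<phi>\<close>.\<close>

lemma prob_clustered_drops:
  assumes \<eta>: "0 < \<eta>" and m: "0 < m" and L: "0 < L"
  shows "{\<omega> \<in> space M. clustered_drops \<eta> m L (\<lambda>t. frac_at t \<omega>)} \<in> events"
    "prob {\<omega> \<in> space M. clustered_drops \<eta> m L (\<lambda>t. frac_at t \<omega>)}
      \<le> (1 + 1 / \<eta>) / \<eta> * expectation (\<lambda>\<omega>. 1 - frac_at (1 / real m) \<omega>)"
proof -
  define c where "c = (1 + 1 / \<eta>) / \<eta>"
  let ?q = "\<lambda>G \<omega> t. connected_fraction (fst G, surviving (snd G) (\<lambda>e. \<tau> e \<omega>) t)"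
  define \<phi> where "\<phi> G \<omega> = c * (1 - ?q G \<omega> (1 / real m)) - of_bool (clustered_drops \<eta> m L (?q G \<omega>))"
    for G \<omega>
  have c: "0 \<le> c" using \<eta> by (simp add: c_def)
  have qm: "(\<lambda>\<omega>. ?q G \<omega> t) \<in> borel_measurable M" if "is_tree G" for G t
    using tree_finite(3)[OF that] clock_measurable by (intro surviving_function_measurable) auto
  have q01: "0 \<le> ?q G \<omega> t" "?q G \<omega> t \<le> 1" if "is_tree G" for G \<omega> t
    using tree_finite[OF that] by (auto simp: connected_fraction_nonneg connected_fraction_le_1)
  have cm: "{\<omega> \<in> space M. clustered_drops \<eta> m L (?q G \<omega>)} \<in> events" if "is_tree G" for G
    using qm[OF that] by (intro clustered_drops_measurable)
  have "0 \<le> expectation (\<lambda>\<omega>. \<phi> (T \<omega>) \<omega>)"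
  proof (rule expectation_nonneg_countable_cases(2)[OF countable_trees T_measurable, where B="c + 1"])
    show "T \<omega> \<in> {G. is_tree G}" if "\<omega> \<in> space M" for \<omega> using that T_tree by simp
    fix G :: "'v ugraph" assume "G \<in> {G. is_tree G}"
    then have G: "is_tree G" by simp
    show \<phi>m: "\<phi> G \<in> borel_measurable M"
      unfolding \<phi>_def using qm[OF G] of_bool_measurable[OF cm[OF G]] by measurable
    show "\<bar>\<phi> G \<omega>\<bar> \<le> c + 1" for \<omega>
    proof -
      have "0 \<le> c * (1 - ?q G \<omega> (1 / real m))" "c * (1 - ?q G \<omega> (1 / real m)) \<le> c * 1"
        using c q01[OF G] by (auto intro!: mult_left_mono mult_nonneg_nonneg simp del: mult_1_right)
      then show ?thesis unfolding \<phi>_def using c by (auto simp: of_bool_def)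
    qed
    assume pos: "0 < prob {\<omega> \<in> space M. T \<omega> = G}"
    define C where "C = uniform_measure M {\<omega> \<in> space M. T \<omega> = G}"
    note C = conditional_clocks[OF pos, folded C_def]
    interpret C: prob_space C by (rule C(1))
    have sp: "space C = space M" "sets C = sets M" by (auto simp: C_def)
    have bm: "borel_measurable C = borel_measurable M" using sp by (intro measurable_cong_sets) auto
    have "C.prob {\<omega> \<in> space C. clustered_drops \<eta> m L (?q G \<omega>)} \<le> c * C.expectation (\<lambda>\<omega>. 1 - ?q G \<omega> (1 / real m))"
      using C.prob_clustered_drops_le[of "fst G" "snd G" r \<tau>] G r_pos C(2,3) \<eta> m L by (simp add: c_def)
    moreover have "C.expectation (\<phi> G) = c * C.expectation (\<lambda>\<omega>. 1 - ?q G \<omega> (1 / real m)) -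
        C.prob {\<omega> \<in> space C. clustered_drops \<eta> m L (?q G \<omega>)}"
    proof -
      have cC: "{\<omega> \<in> space C. clustered_drops \<eta> m L (?q G \<omega>)} \<in> C.events" using cm[OF G] by (simp add: sp)
      have "integrable C (\<lambda>\<omega>. 1 - ?q G \<omega> (1 / real m))"
        using qm[OF G] q01[OF G] by (intro C.integrable_const_bound[where B=1]) (auto simp: bm)
      then show ?thesis
        unfolding \<phi>_def using C.integrable_of_bool[OF cC] C.expectation_of_bool[OF cC] by simp
    qed
    ultimately show "0 \<le> C.expectation (\<phi> G)" by simp
  qed
  moreover have cl: "{\<omega> \<in> space M. clustered_drops \<eta> m L (\<lambda>t. frac_at t \<omega>)} \<in> events"
    by (rule clustered_drops_measurable) (rule surviving_measurable)
  moreover have "integrable M (\<lambda>\<omega>. 1 - frac_at (1 / real m) \<omega>)"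
    using q01[OF T_tree] surviving_measurable[of "\<lambda>G A. connected_fraction (fst G, A)"]
    by (intro integrable_const_bound[where B=1]) auto
  ultimately have "prob {\<omega> \<in> space M. clustered_drops \<eta> m L (\<lambda>t. frac_at t \<omega>)}
      \<le> c * expectation (\<lambda>\<omega>. 1 - frac_at (1 / real m) \<omega>)"
    unfolding \<phi>_def using integrable_of_bool[OF cl] expectation_of_bool[OF cl] by simp
  then show "prob {\<omega> \<in> space M. clustered_drops \<eta> m L (\<lambda>t. frac_at t \<omega>)}
      \<le> (1 + 1 / \<eta>) / \<eta> * expectation (\<lambda>\<omega>. 1 - frac_at (1 / real m) \<omega>)"
    unfolding c_def .
  show "{\<omega> \<in> space M. clustered_drops \<eta> m L (\<lambda>t. frac_at t \<omega>)} \<in> events" by (rule cl)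
qed

text \<open>Exponential clocks are almost surely positive, so at time 0 the tree is almost surely
  intact and forms one full component.\<close>

lemma expectation_initial_profile: "1 \<le> expectation (\<lambda>\<omega>. profile_at 0 \<omega> 0)"
proof -
  define \<phi> where "\<phi> G \<omega> = component_profile (fst G, surviving (snd G) (\<lambda>e. \<tau> e \<omega>) 0) 0 - 1" for G \<omega>
  have b: "0 \<le> component_profile (fst G, A) 0" "component_profile (fst G, A) 0 \<le> 1" if "is_tree G" for G :: "'v ugraph" and A
    using tree_finite[OF that] S_dec_le1_bounds[OF component_profile_in_S_dec_le1[of "(fst G, A)"]] by auto
  have "0 \<le> expectation (\<lambda>\<omega>. \<phi> (T \<omega>) \<omega>)"
  proof (rule expectation_nonneg_countable_cases(2)[OF countable_trees T_measurable, where B=1])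
    show "T \<omega> \<in> {G. is_tree G}" if "\<omega> \<in> space M" for \<omega> using that T_tree by simp
    fix G :: "'v ugraph" assume "G \<in> {G. is_tree G}"
    then have G: "is_tree G" by simp
    show \<phi>m: "\<phi> G \<in> borel_measurable M"
      unfolding \<phi>_def using tree_finite(3)[OF G] clock_measurable
      by (intro borel_measurable_diff surviving_function_measurable[of _ _ _ "\<lambda>A. component_profile (fst G, A) 0"]) auto
    show "\<bar>\<phi> G \<omega>\<bar> \<le> 1" for \<omega> using b[OF G] by (simp add: \<phi>_def abs_le_iff)
    assume pos: "0 < prob {\<omega> \<in> space M. T \<omega> = G}"
    define C where "C = uniform_measure M {\<omega> \<in> space M. T \<omega> = G}"
    note C = conditional_clocks[OF pos, folded C_def]
    interpret C: prob_space C by (rule C(1))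
    have "C.prob {\<omega> \<in> space C. snd G \<subseteq> surviving (snd G) (\<lambda>e. \<tau> e \<omega>) 0} = 1"
      using C.prob_all_survive[of "fst G" "snd G" r \<tau> "snd G" 0] G r_pos C(2,3) by simp
    then have "AE \<omega> in C. snd G \<subseteq> surviving (snd G) (\<lambda>e. \<tau> e \<omega>) 0"
      by (rule C.AE_prob_1[THEN AE_mp]) auto
    then have "AE \<omega> in C. \<phi> G \<omega> = 0"
    proof eventually_elim
      case (elim \<omega>)
      then have "surviving (snd G) (\<lambda>e. \<tau> e \<omega>) 0 = snd G" using surviving_subset by blast
      then show ?case using component_profile_tree[OF G] by (simp add: \<phi>_def)
    qed
    then have "C.expectation (\<phi> G) = 0" by (rule integral_eq_zero_AE)
    then show "0 \<le> C.expectation (\<phi> G)" by simp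
  qed
  moreover have "integrable M (\<lambda>\<omega>. profile_at 0 \<omega> 0)"
    using b[OF T_tree] surviving_measurable[of "\<lambda>G A. component_profile (fst G, A) 0"]
    by (intro integrable_const_bound[where B=1]) auto
  ultimately show ?thesis unfolding \<phi>_def by (simp add: prob_space)
qed

end


section \<open>Measurability of Skorohod-valued processes\<close>

lemma space_borel_of: "space (borel_of T) = topspace T"
  by (simp add: borel_of_def space_measure_of_conv)

lemma measurable_borel_ofI:
  assumes "\<And>\<omega>. \<omega> \<in> space M \<Longrightarrow> X \<omega> \<in> topspace T"
    "\<And>U. openin T U \<Longrightarrow> {\<omega> \<in> space M. X \<omega> \<in> U} \<in> sets M"
  shows "X \<in> measurable M (borel_of T)"
  unfolding borel_of_def
  using assms by (intro measurable_measure_of)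
    (auto dest: openin_subset simp: vimage_def Int_def conj_commute)

lemma continuous_map_borel_measurable:
  assumes "continuous_map T euclideanreal f"
  shows "f \<in> borel_measurable (borel_of T)"
proof (rule borel_measurableI)
  fix U :: "real set" assume "open U"
  then have "openin T {x \<in> topspace T. f x \<in> U}"
    using openin_continuous_map_preimage[OF assms] by (simp add: open_openin[symmetric])
  then have "{x \<in> topspace T. f x \<in> U} \<in> sets (borel_of T)"
    by (auto simp: borel_of_def sets_measure_of_conv dest: openin_subset intro: sigma_sets.Basic)
  then show "f -` U \<inter> space (borel_of T) \<in> sets (borel_of T)"
    by (simp add: space_borel_of vimage_def Int_def conj_commute)
qed

section \<open>Functionals of the sampled path as test functions\<close>

text \<open>A continuous retraction of \<^term>\<open>S_dec\<close> onto \<^term>\<open>S_dec_le1\<close>: the test functions available from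
  the finite-dimensional convergence have to be defined on all of \<^term>\<open>S_dec\<close>.\<close>

definition cut_mass :: "(nat \<Rightarrow> real) \<Rightarrow> nat \<Rightarrow> real" where
  "cut_mass a i = min 1 (\<Sum>j<Suc i. a j) - min 1 (\<Sum>j<i. a j)"

lemma cut_mass_in_S_dec_le1:
  assumes "a \<in> S_dec" shows "cut_mass a \<in> S_dec_le1"
proof (rule S_dec_le1I)
  have a: "0 \<le> a i" "a (Suc i) \<le> a i" for i using assms by (auto simp: S_dec_def decseq_Suc_iff)
  have "cut_mass a (Suc i) \<le> cut_mass a i" for i
    using a[of i] a(1)[of "Suc i"] by (auto simp: cut_mass_def min_def)
  moreover have "0 \<le> cut_mass a i" for i using a(1)[of i] by (auto simp: cut_mass_def min_def)
  ultimately show "cut_mass a \<in> S_dec" by (simp add: S_dec_def decseq_Suc_iff)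
  show "(\<Sum>j<n. cut_mass a j) \<le> 1" for n
    using sum_lessThan_telescope[of "\<lambda>m. min 1 (sum a {..<m})" n] by (simp only: cut_mass_def) simp
qed

lemma cut_mass_eq: "a \<in> S_dec_le1 \<Longrightarrow> cut_mass a = a"
  by (simp add: fun_eq_iff cut_mass_def min_absorb2 S_dec_le1_partial_sum del: sum.lessThan_Suc) simp

lemma continuous_cut_mass: "continuous_on S (\<lambda>a. cut_mass a i)"
proof -
  have c: "continuous_on S (\<lambda>a::nat \<Rightarrow> real. a j)" for j
    by (rule continuous_on_subset[OF continuous_on_product_coordinates]) simp
  show ?thesis unfolding cut_mass_def by (intro continuous_on_diff continuous_on_min continuous_on_const continuous_on_sum c)
qed

abbreviation fdd_space :: "nat \<Rightarrow> (nat \<Rightarrow> nat \<Rightarrow> real) topology" where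
  "fdd_space m \<equiv> product_topology (\<lambda>_. top_of_set S_dec) {..<m}"

lemma continuous_map_cut_mass_fdd:
  assumes "k < m" shows "continuous_map (fdd_space m) euclideanreal (\<lambda>a. cut_mass (a k) i)"
proof -
  have "continuous_map (fdd_space m) (top_of_set S_dec) (\<lambda>a. a k)"
    using assms by (intro continuous_map_product_projection) simp
  moreover have "continuous_map (top_of_set S_dec) euclideanreal (\<lambda>a. cut_mass a i)"
    by (simp add: continuous_cut_mass)
  ultimately show ?thesis using continuous_map_compose[of _ _ "\<lambda>a. a k" _ "\<lambda>a. cut_mass a i"]
    by (simp only: o_def)
qed

text \<open>Close samples give paths that are close under the identity time change, so a Lipschitz
  functional of the step path is continuous in the samples. \<open>cut_mass\<close> supplies the
  uniform tail bound on the whole finite-dimensional space.\<close>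

lemma continuous_map_step_path:
  assumes g: "sk_lipschitz g K" and m: "0 < m"
  shows "continuous_map (fdd_space (Suc (m * m))) euclideanreal (\<lambda>a. g (step_path m (\<lambda>k. cut_mass (a k))))"
    (is "continuous_map ?T _ ?\<phi>")
  unfolding Met_TC.continuous_map_to_metric[unfolded mtopology_is_euclidean]
proof (intro ballI allI impI)
  fix a and \<epsilon> :: real assume a: "a \<in> topspace ?T" and \<epsilon>: "0 < \<epsilon>"
  define e where "e = \<epsilon> / (\<bar>K\<bar> + 1)"
  have e: "0 < e" using \<epsilon> by (simp add: e_def)
  obtain I where I: "inverse (real (Suc I)) < e" using e reals_Archimedean by blast
  \<comment> \<open>Only coordinates below \<open>I\<close> are measured; after
    \<open>cut_mass\<close> all others are below \<open>e\<close>.\<close>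
  define \<psi> where "\<psi> b = (\<Sum>k<Suc (m * m). \<Sum>i<I. \<bar>cut_mass (b k) i - cut_mass (a k) i\<bar>)" for b
  have "continuous_map ?T euclideanreal \<psi>"
    unfolding \<psi>_def
    by (intro continuous_map_sum continuous_map_real_abs continuous_map_diff
      continuous_map_cut_mass_fdd) auto
  then have "openin ?T {b \<in> topspace ?T. \<psi> b \<in> {..<e}}"
    by (rule openin_continuous_map_preimage) (simp add: open_openin[symmetric])
  moreover have "a \<in> {b \<in> topspace ?T. \<psi> b \<in> {..<e}}" using a e by (simp add: \<psi>_def)
  moreover have "?\<phi> b \<in> Met_TC.mball (?\<phi> a) \<epsilon>" if b: "b \<in> {b \<in> topspace ?T. \<psi> b \<in> {..<e}}" for b
  proof -
    have S: "cut_mass (a k) \<in> S_dec_le1" "cut_mass (b k) \<in> S_dec_le1" if "k \<le> m * m" for k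
      using that a b by (auto simp: PiE_def Pi_def intro!: cut_mass_in_S_dec_le1)
    have "\<bar>cut_mass (a k) i - cut_mass (b k) i\<bar> \<le> e" if k: "k \<le> m * m" for k i
    proof (cases "i < I")
      case True
      have "\<bar>cut_mass (b k) i - cut_mass (a k) i\<bar> \<le> (\<Sum>i<I. \<bar>cut_mass (b k) i - cut_mass (a k) i\<bar>)"
        using True by (intro member_le_sum) auto
      also have "\<dots> \<le> \<psi> b"
        unfolding \<psi>_def using k
        by (intro member_le_sum[of k _ "\<lambda>k. \<Sum>i<I. \<bar>cut_mass (b k) i - cut_mass (a k) i\<bar>"])
          (auto intro: sum_nonneg)
      finally show ?thesis using b by (simp add: abs_minus_commute)
    next
      case False
      then have "inverse (1 + real i) \<le> inverse (real (Suc I))" by (intro le_imp_inverse_le) auto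
      then show ?thesis
        using S_dec_le1_bounds(1,2)[OF S(1)[OF k], of i] S_dec_le1_bounds(1,2)[OF S(2)[OF k], of i] I by linarith
    qed
    then have "sk_close e (step_path m (\<lambda>k. cut_mass (a k))) (step_path m (\<lambda>k. cut_mass (b k)))"
      using e by (intro sk_close_step_path) auto
    then have "\<bar>?\<phi> a - ?\<phi> b\<bar> \<le> K * e"
      using S m by (intro sk_lipschitzD[OF g]) (auto intro!: step_path_cadlag)
    also have "\<dots> < (\<bar>K\<bar> + 1) * e" using e by (intro mult_strict_right_mono) auto
    also have "\<dots> = \<epsilon>" by (simp add: e_def)
    finally show ?thesis by (simp add: dist_real_def)
  qed
  ultimately show "\<exists>U. openin ?T U \<and> a \<in> U \<and> (\<forall>b\<in>U. ?\<phi> b \<in> Met_TC.mball (?\<phi> a) \<epsilon>)" by blast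
qed

lemma step_path_bounded_image:
  fixes g :: "(real \<Rightarrow> nat \<Rightarrow> real) \<Rightarrow> real"
  assumes B: "\<And>x. x \<in> cadlag_space S_dec_le1 \<Longrightarrow> \<bar>g x\<bar> \<le> B" and m: "0 < m"
  shows "bounded ((\<lambda>a. g (step_path m (\<lambda>k. cut_mass (a k)))) ` topspace (fdd_space (Suc (m * m))))"
  unfolding bounded_iff
proof (intro exI[of _ B] ballI)
  fix v assume "v \<in> (\<lambda>a. g (step_path m (\<lambda>k. cut_mass (a k)))) ` topspace (fdd_space (Suc (m * m)))"
  then obtain a where "a \<in> topspace (fdd_space (Suc (m * m)))" "v = g (step_path m (\<lambda>k. cut_mass (a k)))" by blast
  moreover from this(1) have "step_path m (\<lambda>k. cut_mass (a k)) \<in> cadlag_space S_dec_le1"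
    using m by (intro step_path_cadlag) (auto intro!: cut_mass_in_S_dec_le1 simp: PiE_def Pi_def)
  ultimately show "norm v \<le> B" using B by simp
qed

text \<open>\<open>cut_mass\<close> is the identity on sequences of mass at most 1, so the test
  function reproduces the true discretization there.\<close>

lemma discretize_eq_step_path:
  assumes "\<And>t. 0 \<le> t \<Longrightarrow> x t \<in> S_dec_le1"
  shows "discretize m x = step_path m (\<lambda>k. cut_mass ((\<lambda>k\<in>{..<Suc (m * m)}. x (real k / real m)) k))"
  unfolding discretize_def step_path_def
  by (intro restrict_ext) (use assms grid_le in \<open>auto simp: cut_mass_eq less_Suc_eq_le\<close>)

lemma cadlag_space_value: "x \<in> cadlag_space S \<Longrightarrow> 0 \<le> t \<Longrightarrow> x t \<in> S"
  by (auto simp: cadlag_space_def PiE_def)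

section \<open>Borel measurability from finite-dimensional measurability\<close>

context
  fixes M :: "'a measure" and X :: "'a \<Rightarrow> real \<Rightarrow> nat \<Rightarrow> real"
  assumes X: "\<And>\<omega>. \<omega> \<in> space M \<Longrightarrow> X \<omega> \<in> cadlag_space S_dec_le1"
    and coord: "\<And>m t. (\<And>i. i < m \<Longrightarrow> 0 \<le> t i) \<Longrightarrow>
      (\<lambda>\<omega>. \<lambda>i\<in>{..<m}. X \<omega> (t i)) \<in> measurable M (borel_of (fdd_space m))"
begin

lemma lipschitz_discretize_measurable:
  assumes g: "sk_lipschitz g K" and m: "0 < m"
  shows "(\<lambda>\<omega>. g (discretize m (X \<omega>))) \<in> borel_measurable M"
proof -
  have "(\<lambda>\<omega>. g (step_path m (\<lambda>k. cut_mass ((\<lambda>k\<in>{..<Suc (m * m)}. X \<omega> (real k / real m)) k)))) \<in> borel_measurable M"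
    by (rule measurable_compose[OF coord continuous_map_borel_measurable[OF continuous_map_step_path[OF g m]]]) simp
  moreover have "g (discretize m (X \<omega>)) =
      g (step_path m (\<lambda>k. cut_mass ((\<lambda>k\<in>{..<Suc (m * m)}. X \<omega> (real k / real m)) k)))" if "\<omega> \<in> space M" for \<omega>
    using cadlag_space_value[OF X[OF that]] by (subst discretize_eq_step_path) auto
  ultimately show ?thesis by (simp cong: measurable_cong)
qed

text \<open>A pointwise limit of functions of finitely many sampled values.\<close>

lemma lipschitz_process_measurable:
  assumes g: "sk_lipschitz g K"
  shows "(\<lambda>\<omega>. g (X \<omega>)) \<in> borel_measurable M"
proof (rule borel_measurable_LIMSEQ_metric)
  show "(\<lambda>\<omega>. g (discretize (Suc m) (X \<omega>))) \<in> borel_measurable M" for m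
    by (rule lipschitz_discretize_measurable[OF g]) simp
  show "(\<lambda>m. g (discretize (Suc m) (X \<omega>))) \<longlonglongrightarrow> g (X \<omega>)" if "\<omega> \<in> space M" for \<omega>
    using sk_lipschitz_discretize_tendsto[OF g X[OF that]] by (rule LIMSEQ_Suc)
qed

text \<open>Every Skorohod open set is the positivity set of a Lipschitz functional, the envelope of
  its indicator.\<close>

lemma process_measurable: "X \<in> measurable M (borel_of (skorohod_J1 S_dec_le1))"
proof (rule measurable_borel_ofI)
  show "X \<omega> \<in> topspace (skorohod_J1 S_dec_le1)" if "\<omega> \<in> space M" for \<omega>
    using X[OF that] by (simp add: topspace_skorohod_J1)
  fix U assume U: "openin (skorohod_J1 S_dec_le1) U"
  have "sk_lipschitz (lip_env (indicator U) 1) 1"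
    by (rule sk_lipschitz_lip_env[where B=0]) auto
  note [measurable] = lipschitz_process_measurable[OF this]
  have "{\<omega> \<in> space M. 0 < lip_env (indicator U) 1 (X \<omega>)} \<in> sets M" by measurable
  moreover have "{\<omega> \<in> space M. 0 < lip_env (indicator U) 1 (X \<omega>)} = {\<omega> \<in> space M. X \<omega> \<in> U}"
    using lip_env_indicator_pos_iff[OF U X] by auto
  ultimately show "{\<omega> \<in> space M. X \<omega> \<in> U} \<in> sets M" by simp
qed

lemma coordinate_measurable:
  assumes t: "0 \<le> t" shows "(\<lambda>\<omega>. X \<omega> t i) \<in> borel_measurable M"
proof -
  have c: "continuous_map (fdd_space 1) euclideanreal (\<lambda>a. cut_mass (a 0) i)"
    by (rule continuous_map_cut_mass_fdd) simp
  have "(\<lambda>\<omega>. cut_mass ((\<lambda>i\<in>{..<1::nat}. X \<omega> t) 0) i) \<in> borel_measurable M"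
    by (rule measurable_compose[OF coord[of 1 "\<lambda>_. t"] continuous_map_borel_measurable[OF c]]) (rule t)
  moreover have "cut_mass ((\<lambda>i\<in>{..<1::nat}. X \<omega> t) 0) i = X \<omega> t i" if "\<omega> \<in> space M" for \<omega>
    using cadlag_space_value[OF X[OF that] t] by (simp add: cut_mass_eq)
  ultimately show ?thesis by (simp cong: measurable_cong)
qed

end


section \<open>Discretization error of the fragmentation process\<close>

text \<open>Off the clustered event the samplings at mesh 1 / (m L) and 1 / m are gauge-close, and
  on it the functional changes by at most 2 B. The estimate does not involve L, so letting L tend to
  infinity replaces the fine sampling by \<open>X\<close> itself. The 4 is this 2 times the 2 from
  \<open>connected_fraction_ge\<close>.\<close>

lemma (in random_tree_fragmentation) discretization_error:
  assumes card: "\<And>\<omega>. \<omega> \<in> space M \<Longrightarrow> card (fst (T \<omega>)) = n"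
    and g: "sk_lipschitz g K" and B: "\<And>x. x \<in> cadlag_space S_dec_le1 \<Longrightarrow> \<bar>g x\<bar> \<le> B"
    and \<eta>: "0 < \<eta>" and m: "0 < m"
  defines "X \<equiv> \<lambda>\<omega>. fragmentation n (T \<omega>) (\<lambda>e. \<tau> e \<omega>)"
  assumes coord: "\<And>m t. (\<And>i. i < m \<Longrightarrow> 0 \<le> t i) \<Longrightarrow>
      (\<lambda>\<omega>. \<lambda>i\<in>{..<m}. X \<omega> (t i)) \<in> measurable M (borel_of (fdd_space m))"
  shows "\<bar>expectation (\<lambda>\<omega>. g (X \<omega>)) - expectation (\<lambda>\<omega>. g (discretize m (X \<omega>)))\<bar>
    \<le> K * (sqrt \<eta> + 2 / real m) + 4 * B * ((1 + 1 / \<eta>) / \<eta>) * expectation (\<lambda>\<omega>. 1 - X \<omega> (1 / real m) 0)"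
proof -
  define c where "c = (1 + 1 / \<eta>) / \<eta>"
  have c: "0 \<le> c" using \<eta> by (simp add: c_def)
  have XD: "X \<omega> \<in> cadlag_space S_dec_le1" if "\<omega> \<in> space M" for \<omega>
    unfolding X_def using tree_finite[OF T_tree[OF that]] card[OF that] by (intro fragmentation_cadlag)
  have XdD: "discretize m' (X \<omega>) \<in> cadlag_space S_dec_le1" if "\<omega> \<in> space M" "0 < m'" for \<omega> m'
    using cadlag_space_value[OF XD[OF that(1)]] that(2) by (intro discretize_cadlag)
  have X_eq: "X \<omega> t = profile_at t \<omega>" if "\<omega> \<in> space M" "0 \<le> t" for \<omega> t
    unfolding X_def using fragmentation_eq that card by blast
  have B0: "0 \<le> B"
  proof -
    obtain \<omega> where "\<omega> \<in> space M" using not_empty by blast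
    then show ?thesis using B[OF XD] by (meson abs_ge_zero order_trans)
  qed
  have gm: "(\<lambda>\<omega>. g (discretize m' (X \<omega>))) \<in> borel_measurable M" if "0 < m'" for m'
    by (rule lipschitz_discretize_measurable[OF XD coord g that])
  have gi: "integrable M (\<lambda>\<omega>. g (discretize m' (X \<omega>)))" if "0 < m'" for m'
    using gm[OF that] B XdD[OF _ that] by (intro integrable_const_bound[where B=B]) auto
  let ?q = "\<lambda>\<omega> t. frac_at t \<omega>"
  let ?Y = "\<lambda>\<omega>. 1 - X \<omega> (1 / real m) 0"
  have "expectation (\<lambda>\<omega>. 1 - frac_at (1 / real m) \<omega>) \<le> expectation (\<lambda>\<omega>. 2 * ?Y \<omega>)"
  proof (rule integral_mono)
    show "integrable M (\<lambda>\<omega>. 1 - frac_at (1 / real m) \<omega>)"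
      using tree_finite[OF T_tree] surviving_measurable[of "\<lambda>G A. connected_fraction (fst G, A)"]
      by (intro integrable_const_bound[where B=1]) (auto simp: connected_fraction_nonneg connected_fraction_le_1)
    have "(\<lambda>\<omega>. X \<omega> (1 / real m) 0) \<in> borel_measurable M"
      by (rule coordinate_measurable[OF XD coord]) auto
    then have "integrable M (\<lambda>\<omega>. X \<omega> (1 / real m) 0)"
      using S_dec_le1_bounds[OF cadlag_space_value[OF XD]] by (intro integrable_const_bound[where B=1]) auto
    then show "integrable M (\<lambda>\<omega>. 2 * ?Y \<omega>)" by simp
    show "1 - frac_at (1 / real m) \<omega> \<le> 2 * ?Y \<omega>" if "\<omega> \<in> space M" for \<omega>
      using tree_finite[OF T_tree[OF that]] X_eq[OF that]
        connected_fraction_ge[of "(fst (T \<omega>), surviving (snd (T \<omega>)) (\<lambda>e. \<tau> e \<omega>) (1 / real m))"] by simp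
  qed
  then have frac_le: "expectation (\<lambda>\<omega>. 1 - frac_at (1 / real m) \<omega>) \<le> 2 * expectation ?Y"
    unfolding integral_mult_right_zero .
  have bound: "\<bar>expectation (\<lambda>\<omega>. g (discretize (m * L) (X \<omega>))) - expectation (\<lambda>\<omega>. g (discretize m (X \<omega>)))\<bar>
      \<le> K * (sqrt \<eta> + 2 / real m) + 4 * B * c * expectation ?Y" if L: "0 < L" for L
  proof -
    let ?C = "{\<omega> \<in> space M. clustered_drops \<eta> m L (?q \<omega>)}"
    have Cm: "?C \<in> events" by (rule prob_clustered_drops(1)[OF \<eta> m L])
    have mL: "0 < m * L" using m L by simp
    let ?D = "\<lambda>\<omega>. g (discretize (m * L) (X \<omega>)) - g (discretize m (X \<omega>))"
    have "\<bar>expectation (\<lambda>\<omega>. g (discretize (m * L) (X \<omega>))) - expectation (\<lambda>\<omega>. g (discretize m (X \<omega>)))\<bar>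
        = \<bar>expectation ?D\<bar>" using gi mL m by simp
    also have "\<dots> \<le> expectation (\<lambda>\<omega>. \<bar>?D \<omega>\<bar>)" by (rule integral_abs_bound)
    also have "\<dots> \<le> expectation (\<lambda>\<omega>. K * (sqrt \<eta> + 2 / real m) + 2 * B * of_bool (clustered_drops \<eta> m L (?q \<omega>)))"
    proof (rule integral_mono)
      show "integrable M (\<lambda>\<omega>. \<bar>?D \<omega>\<bar>)" using gi mL m by auto
      show "integrable M (\<lambda>\<omega>. K * (sqrt \<eta> + 2 / real m) + 2 * B * of_bool (clustered_drops \<eta> m L (?q \<omega>)))"
        using integrable_of_bool[OF Cm] by simp
      fix \<omega> assume \<omega>: "\<omega> \<in> space M"
      note D = XdD[OF \<omega> mL] XdD[OF \<omega> m]
      show "\<bar>?D \<omega>\<bar> \<le> K * (sqrt \<eta> + 2 / real m) + 2 * B * of_bool (clustered_drops \<eta> m L (?q \<omega>))"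
      proof (cases "clustered_drops \<eta> m L (?q \<omega>)")
        case True
        \<comment> \<open>Comparing a path with itself in the Lipschitz condition yields the sign of
          this product.\<close>
        have "0 \<le> K * (sqrt \<eta> + 2 / real m)"
          using sk_lipschitzD[OF g D(1,1) sk_close_mono[OF sk_close_refl, of "sqrt \<eta> + 2 / real m"]] \<eta> by simp
        then show ?thesis using True B[OF D(1)] B[OF D(2)] by simp
      next
        case False
        have "sk_close (sqrt \<eta> + 2 / real m) (discretize (m * L) (X \<omega>)) (discretize m (X \<omega>))"
          unfolding X_def using tree_finite[OF T_tree[OF \<omega>]] card[OF \<omega>] \<eta> m L False
          by (intro sk_close_discretize_fragmentation) auto
        then show ?thesis using sk_lipschitzD[OF g D] False by simp
      qed
    qed
    also have "\<dots> = K * (sqrt \<eta> + 2 / real m) + 2 * B * prob ?C"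
      using integrable_of_bool[OF Cm] expectation_of_bool[OF Cm] by (simp add: prob_space)
    also have "\<dots> \<le> K * (sqrt \<eta> + 2 / real m) + 2 * B * (c * (2 * expectation ?Y))"
    proof (intro add_left_mono mult_left_mono)
      show "prob ?C \<le> c * (2 * expectation ?Y)"
        using prob_clustered_drops(2)[OF \<eta> m L] mult_left_mono[OF frac_le c] unfolding c_def by linarith
    qed (use B0 in simp)
    finally show ?thesis by (simp add: algebra_simps)
  qed
  have "(\<lambda>L. expectation (\<lambda>\<omega>. g (discretize (m * Suc L) (X \<omega>)))) \<longlonglongrightarrow> expectation (\<lambda>\<omega>. g (X \<omega>))"
  proof (rule expectation_bounded_tendsto(2)[where B=B])
    show "(\<lambda>\<omega>. g (discretize (m * Suc L) (X \<omega>))) \<in> borel_measurable M" for L using m by (intro gm) simp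
    fix \<omega> assume \<omega>: "\<omega> \<in> space M"
    show "\<bar>g (discretize (m * Suc L) (X \<omega>))\<bar> \<le> B" for L using m by (intro B XdD \<omega>) simp
    have "Suc L \<le> m * Suc L" for L using mult_le_mono1[of 1 m "Suc L"] m by (simp del: mult_Suc_right)
    then have "filterlim (\<lambda>L. m * Suc L) at_top sequentially"
      by (intro filterlim_at_top_mono[OF filterlim_Suc] always_eventually allI)
    then show "(\<lambda>L. g (discretize (m * Suc L) (X \<omega>))) \<longlonglongrightarrow> g (X \<omega>)"
      by (rule filterlim_compose[OF sk_lipschitz_discretize_tendsto[OF g XD[OF \<omega>]]])
  qed
  then have "(\<lambda>L. \<bar>expectation (\<lambda>\<omega>. g (discretize (m * Suc L) (X \<omega>))) - expectation (\<lambda>\<omega>. g (discretize m (X \<omega>)))\<bar>)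
      \<longlonglongrightarrow> \<bar>expectation (\<lambda>\<omega>. g (X \<omega>)) - expectation (\<lambda>\<omega>. g (discretize m (X \<omega>)))\<bar>"
    by (intro tendsto_rabs tendsto_diff tendsto_const)
  then show ?thesis
    unfolding c_def[symmetric] by (rule LIMSEQ_le_const2) (intro exI allI impI bound zero_less_Suc)
qed


section \<open>Convergence in the Skorohod space\<close>

lemma converges_in_distribution_AE_cong:
  assumes c: "converges_in_distribution S M X N Y" and Z: "Z \<in> measurable N (borel_of S)"
    and ae: "AE \<omega> in N. Z \<omega> = Y \<omega>"
  shows "converges_in_distribution S M X N Z"
  unfolding converges_in_distribution_def
proof (intro conjI allI impI)
  note c = c[unfolded converges_in_distribution_def]
  show "X n \<in> measurable (M n) (borel_of S)" if "1 \<le> n" for n using c that by blast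
  show "Z \<in> measurable N (borel_of S)" by (rule Z)
  fix f :: "'a \<Rightarrow> real" assume f: "continuous_map S euclideanreal f \<and> bounded (f ` topspace S)"
  have "(\<integral>\<omega>. f (Z \<omega>) \<partial>N) = (\<integral>\<omega>. f (Y \<omega>) \<partial>N)"
  proof (rule integral_cong_AE)
    have fm: "f \<in> borel_measurable (borel_of S)" using f continuous_map_borel_measurable by blast
    show "(\<lambda>\<omega>. f (Z \<omega>)) \<in> borel_measurable N" by (rule measurable_compose[OF Z fm])
    show "(\<lambda>\<omega>. f (Y \<omega>)) \<in> borel_measurable N" by (rule measurable_compose[OF _ fm]) (use c in blast)
    show "AE \<omega> in N. f (Z \<omega>) = f (Y \<omega>)" using ae by eventually_elim simp
  qed
  then show "(\<lambda>n. \<integral>\<omega>. f (X n \<omega>) \<partial>M n) \<longlonglongrightarrow> (\<integral>\<omega>. f (Z \<omega>) \<partial>N)" using c f by simp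
qed

text \<open>\<open>Z\<close> is a version of the limit all of whose paths have mass at most 1; it is
  constructed from \<open>Y\<close> in the final proof.\<close>

locale fragmentation_limit =
  fixes M :: "nat \<Rightarrow> 'a measure" and T :: "nat \<Rightarrow> 'a \<Rightarrow> 'v::countable ugraph" and r :: "nat \<Rightarrow> real"
    and \<tau> :: "nat \<Rightarrow> 'v set \<Rightarrow> 'a \<Rightarrow> real" and N :: "'b measure" and Z :: "'b \<Rightarrow> real \<Rightarrow> nat \<Rightarrow> real"
    and X :: "nat \<Rightarrow> 'a \<Rightarrow> real \<Rightarrow> nat \<Rightarrow> real"
  assumes trees: "\<And>n. 1 \<le> n \<Longrightarrow> random_tree_fragmentation (M n) (T n) (r n) (\<tau> n)"
    and card: "\<And>n \<omega>. 1 \<le> n \<Longrightarrow> \<omega> \<in> space (M n) \<Longrightarrow> card (fst (T n \<omega>)) = n"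
    and X_def: "\<And>n \<omega>. X n \<omega> = fragmentation n (T n \<omega>) (\<lambda>e. \<tau> n e \<omega>)"
    and N: "prob_space N"
    and Z: "\<And>\<omega>. \<omega> \<in> space N \<Longrightarrow> Z \<omega> \<in> cadlag_space S_dec_le1"
    and fdd: "fdd_converges (top_of_set S_dec) M X N Z"
begin

sublocale N: prob_space N by (rule N)

lemma X_cadlag: "1 \<le> n \<Longrightarrow> \<omega> \<in> space (M n) \<Longrightarrow> X n \<omega> \<in> cadlag_space S_dec_le1"
  unfolding X_def using random_tree_fragmentation.T_tree[OF trees] card
  by (intro fragmentation_cadlag tree_finite)

lemma X_coord:
  assumes "1 \<le> n" "\<And>i. i < m \<Longrightarrow> 0 \<le> t i"
  shows "(\<lambda>\<omega>. \<lambda>i\<in>{..<m}. X n \<omega> (t i)) \<in> measurable (M n) (borel_of (fdd_space m))"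
  using fdd assms by (simp add: fdd_converges_def converges_in_distribution_def)

lemma Z_coord:
  assumes "\<And>i. i < m \<Longrightarrow> 0 \<le> t i"
  shows "(\<lambda>\<omega>. \<lambda>i\<in>{..<m}. Z \<omega> (t i)) \<in> measurable N (borel_of (fdd_space m))"
  using fdd assms by (simp add: fdd_converges_def converges_in_distribution_def)

lemma fdd_tendsto:
  assumes "\<And>i. i < m \<Longrightarrow> 0 \<le> t i" "continuous_map (fdd_space m) euclideanreal f" "bounded (f ` topspace (fdd_space m))"
  shows "(\<lambda>n. \<integral>\<omega>. f (\<lambda>i\<in>{..<m}. X n \<omega> (t i)) \<partial>M n) \<longlonglongrightarrow> (\<integral>\<omega>. f (\<lambda>i\<in>{..<m}. Z \<omega> (t i)) \<partial>N)"
  using fdd assms unfolding fdd_converges_def converges_in_distribution_def by blast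

text \<open>The functional of the discretized path is a bounded continuous function of the values at
  the times k / m, so finite-dimensional convergence applies directly.\<close>

lemma discretize_tendsto:
  assumes g: "sk_lipschitz g K" and B: "\<And>x. x \<in> cadlag_space S_dec_le1 \<Longrightarrow> \<bar>g x\<bar> \<le> B" and m: "0 < m"
  shows "(\<lambda>n. \<integral>\<omega>. g (discretize m (X n \<omega>)) \<partial>M n) \<longlonglongrightarrow> (\<integral>\<omega>. g (discretize m (Z \<omega>)) \<partial>N)"
proof -
  let ?r = "\<lambda>x. \<lambda>k\<in>{..<Suc (m * m)}. x (real k / real m)"
  let ?f = "\<lambda>a. g (step_path m (\<lambda>k. cut_mass (a k)))"
  have eq: "?f (?r x) = g (discretize m x)" if "x \<in> cadlag_space S_dec_le1" for x
    using discretize_eq_step_path[of x m] cadlag_space_value[OF that] by simp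
  have 1: "(\<lambda>n. \<integral>\<omega>. ?f (?r (X n \<omega>)) \<partial>M n) \<longlonglongrightarrow> (\<integral>\<omega>. ?f (?r (Z \<omega>)) \<partial>N)"
    by (rule fdd_tendsto[OF _ continuous_map_step_path[OF g m] step_path_bounded_image[OF B m]]) auto
  have 2: "(\<integral>\<omega>. ?f (?r (Z \<omega>)) \<partial>N) = (\<integral>\<omega>. g (discretize m (Z \<omega>)) \<partial>N)"
    by (intro Bochner_Integration.integral_cong refl eq Z)
  have 3: "\<forall>\<^sub>F n in sequentially.
      (\<integral>\<omega>. ?f (?r (X n \<omega>)) \<partial>M n) = (\<integral>\<omega>. g (discretize m (X n \<omega>)) \<partial>M n)"
    using eventually_ge_at_top[of 1]
    by eventually_elim (intro Bochner_Integration.integral_cong refl eq X_cadlag)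
  show ?thesis by (rule Lim_transform_eventually[OF 1[unfolded 2] 3])
qed

text \<open>On sequences of mass at most 1 the first entry agrees with that of
  \<open>cut_mass\<close>, which is bounded and continuous.\<close>

lemma largest_component_tendsto:
  assumes t: "0 \<le> t"
  shows "(\<lambda>n. \<integral>\<omega>. 1 - X n \<omega> t 0 \<partial>M n) \<longlonglongrightarrow> (\<integral>\<omega>. 1 - Z \<omega> t 0 \<partial>N)"
proof -
  let ?f = "\<lambda>a. 1 - cut_mass (a (0::nat)) 0"
  have eq: "?f (\<lambda>k\<in>{..<1}. x t) = 1 - x t 0" if "x \<in> cadlag_space S_dec_le1" for x
    using cadlag_space_value[OF that t] by (simp add: cut_mass_eq)
  have 1: "(\<lambda>n. \<integral>\<omega>. ?f (\<lambda>k\<in>{..<1}. X n \<omega> t) \<partial>M n) \<longlonglongrightarrow> (\<integral>\<omega>. ?f (\<lambda>k\<in>{..<1}. Z \<omega> t) \<partial>N)"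
  proof (rule fdd_tendsto[where f="?f" and m=1])
    show "continuous_map (fdd_space 1) euclideanreal ?f"
      by (intro continuous_map_diff continuous_map_cut_mass_fdd) auto
    show "bounded (?f ` topspace (fdd_space 1))"
      unfolding bounded_iff
    proof (intro exI[of _ 1] ballI)
      fix v assume "v \<in> ?f ` topspace (fdd_space 1)"
      then obtain a where "a \<in> topspace (fdd_space 1)" "v = ?f a" by blast
      then show "norm v \<le> 1" using S_dec_le1_bounds(1,3)[OF cut_mass_in_S_dec_le1, of "a 0" 0]
        by (auto simp: PiE_def Pi_def)
    qed
  qed (rule t)
  have 2: "(\<integral>\<omega>. ?f (\<lambda>k\<in>{..<1}. Z \<omega> t) \<partial>N) = (\<integral>\<omega>. 1 - Z \<omega> t 0 \<partial>N)"
    by (intro Bochner_Integration.integral_cong refl eq Z)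
  have 3: "\<forall>\<^sub>F n in sequentially.
      (\<integral>\<omega>. ?f (\<lambda>k\<in>{..<1}. X n \<omega> t) \<partial>M n) = (\<integral>\<omega>. 1 - X n \<omega> t 0 \<partial>M n)"
    using eventually_ge_at_top[of 1]
    by eventually_elim (intro Bochner_Integration.integral_cong refl eq X_cadlag)
  show ?thesis by (rule Lim_transform_eventually[OF 1[unfolded 2] 3])
qed

text \<open>The limit starts from a single component because all the prelimits do, so by right-continuity
  it stays close to that for a short time.\<close>

lemma limit_initial_mass: "(\<lambda>m. \<integral>\<omega>. 1 - Z \<omega> (1 / real (Suc m)) 0 \<partial>N) \<longlonglongrightarrow> 0"
proof -
  have b: "0 \<le> Z \<omega> t 0" "Z \<omega> t 0 \<le> 1" if "\<omega> \<in> space N" "0 \<le> t" for \<omega> t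
    using S_dec_le1_bounds(1,3)[OF cadlag_space_value[OF Z]] that by auto
  have Zm: "(\<lambda>\<omega>. Z \<omega> t 0) \<in> borel_measurable N" if "0 \<le> t" for t
    by (rule coordinate_measurable[OF Z Z_coord that])
  have "(\<integral>\<omega>. 1 - X n \<omega> 0 0 \<partial>M n) \<le> 0" if n: "1 \<le> n" for n
  proof -
    interpret random_tree_fragmentation "M n" "T n" "r n" "\<tau> n" by (rule trees[OF n])
    have Xb: "\<bar>X n \<omega> 0 0\<bar> \<le> 1" if "\<omega> \<in> space (M n)" for \<omega>
      using S_dec_le1_bounds(1,3)[OF cadlag_space_value[OF X_cadlag[OF n that]], of 0 0] by simp
    have "(\<lambda>\<omega>. X n \<omega> 0 0) \<in> borel_measurable (M n)"
      by (rule coordinate_measurable[OF X_cadlag[OF n] X_coord[OF n]]) auto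
    then have int: "integrable (M n) (\<lambda>\<omega>. X n \<omega> 0 0)"
      using Xb by (intro integrable_const_bound[where B=1]) auto
    have "expectation (\<lambda>\<omega>. X n \<omega> 0 0) = expectation (\<lambda>\<omega>. profile_at 0 \<omega> 0)"
      by (intro Bochner_Integration.integral_cong refl) (simp add: X_def fragmentation_eq card[OF n])
    then show ?thesis using expectation_initial_profile int by (simp add: prob_space)
  qed
  then have "(\<integral>\<omega>. 1 - Z \<omega> 0 0 \<partial>N) \<le> 0"
    by (intro LIMSEQ_le_const2[OF largest_component_tendsto]) auto
  moreover have "0 \<le> (\<integral>\<omega>. 1 - Z \<omega> 0 0 \<partial>N)"
    using b by (intro Bochner_Integration.integral_nonneg) auto
  moreover have "(\<lambda>m. \<integral>\<omega>. 1 - Z \<omega> (1 / real (Suc m)) 0 \<partial>N) \<longlonglongrightarrow> (\<integral>\<omega>. 1 - Z \<omega> 0 0 \<partial>N)"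
  proof (rule N.expectation_bounded_tendsto(2)[where B=1])
    show "(\<lambda>\<omega>. 1 - Z \<omega> (1 / real (Suc m)) 0) \<in> borel_measurable N" for m
      by (intro borel_measurable_diff Zm) auto
    fix \<omega> assume \<omega>: "\<omega> \<in> space N"
    show "\<bar>1 - Z \<omega> (1 / real (Suc m)) 0\<bar> \<le> 1" for m
      using b[OF \<omega>, of "1 / real (Suc m)"] by simp
    have "(Z \<omega> \<longlongrightarrow> Z \<omega> 0) (at_right 0)" using Z[OF \<omega>] by (simp add: cadlag_space_def)
    then have "((\<lambda>t. Z \<omega> t 0) \<longlongrightarrow> Z \<omega> 0 0) (at_right 0)" by (rule tendsto_fun_component)
    moreover have "filterlim (\<lambda>m. 1 / real (Suc m)) (at_right 0) sequentially"
      unfolding filterlim_at using LIMSEQ_Suc[OF lim_1_over_n] by auto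
    ultimately have "(\<lambda>m. Z \<omega> (1 / real (Suc m)) 0) \<longlonglongrightarrow> Z \<omega> 0 0" by (rule filterlim_compose)
    then show "(\<lambda>m. 1 - Z \<omega> (1 / real (Suc m)) 0) \<longlonglongrightarrow> 1 - Z \<omega> 0 0" by (intro tendsto_intros)
  qed
  ultimately show ?thesis by simp
qed

text \<open>Order of choices: \<eta> makes the oscillation term small; then m makes the mesh term,
  the clustering term of the limit and the discretization error of the limit small; then n is taken
  large. The factor \<open>c\<close> grows with 1 / \<eta>, but it is fixed before m, and the mass
  missing from the largest component of the limit at time 1 / m tends to 0 in mean.\<close>

lemma lipschitz_tendsto:
  assumes g: "sk_lipschitz g K" and B: "\<And>x. x \<in> cadlag_space S_dec_le1 \<Longrightarrow> \<bar>g x\<bar> \<le> B"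
  shows "(\<lambda>n. \<integral>\<omega>. g (X n \<omega>) \<partial>M n) \<longlonglongrightarrow> (\<integral>\<omega>. g (Z \<omega>) \<partial>N)"
proof (rule LIMSEQ_I)
  fix \<epsilon> :: real assume \<epsilon>: "0 < \<epsilon>"
  define a where "a = \<bar>K\<bar> + 1"
  have a: "0 < a" "K \<le> a" by (auto simp: a_def)
  \<comment> \<open>Chosen so that \<open>a * sqrt \<eta>\<close> is \<epsilon> / 8; four terms of
    this size leave room below \<epsilon>.\<close>
  define \<eta> where "\<eta> = (\<epsilon> / (8 * a))\<^sup>2"
  have \<eta>: "0 < \<eta>" using \<epsilon> a by (simp add: \<eta>_def)
  have K\<eta>: "K * sqrt \<eta> \<le> \<epsilon> / 8"
  proof -
    have "K * sqrt \<eta> \<le> a * sqrt \<eta>" using \<eta> a by (intro mult_right_mono) auto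
    also have "\<dots> = \<epsilon> / 8" using \<epsilon> a by (simp add: \<eta>_def)
    finally show ?thesis .
  qed
  define c where "c = 4 * B * ((1 + 1 / \<eta>) / \<eta>)"
  let ?E = "\<lambda>m n. \<integral>\<omega>. g (discretize (Suc m) (X n \<omega>)) \<partial>M n"
  let ?F = "\<lambda>m. \<integral>\<omega>. g (discretize (Suc m) (Z \<omega>)) \<partial>N"
  let ?Y = "\<lambda>m. \<integral>\<omega>. 1 - Z \<omega> (1 / real (Suc m)) 0 \<partial>N"
  have "?F \<longlonglongrightarrow> (\<integral>\<omega>. g (Z \<omega>) \<partial>N)"
  proof (rule N.expectation_bounded_tendsto(2)[where B=B])
    show "(\<lambda>\<omega>. g (discretize (Suc m) (Z \<omega>))) \<in> borel_measurable N" for m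
      by (rule lipschitz_discretize_measurable[OF Z Z_coord g]) auto
    fix \<omega> assume \<omega>: "\<omega> \<in> space N"
    show "\<bar>g (discretize (Suc m) (Z \<omega>))\<bar> \<le> B" for m
      using cadlag_space_value[OF Z[OF \<omega>]] by (intro B discretize_cadlag) auto
    show "(\<lambda>m. g (discretize (Suc m) (Z \<omega>))) \<longlonglongrightarrow> g (Z \<omega>)"
      by (rule LIMSEQ_Suc[OF sk_lipschitz_discretize_tendsto[OF g Z[OF \<omega>]]])
  qed
  then have F: "\<forall>\<^sub>F m in sequentially. \<bar>?F m - (\<integral>\<omega>. g (Z \<omega>) \<partial>N)\<bar> < \<epsilon> / 8"
    using tendstoD[of ?F _ sequentially "\<epsilon> / 8"] \<epsilon> by (simp add: dist_real_def)
  have lim: "(\<lambda>m. K * (2 * (1 / real (Suc m))) + c * ?Y m) \<longlonglongrightarrow> K * (2 * 0) + c * 0"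
    by (intro tendsto_intros LIMSEQ_Suc[OF lim_1_over_n] limit_initial_mass)
  have "\<forall>\<^sub>F m in sequentially. K * (2 * (1 / real (Suc m))) + c * ?Y m < \<epsilon> / 8"
    by (rule order_tendstoD(2)[OF lim]) (use \<epsilon> in simp)
  with F have "\<forall>\<^sub>F m in sequentially. \<bar>?F m - (\<integral>\<omega>. g (Z \<omega>) \<partial>N)\<bar> < \<epsilon> / 8 \<and>
      K * (2 * (1 / real (Suc m))) + c * ?Y m < \<epsilon> / 8" by (rule eventually_conj)
  then obtain m where m: "\<bar>?F m - (\<integral>\<omega>. g (Z \<omega>) \<partial>N)\<bar> < \<epsilon> / 8"
    "K * (2 * (1 / real (Suc m))) + c * ?Y m < \<epsilon> / 8"
    by (auto dest: eventually_happens)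
  have "(\<lambda>n. K * (2 * (1 / real (Suc m))) + c * (\<integral>\<omega>. 1 - X n \<omega> (1 / real (Suc m)) 0 \<partial>M n))
      \<longlonglongrightarrow> K * (2 * (1 / real (Suc m))) + c * ?Y m"
    by (intro tendsto_intros largest_component_tendsto) simp
  then have "\<forall>\<^sub>F n in sequentially.
      K * (2 * (1 / real (Suc m))) + c * (\<integral>\<omega>. 1 - X n \<omega> (1 / real (Suc m)) 0 \<partial>M n) < \<epsilon> / 8"
    using order_tendstoD(2) m(2) by blast
  moreover have "\<forall>\<^sub>F n in sequentially. \<bar>?E m n - ?F m\<bar> < \<epsilon> / 8"
    using tendstoD[OF discretize_tendsto[OF g B, of "Suc m"], of "\<epsilon> / 8"] \<epsilon> by (simp add: dist_real_def)
  moreover note eventually_ge_at_top[of 1]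
  ultimately have "\<forall>\<^sub>F n in sequentially. norm ((\<integral>\<omega>. g (X n \<omega>) \<partial>M n) - (\<integral>\<omega>. g (Z \<omega>) \<partial>N)) < \<epsilon>"
  proof eventually_elim
    case (elim n)
    interpret random_tree_fragmentation "M n" "T n" "r n" "\<tau> n" by (rule trees[OF elim(3)])
    have "\<bar>(\<integral>\<omega>. g (X n \<omega>) \<partial>M n) - ?E m n\<bar>
        \<le> K * (sqrt \<eta> + 2 / real (Suc m)) + c * (\<integral>\<omega>. 1 - X n \<omega> (1 / real (Suc m)) 0 \<partial>M n)"
      using discretization_error[OF card[OF elim(3)] g B \<eta>, of "Suc m"] X_coord[OF elim(3)]
      unfolding X_def c_def by simp
    moreover have "K * (sqrt \<eta> + 2 / real (Suc m)) = K * sqrt \<eta> + K * (2 * (1 / real (Suc m)))"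
      by (simp add: algebra_simps)
    ultimately show ?case using K\<eta> elim m(1) \<epsilon> unfolding real_norm_def by linarith
  qed
  then show "\<exists>no. \<forall>n\<ge>no. norm ((\<integral>\<omega>. g (X n \<omega>) \<partial>M n) - (\<integral>\<omega>. g (Z \<omega>) \<partial>N)) < \<epsilon>"
    by (simp add: eventually_sequentially)
qed

text \<open>Only the lower bound needs proof: applied to \<open>- f\<close> it yields the upper one. Approximating \<open>f\<close>
  from below by Lipschitz envelopes replaces tightness and Prokhorov's theorem.\<close>

lemma continuous_eventually_gt:
  assumes f: "continuous_map (skorohod_J1 S_dec_le1) euclideanreal f"
    and B: "\<And>x. x \<in> cadlag_space S_dec_le1 \<Longrightarrow> \<bar>f x\<bar> \<le> B" and a: "a < (\<integral>\<omega>. f (Z \<omega>) \<partial>N)"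
  shows "\<forall>\<^sub>F n in sequentially. a < (\<integral>\<omega>. f (X n \<omega>) \<partial>M n)"
proof -
  have fB: "- B \<le> f x" "f x \<le> B" if "x \<in> cadlag_space S_dec_le1" for x using B[OF that] by auto
  have gL: "sk_lipschitz (lip_env f (real k)) (real k)" for k
    by (rule sk_lipschitz_lip_env[where B="- B"]) (use fB in auto)
  have g_le: "lip_env f (real k) x \<le> f x" and gB: "\<bar>lip_env f (real k) x\<bar> \<le> B"
    if "x \<in> cadlag_space S_dec_le1" for x k
  proof -
    show le: "lip_env f (real k) x \<le> f x" by (rule lip_env_le[where B="- B"]) (use fB that in auto)
    have "- B \<le> lip_env f (real k) x" by (rule lip_env_ge) (use fB that in auto)
    then show "\<bar>lip_env f (real k) x\<bar> \<le> B" using le fB[OF that] by (simp add: abs_le_iff)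
  qed
  have "(\<lambda>k. \<integral>\<omega>. lip_env f (real k) (Z \<omega>) \<partial>N) \<longlonglongrightarrow> (\<integral>\<omega>. f (Z \<omega>) \<partial>N)"
  proof (rule N.expectation_bounded_tendsto(2)[where B=B])
    show "(\<lambda>\<omega>. lip_env f (real k) (Z \<omega>)) \<in> borel_measurable N" for k
      by (rule lipschitz_process_measurable[OF Z Z_coord gL])
    show "\<bar>lip_env f (real k) (Z \<omega>)\<bar> \<le> B" if "\<omega> \<in> space N" for k \<omega> by (rule gB[OF Z[OF that]])
    show "(\<lambda>k. lip_env f (real k) (Z \<omega>)) \<longlonglongrightarrow> f (Z \<omega>)" if "\<omega> \<in> space N" for \<omega>
      by (rule lip_env_tendsto[OF fB(1) f Z[OF that]])
  qed
  then have "\<forall>\<^sub>F k in sequentially. a < (\<integral>\<omega>. lip_env f (real k) (Z \<omega>) \<partial>N)" using a by (rule order_tendstoD(1))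
  then obtain k where k: "a < (\<integral>\<omega>. lip_env f (real k) (Z \<omega>) \<partial>N)" by (auto dest: eventually_happens)
  have "\<forall>\<^sub>F n in sequentially. a < (\<integral>\<omega>. lip_env f (real k) (X n \<omega>) \<partial>M n)"
    by (rule order_tendstoD(1)[OF lipschitz_tendsto[OF gL gB] k])
  then show ?thesis
    using eventually_ge_at_top[of 1]
  proof eventually_elim
    case (elim n)
    interpret random_tree_fragmentation "M n" "T n" "r n" "\<tau> n" by (rule trees[OF elim(2)])
    note Xn = X_cadlag[OF elim(2)]
    have "(\<integral>\<omega>. lip_env f (real k) (X n \<omega>) \<partial>M n) \<le> (\<integral>\<omega>. f (X n \<omega>) \<partial>M n)"
    proof (rule integral_mono)
      have "(\<lambda>\<omega>. lip_env f (real k) (X n \<omega>)) \<in> borel_measurable (M n)"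
        by (rule lipschitz_process_measurable[OF Xn X_coord[OF elim(2)] gL])
      then show "integrable (M n) (\<lambda>\<omega>. lip_env f (real k) (X n \<omega>))"
        using gB[OF Xn] by (intro integrable_const_bound[where B=B]) auto
      have "(\<lambda>\<omega>. f (X n \<omega>)) \<in> borel_measurable (M n)"
        by (rule measurable_compose[OF process_measurable[OF Xn X_coord[OF elim(2)]] continuous_map_borel_measurable[OF f]])
      then show "integrable (M n) (\<lambda>\<omega>. f (X n \<omega>))"
        using B[OF Xn] by (intro integrable_const_bound[where B=B]) auto
      show "lip_env f (real k) (X n \<omega>) \<le> f (X n \<omega>)" if "\<omega> \<in> space (M n)" for \<omega> by (rule g_le[OF Xn[OF that]])
    qed
    then show ?case using elim(1) by linarith
  qed
qed

lemma skorohod_convergence: "converges_in_distribution (skorohod_J1 S_dec_le1) M X N Z"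
  unfolding converges_in_distribution_def
proof (intro conjI allI impI)
  show "X n \<in> measurable (M n) (borel_of (skorohod_J1 S_dec_le1))" if "1 \<le> n" for n
    by (rule process_measurable[OF X_cadlag[OF that] X_coord[OF that]])
  show "Z \<in> measurable N (borel_of (skorohod_J1 S_dec_le1))" by (rule process_measurable[OF Z Z_coord])
  fix f :: "(real \<Rightarrow> nat \<Rightarrow> real) \<Rightarrow> real"
  assume f: "continuous_map (skorohod_J1 S_dec_le1) euclideanreal f \<and> bounded (f ` topspace (skorohod_J1 S_dec_le1))"
  then obtain B where B: "\<And>x. x \<in> cadlag_space S_dec_le1 \<Longrightarrow> \<bar>f x\<bar> \<le> B"
    by (auto simp: bounded_iff topspace_skorohod_J1)
  show "(\<lambda>n. \<integral>\<omega>. f (X n \<omega>) \<partial>M n) \<longlonglongrightarrow> (\<integral>\<omega>. f (Z \<omega>) \<partial>N)"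
  proof (rule order_tendstoI)
    fix a assume "a < (\<integral>\<omega>. f (Z \<omega>) \<partial>N)"
    then show "\<forall>\<^sub>F n in sequentially. a < (\<integral>\<omega>. f (X n \<omega>) \<partial>M n)"
      using continuous_eventually_gt[of f B a] f B by blast
  next
    fix a assume "(\<integral>\<omega>. f (Z \<omega>) \<partial>N) < a"
    then have "- a < (\<integral>\<omega>. - f (Z \<omega>) \<partial>N)" by simp
    moreover have "continuous_map (skorohod_J1 S_dec_le1) euclideanreal (\<lambda>x. - f x)"
      using f by (intro continuous_map_minus) auto
    ultimately have "\<forall>\<^sub>F n in sequentially. - a < (\<integral>\<omega>. - f (X n \<omega>) \<partial>M n)"
      using B by (intro continuous_eventually_gt[of "\<lambda>x. - f x" B]) auto
    then show "\<forall>\<^sub>F n in sequentially. (\<integral>\<omega>. f (X n \<omega>) \<partial>M n) < a" by simp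
  qed
qed

end


section \<open>The limit has total mass at most one\<close>

text \<open>The truncated excess of a partial sum over 1 is bounded, continuous and zero on the
  prelimits, so its mean is 0 in the limit; being nonnegative, it vanishes almost surely.\<close>

lemma AE_partial_mass_le:
  fixes Y :: "'b \<Rightarrow> real \<Rightarrow> nat \<Rightarrow> real"
  assumes fdd: "fdd_converges (top_of_set S_dec) M X N Y" and N: "prob_space N" and t: "0 \<le> t"
    and X: "\<And>n \<omega>. 1 \<le> n \<Longrightarrow> \<omega> \<in> space (M n) \<Longrightarrow> X n \<omega> t \<in> S_dec_le1"
  shows "AE \<omega> in N. (\<Sum>j<J. Y \<omega> t j) \<le> 1"
proof -
  interpret prob_space N by (rule N)
  \<comment> \<open>Truncation of the sum at 2 makes the function bounded and leaves it positive
    whenever the sum exceeds 1.\<close>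
  define f where "f a = max 0 (min 2 (\<Sum>j<J. a (0::nat) j) - 1)" for a :: "nat \<Rightarrow> nat \<Rightarrow> real"
  have "continuous_map (fdd_space 1) (top_of_set S_dec) (\<lambda>a. a 0)"
    by (intro continuous_map_product_projection) simp
  moreover have "continuous_map (top_of_set S_dec) euclideanreal (\<lambda>a. max 0 (min 2 (\<Sum>j<J. a j) - 1))"
  proof -
    have c: "continuous_on S_dec (\<lambda>a::nat \<Rightarrow> real. a j)" for j
      by (rule continuous_on_subset[OF continuous_on_product_coordinates]) simp
    show ?thesis
      by (simp, intro continuous_on_max continuous_on_diff continuous_on_min continuous_on_const continuous_on_sum c)
  qed
  ultimately have fc: "continuous_map (fdd_space 1) euclideanreal f"
    using continuous_map_compose[of _ _ "\<lambda>a. a 0" _ "\<lambda>a. max 0 (min 2 (\<Sum>j<J. a j) - 1)"]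
    unfolding f_def by (simp only: o_def)
  have fb: "0 \<le> f a" "f a \<le> 1" for a by (auto simp: f_def)
  then have "bounded (f ` topspace (fdd_space 1))" by (auto simp: bounded_iff intro!: exI[of _ 1])
  then have conv: "converges_in_distribution (fdd_space 1) M (\<lambda>n \<omega>. \<lambda>i\<in>{..<1}. X n \<omega> t) N (\<lambda>\<omega>. \<lambda>i\<in>{..<1}. Y \<omega> t)"
    and lim: "(\<lambda>n. \<integral>\<omega>. f (\<lambda>i\<in>{..<1}. X n \<omega> t) \<partial>M n) \<longlonglongrightarrow> (\<integral>\<omega>. f (\<lambda>i\<in>{..<1}. Y \<omega> t) \<partial>N)"
    using fdd[unfolded fdd_converges_def, rule_format, of 1 "\<lambda>_. t"] t fc
    by (auto simp: converges_in_distribution_def)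
  have fX: "f (\<lambda>i\<in>{..<1}. X n \<omega> t) = 0" if "1 \<le> n" "\<omega> \<in> space (M n)" for n \<omega>
    using S_dec_le1_partial_sum[OF X[OF that], of J] by (simp add: f_def)
  have "(\<integral>\<omega>. f (\<lambda>i\<in>{..<1}. X n \<omega> t) \<partial>M n) = 0" if "1 \<le> n" for n
    using fX[OF that] by (simp cong: Bochner_Integration.integral_cong)
  then have "\<forall>\<^sub>F n in sequentially. (\<integral>\<omega>. f (\<lambda>i\<in>{..<1}. X n \<omega> t) \<partial>M n) = 0"
    using eventually_ge_at_top[of 1] by (rule eventually_mono[rotated])
  then have int0: "(\<integral>\<omega>. f (\<lambda>i\<in>{..<1}. Y \<omega> t) \<partial>N) = 0"
    by (intro LIMSEQ_unique[OF lim] tendsto_eventually)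
  have "(\<lambda>\<omega>. f (\<lambda>i\<in>{..<1}. Y \<omega> t)) \<in> borel_measurable N"
    using conv by (intro measurable_compose[OF _ continuous_map_borel_measurable[OF fc]])
      (simp add: converges_in_distribution_def)
  then have "integrable N (\<lambda>\<omega>. f (\<lambda>i\<in>{..<1}. Y \<omega> t))"
    using fb by (intro integrable_const_bound[where B=1]) auto
  then have "AE \<omega> in N. f (\<lambda>i\<in>{..<1}. Y \<omega> t) = 0"
    using integral_nonneg_eq_0_iff_AE[of N "\<lambda>\<omega>. f (\<lambda>i\<in>{..<1}. Y \<omega> t)"] int0 fb by simp
  then show ?thesis by eventually_elim (simp add: f_def max_def min_def split: if_splits)
qed

text \<open>If a partial sum exceeded 1 at some time, right-continuity would carry the excess to a
  rational time shortly after.\<close>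

lemma cadlag_S_dec_le1I:
  assumes y: "y \<in> cadlag_space S_dec"
    and mass: "\<And>q J. q \<in> \<rat> \<Longrightarrow> 0 \<le> q \<Longrightarrow> (\<Sum>j<J. y q j) \<le> 1"
  shows "y \<in> cadlag_space S_dec_le1"
  unfolding cadlag_space_S_dec_le1_iff
proof (intro conjI allI impI y S_dec_le1I cadlag_space_value[OF y])
  fix t :: real and J assume t: "0 \<le> t"
  have "(y \<longlongrightarrow> y t) (at_right t)" using y t by (simp add: cadlag_space_def)
  then have lim: "((\<lambda>s. \<Sum>j<J. y s j) \<longlongrightarrow> (\<Sum>j<J. y t j)) (at_right t)"
    by (intro tendsto_sum) (rule tendsto_fun_component)
  show "(\<Sum>j<J. y t j) \<le> 1"
  proof (rule ccontr)
    assume "\<not> ?thesis"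
    then have "\<forall>\<^sub>F s in at_right t. 1 < (\<Sum>j<J. y s j)" using order_tendstoD(1)[OF lim, of 1] by simp
    then obtain b where b: "t < b" "\<And>s. t < s \<Longrightarrow> s < b \<Longrightarrow> 1 < (\<Sum>j<J. y s j)"
      unfolding eventually_at_right_field by blast
    obtain q where "q \<in> \<rat>" "t < q" "q < b" using Rats_dense_in_real[OF b(1)] by blast
    then show False using b(2)[of q] mass[of q J] t by simp
  qed
qed

text \<open>The paths of \<open>Y\<close> have mass at most 1 only almost surely, whence the version
  \<open>Z\<close>; it agrees with \<open>Y\<close> off a null set, so finite-dimensional
  convergence carries over to it.\<close>

theorem theorem5p2:
  fixes M :: "nat \<Rightarrow> 'a measure"
    and T :: "nat \<Rightarrow> 'a \<Rightarrow> 'v::countable ugraph"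
    and r :: "nat \<Rightarrow> real"
    and \<tau> :: "nat \<Rightarrow> 'v set \<Rightarrow> 'a \<Rightarrow> real"
    and X :: "nat \<Rightarrow> 'a \<Rightarrow> real \<Rightarrow> nat \<Rightarrow> real"
    and N :: "'b measure"
    and Y :: "'b \<Rightarrow> real \<Rightarrow> nat \<Rightarrow> real"
  assumes "\<And>n. n \<ge> 1 \<Longrightarrow> prob_space (M n)"
    and "\<And>n. n \<ge> 1 \<Longrightarrow> T n \<in> measurable (M n) (count_space UNIV)"
    and "\<And>n \<omega>. n \<ge> 1 \<Longrightarrow> \<omega> \<in> space (M n) \<Longrightarrow> is_tree (T n \<omega>) \<and> card (fst (T n \<omega>)) = n"
    and "\<And>n. n \<ge> 1 \<Longrightarrow> r n > 0"
    and "\<And>n. n \<ge> 1 \<Longrightarrow> iid_exponential_clocks (M n) (T n) (r n) (\<tau> n)"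
    and "\<And>n \<omega>. X n \<omega> = fragmentation n (T n \<omega>) (\<lambda>e. \<tau> n e \<omega>)"
    and "prob_space N"
    and "Y \<in> measurable N (borel_of (skorohod_J1 S_dec))"
    and "fdd_converges (top_of_set S_dec) M X N Y"
  shows "\<exists>Z. (AE \<omega> in N. Z \<omega> = Y \<omega>) \<and>
           converges_in_distribution (skorohod_J1 S_dec_le1) M X N Z"
proof -
  have X: "X n \<omega> \<in> cadlag_space S_dec_le1" if "1 \<le> n" "\<omega> \<in> space (M n)" for n \<omega>
    using assms(3)[OF that] tree_finite[of "T n \<omega>"] unfolding assms(6) by (intro fragmentation_cadlag) auto
  have Y: "Y \<omega> \<in> cadlag_space S_dec" if "\<omega> \<in> space N" for \<omega>
    using measurable_space[OF assms(8) that] by (simp add: space_borel_of topspace_skorohod_J1)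
  have "AE \<omega> in N. \<forall>q\<in>\<rat> \<inter> {0..}. \<forall>J. (\<Sum>j<J. Y \<omega> q j) \<le> 1"
  proof (rule AE_ball_countable[THEN iffD2])
    show "countable (\<rat> \<inter> {0::real..})" by (simp add: countable_rat)
    show "\<forall>q\<in>\<rat> \<inter> {0..}. AE \<omega> in N. \<forall>J. (\<Sum>j<J. Y \<omega> q j) \<le> 1"
      unfolding AE_all_countable
      using AE_partial_mass_le[OF assms(9,7)] cadlag_space_value[OF X] by auto
  qed
  then have AE: "AE \<omega> in N. Y \<omega> \<in> cadlag_space S_dec_le1"
    using AE_space by eventually_elim (use Y in \<open>auto intro!: cadlag_S_dec_le1I\<close>)
  \<comment> \<open>A measurable null set containing the exceptional outcomes, so that redefining
    the path on it preserves measurability.\<close>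
  then obtain A where A: "{\<omega> \<in> space N. Y \<omega> \<notin> cadlag_space S_dec_le1} \<subseteq> A" "A \<in> null_sets N"
    by (auto simp: eventually_ae_filter)
  \<comment> \<open>A default path for the exceptional outcomes; the zero path shows that one
    exists.\<close>
  obtain z where z: "z \<in> cadlag_space S_dec_le1"
  proof -
    have "(\<lambda>_. 0) \<in> S_dec_le1" by (intro S_dec_le1I) (auto simp: S_dec_def decseq_def)
    then show ?thesis using that step_path_cadlag[of 1 "\<lambda>_ _. 0"] by simp
  qed
  define Z where "Z \<omega> = (if \<omega> \<in> A then z else Y \<omega>)" for \<omega>
  have AE_Z: "AE \<omega> in N. Z \<omega> = Y \<omega>"
    using AE_not_in[OF A(2)] by eventually_elim (simp add: Z_def)
  have "fdd_converges (top_of_set S_dec) M X N Z"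
    unfolding fdd_converges_def
  proof (intro allI impI)
    fix m :: nat and t :: "nat \<Rightarrow> real" assume t: "\<forall>i<m. 0 \<le> t i"
    have c: "converges_in_distribution (fdd_space m) M (\<lambda>n \<omega>. \<lambda>i\<in>{..<m}. X n \<omega> (t i)) N (\<lambda>\<omega>. \<lambda>i\<in>{..<m}. Y \<omega> (t i))"
      using assms(9) t by (simp add: fdd_converges_def)
    then have Ym: "(\<lambda>\<omega>. \<lambda>i\<in>{..<m}. Y \<omega> (t i)) \<in> measurable N (borel_of (fdd_space m))"
      by (simp add: converges_in_distribution_def)
    show "converges_in_distribution (fdd_space m) M (\<lambda>n \<omega>. \<lambda>i\<in>{..<m}. X n \<omega> (t i)) N (\<lambda>\<omega>. \<lambda>i\<in>{..<m}. Z \<omega> (t i))"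
    proof (rule converges_in_distribution_AE_cong[OF c])
      have zm: "(\<lambda>i\<in>{..<m}. z (t i)) \<in> topspace (fdd_space m)"
        using z t by (auto simp: cadlag_space_S_dec_le1_iff cadlag_space_value)
      have "(\<lambda>\<omega>. if \<omega> \<in> A then (\<lambda>i\<in>{..<m}. z (t i)) else (\<lambda>i\<in>{..<m}. Y \<omega> (t i))) \<in> measurable N (borel_of (fdd_space m))"
        using A(2) zm by (intro measurable_If_set[OF _ Ym]) (auto simp: space_borel_of)
      moreover have "(\<lambda>i\<in>{..<m}. Z \<omega> (t i)) = (if \<omega> \<in> A then (\<lambda>i\<in>{..<m}. z (t i)) else (\<lambda>i\<in>{..<m}. Y \<omega> (t i)))" for \<omega>
        by (simp add: Z_def)
      ultimately show "(\<lambda>\<omega>. \<lambda>i\<in>{..<m}. Z \<omega> (t i)) \<in> measurable N (borel_of (fdd_space m))" by simp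
      show "AE \<omega> in N. (\<lambda>i\<in>{..<m}. Z \<omega> (t i)) = (\<lambda>i\<in>{..<m}. Y \<omega> (t i))"
        using AE_Z by eventually_elim simp
    qed
  qed
  moreover have "Z \<omega> \<in> cadlag_space S_dec_le1" if "\<omega> \<in> space N" for \<omega>
    using A(1) z that by (auto simp: Z_def)
  moreover have "random_tree_fragmentation (M n) (T n) (r n) (\<tau> n)" if "1 \<le> n" for n
    using assms(1-5)[of n] that
    by (auto simp: random_tree_fragmentation_def random_tree_fragmentation_axioms_def)
  ultimately have "fragmentation_limit M T r \<tau> N Z X"
    using assms(3,6,7) by (intro fragmentation_limit.intro) auto
  then show ?thesis using AE_Z fragmentation_limit.skorohod_convergence by blast
qed

end
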